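(* Let $\mathbb{K}$ be a number field. Let $x\ge3$ be real and let $\omega,\tilde\omega:\mathcal{I}\to\mathbb{R}_{\ge0}$ be two functions such that, for both $w=\omega$ and $w=\tilde\omega$, \[ \sum_{\mathfrak{n}\in\mathcal{I}}d_5(\mathfrak{n})w(\mathfrak{n})\le X \] for some $X\ge1$. Suppose further that $Y>1$, $0\le\iota\le\mu<1$, $0<\kappa\le1/2$ and $M\in[x^\mu,x)$ are such that for any sequences $(a_\mathfrak{a})_{\mathfrak{a}\in\mathcal{I}},(b_\mathfrak{b})_{\mathfrak{b}\in\mathcal{I}}$ of complex numbers with $|a_\mathfrak{a}|\le d_3(\mathfrak{a})$ and $|b_\mathfrak{b}|\le d_3(\mathfrak{b})$, \[ \Big|\sum_{\substack{\mathfrak{a},\mathfrak{b}\in\mathcal{I}\\ \mathcal{N}(\mathfrak{a})\le M}}a_\mathfrak{a}(\omega(\mathfrak{ab})-\tilde\omega(\mathfrak{ab}))\Big|\le Y \quad\text{and}\quad \Big|\sum_{\substack{\mathfrak{a},\mathfrak{b}\in\mathcal{I}\\ x^{\mu-\iota}\le\mathcal{N}(\mathfrak{a})\le x^{\mu+\kappa}}}a_\mathfrak{a}b_\mathfrak{b}(\omega(\mathfrak{ab})-\tilde\omega(\mathfrak{ab}))\Big|\le Y . \] Let $(c_\mathfrak{r})_{\mathfrak{r}\in\mathcal{I}}$ be complex numbers with $|c_\mathfrak{r}|\le1$, and let $R>1/2$. If $R>x^{\mu+\kappa}/2$, suppose in addition that $2R\le x^{1-\mu}\le M$ and that, for $w=\omega$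 and $w=\tilde\omega$, \[ \sum_{\substack{\mathfrak{a}\in\mathcal{I}\\ \mathcal{N}(\mathfrak{a})\notin[x^{1-\iota},x]}}d_5(\mathfrak{a})w(\mathfrak{a})\le Y. \] Then \[ \Big|\sum_{\mathcal{N}(\mathfrak{r})\sim R}c_\mathfrak{r}\Phi_\mathfrak{r}(\omega,\mathfrak{q})-\sum_{\mathcal{N}(\mathfrak{r})\sim R}c_\mathfrak{r}\Phi_\mathfrak{r}(\tilde\omega,\mathfrak{q})\Big|\ll Y\log^3(xX) \] for every prime ideal $\mathfrak{q}\in\mathbb{P}$ such that $\mathcal{N}(\mathfrak{p})<x^\kappa$ whenever $\mathfrak{p}\prec\mathfrak{q}$, and \[ \Big|\sum_{\mathcal{N}(\mathfrak{r})\sim R}c_\mathfrak{r}S_\mathfrak{r}(\omega,x^\kappa)-\sum_{\mathcal{N}(\mathfrak{r})\sim R}c_\mathfrak{r}S_\mathfrak{r}(\tilde\omega,x^\kappa)\Big|\ll Y\log^3(xX), \] where the implied constants may depend on $\mathbb{K}$.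
   Context: $\mathcal{O}$ is the ring of integers of $\mathbb{K}$, $\mathcal{I}$ the set of non-zero ideals of $\mathcal{O}$, $\mathbb{P}$ the set of non-zero prime ideals, and $\mathcal{N}(\mathfrak{a})$ the absolute norm. A total order $\prec$ on $\mathbb{P}$ is fixed such that $\mathfrak{p}_2\prec\mathfrak{p}_1$ whenever $\mathcal{N}(\mathfrak{p}_2)<\mathcal{N}(\mathfrak{p}_1)$. For $z>0$ and $\mathfrak{q}\in\mathbb{P}$: $\Pi(z)=\prod_{\mathfrak{p}\in\mathbb{P},\,\mathcal{N}(\mathfrak{p})<z}\mathfrak{p}$ and $\Pi(\mathfrak{q})=\prod_{\mathfrak{p}\in\mathbb{P},\,\mathfrak{p}\prec\mathfrak{q}}\mathfrak{p}$ (empty products equal $\mathcal{O}$). For $w:\mathcal{I}\to\mathbb{C}$ and $\mathfrak{r}\in\mathcal{I}$: $S_\mathfrak{r}(w,z)=\sum_{\mathfrak{a}\in\mathcal{I},\,(\mathfrak{a},\Pi(z))=1}w(\mathfrak{ar})$ and $\Phi_\mathfrak{r}(w,\mathfrak{q})=\sum_{\mathfrak{a}\in\mathcal{I},\,(\mathfrak{a},\Pi(\mathfrak{q}))=1}w(\mathfrak{ar})$, where $(\mathfrak{a},\mathfrak{b})=1$ means coprime. $d_k(\mathfrak{a})$ is the number of ways to write $\mathfrak{a}$ as an ordered product of $k$ ideals. The condition $\mathcal{N}(\mathfrak{r})\sim R$ means $R\le\mathcal{N}(\mathfrak{r})<R_1$ for some fixed $R_1\in(R,2R]$. *)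

theory Defs
  imports
    "HOL-Analysis.Infinite_Sum"
    "HOL-Computational_Algebra.Polynomial"
    "HOL-Algebra.Ideal_Product"
    "HOL-Algebra.QuotRing"
begin

text \<open>
  A number field is a subfield \<open>K\<close> of an arbitrary field of characteristic zero that has finite
  dimension over the rationals. Taking \<open>K = UNIV\<close> covers every number field given as a type, and
  every number field is isomorphic to a subfield of the complex numbers.
\<close>

definition number_field :: "'a::field_char_0 set \<Rightarrow> bool" where
  "number_field K \<longleftrightarrow>
     1 \<in> K \<and>
     (\<forall>x\<in>K. \<forall>y\<in>K. x - y \<in> K \<and> x * y \<in> K) \<and>
     (\<forall>x\<in>K. inverse x \<in> K) \<and>
     (\<exists>B. finite B \<and> B \<subseteq> K \<and> K \<subseteq> module.span (\<lambda>q x. of_rat q * x) B)"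

definition ring_of_integers :: "'a::field_char_0 set \<Rightarrow> 'a ring" where
  "ring_of_integers K =
     \<lparr>carrier = {x \<in> K. algebraic_int x}, mult = (*), one = 1, zero = 0, add = (+)\<rparr>"

definition nz_ideals :: "'a::field_char_0 set \<Rightarrow> 'a set set" where
  "nz_ideals K = {\<aa>. ideal \<aa> (ring_of_integers K) \<and> \<aa> \<noteq> {0}}"

definition nz_primes :: "'a::field_char_0 set \<Rightarrow> 'a set set" where
  "nz_primes K = {\<pp>. primeideal \<pp> (ring_of_integers K) \<and> \<pp> \<noteq> {0}}"

definition abs_norm :: "'a::field_char_0 set \<Rightarrow> 'a set \<Rightarrow> nat" where
  "abs_norm K \<aa> = order (ring_of_integers K Quot \<aa>)"

abbreviation ideal_mult :: "'a::field_char_0 set \<Rightarrow> 'a set \<Rightarrow> 'a set \<Rightarrow> 'a set" where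
  "ideal_mult K \<equiv> ideal_prod (ring_of_integers K)"

definition coprime_ideals :: "'a::field_char_0 set \<Rightarrow> 'a set \<Rightarrow> 'a set \<Rightarrow> bool" where
  "coprime_ideals K \<aa> \<bb> \<longleftrightarrow>
     set_add (ring_of_integers K) \<aa> \<bb> = carrier (ring_of_integers K)"

definition divisor_fun :: "'a::field_char_0 set \<Rightarrow> nat \<Rightarrow> 'a set \<Rightarrow> nat" where
  "divisor_fun K k \<aa> =
     card {\<bb>s. length \<bb>s = k \<and> set \<bb>s \<subseteq> nz_ideals K \<and>
              foldr (ideal_mult K) \<bb>s (carrier (ring_of_integers K)) = \<aa>}"

definition prime_order :: "'a::field_char_0 set \<Rightarrow> ('a set \<Rightarrow> 'a set \<Rightarrow> bool) \<Rightarrow> bool" where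
  "prime_order K prec \<longleftrightarrow>
     irreflp_on (nz_primes K) prec \<and> transp_on (nz_primes K) prec \<and>
     totalp_on (nz_primes K) prec \<and>
     (\<forall>\<pp>\<^sub>1\<in>nz_primes K. \<forall>\<pp>\<^sub>2\<in>nz_primes K. abs_norm K \<pp>\<^sub>2 < abs_norm K \<pp>\<^sub>1 \<longrightarrow> prec \<pp>\<^sub>2 \<pp>\<^sub>1)"

text \<open>
  The products below run over finite sets, because there are only finitely many ideals of bounded
  norm. The unit of \<open>ideals_set\<close> is the whole ring, which is thus the value of the empty product.
\<close>

definition prime_prod_norm :: "'a::field_char_0 set \<Rightarrow> real \<Rightarrow> 'a set" where
  "prime_prod_norm K z =
     finprod (ideals_set (ring_of_integers K)) (\<lambda>\<pp>. \<pp>) {\<pp> \<in> nz_primes K. real (abs_norm K \<pp>) < z}"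

definition prime_prod_prec ::
    "'a::field_char_0 set \<Rightarrow> ('a set \<Rightarrow> 'a set \<Rightarrow> bool) \<Rightarrow> 'a set \<Rightarrow> 'a set" where
  "prime_prod_prec K prec \<qq> =
     finprod (ideals_set (ring_of_integers K)) (\<lambda>\<pp>. \<pp>) {\<pp> \<in> nz_primes K. prec \<pp> \<qq>}"

definition sieve_S ::
    "'a::field_char_0 set \<Rightarrow> 'a set \<Rightarrow> ('a set \<Rightarrow> complex) \<Rightarrow> real \<Rightarrow> complex" where
  "sieve_S K \<rr> w z =
     (\<Sum>\<^sub>\<infinity>\<aa>\<in>{\<aa> \<in> nz_ideals K. coprime_ideals K \<aa> (prime_prod_norm K z)}. w (ideal_mult K \<aa> \<rr>))"

definition sieve_\<Phi> ::
    "'a::field_char_0 set \<Rightarrow> ('a set \<Rightarrow> 'a set \<Rightarrow> bool) \<Rightarrow>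
     'a set \<Rightarrow> ('a set \<Rightarrow> complex) \<Rightarrow> 'a set \<Rightarrow> complex" where
  "sieve_\<Phi> K prec \<rr> w \<qq> =
     (\<Sum>\<^sub>\<infinity>\<aa>\<in>{\<aa> \<in> nz_ideals K. coprime_ideals K \<aa> (prime_prod_prec K prec \<qq>)}.
        w (ideal_mult K \<aa> \<rr>))"

text \<open>
  \<open>infsum\<close> is 0 for families that are not summable, so a bound for an infinite sum is read as
  including its convergence.
\<close>

definition sum_bounded_by ::
    "('i \<Rightarrow> 'b::real_normed_vector) \<Rightarrow> 'i set \<Rightarrow> real \<Rightarrow> bool" where
  "sum_bounded_by f A B \<longleftrightarrow> f summable_on A \<and> norm (infsum f A) \<le> B"

end

theory Submission
  imports Defs "HOL-Library.Multiset"
begin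

text \<open>
  The ideals coprime to a finite set \<open>Q\<close> of primes are detected by a Moebius sum over products \<open>d\<close> of
  primes in \<open>Q\<close>. The terms where the norm of \<open>r d\<close> is below a threshold form a Type I sum. In the
  others, building \<open>d\<close> from its largest prime downwards, the norm of \<open>r d\<close> (or of its complementary
  factor, when \<open>R\<close> is large) passes through the Type II range, because the primes in \<open>Q\<close> have norm
  below \<open>x powr \<kappa>\<close>. What remains is to decouple conditions \<open>i < j\<close> between the two Type II variables.
  The indicator of \<open>i < j\<close> for \<open>i, j < 2 ^ L\<close> is a combination, with weights adding up to \<open>L\<close>, of
  products of bounded functions of \<open>i\<close> and of \<open>j\<close>, which costs one logarithm for each condition.

  The integers of a number field form a finitely generated group because they are discrete in
  coordinates over the rationals, and ideals factor uniquely because every prime \<open>P\<close> has a fractional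
  inverse \<open>\<O> + \<gamma>\<O>\<close>. This identifies ideals with multisets of primes, on which the sieve is carried out.
\<close>

section \<open>Finitely generated groups and algebraic integers\<close>

text \<open>The bilinear hypotheses accept only coefficients that depend on one variable each and
  are bounded by d_3. A Moebius expansion violates both demands. The coefficient of
  \<open>a = r d\<close> is a sum over \<open>r\<close>; this is harmless, since terms bounded by 1
  summed over the divisors of \<open>a\<close> give at most d_2(a) <= d_3(a). The crossing
  condition, however, compares the least primes (for large R also norms) of both variables. Its
  separation is exact and finite, so it leaves no error term, but its cost is the number L of binary
  digits of what is compared. Hence L must be O(log x), and this requires an explicit polynomial
  bound for the number of primes in \<open>Q\<close>. A crude one suffices: a prime of norm at most
  n contains a positive integer j <= n, so it divides (j), whose norm is at most j to the power of
  the number of additive generators of the integers. The implied constant depends only on that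
  number. One comparison is separated in the small case and two in the large case, which leads to
  Y(3 + L + L^2). The weight d_5 makes all double divisor sums absolutely convergent, so that they
  may be rearranged.\<close>

lemma (in module) span_image_lessThan:
  "y \<in> span (f ` {..<m::nat}) \<longleftrightarrow> (\<exists>u. y = (\<Sum>k<m. scale (u k) (f k)))"
proof (induction m arbitrary: y)
  case 0
  then show ?case by simp
next
  case (Suc m)
  have "y \<in> span (f ` {..<Suc m}) \<longleftrightarrow> (\<exists>c. y - scale c (f m) \<in> span (f ` {..<m}))"
    by (simp add: lessThan_Suc span_breakdown_eq)
  also have "\<dots> \<longleftrightarrow> (\<exists>c u. y - scale c (f m) = (\<Sum>k<m. scale (u k) (f k)))"
    by (simp add: Suc)
  also have "\<dots> \<longleftrightarrow> (\<exists>u. y = (\<Sum>k<Suc m. scale (u k) (f k)))"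
  proof
    assume "\<exists>c u. y - scale c (f m) = (\<Sum>k<m. scale (u k) (f k))"
    then obtain c u where *: "y - scale c (f m) = (\<Sum>k<m. scale (u k) (f k))" by blast
    have "y = (\<Sum>k<Suc m. scale ((u(m := c)) k) (f k))"
      using * by (simp add: algebra_simps)
    then show "\<exists>u. y = (\<Sum>k<Suc m. scale (u k) (f k))" by blast
  next
    assume "\<exists>u. y = (\<Sum>k<Suc m. scale (u k) (f k))"
    then show "\<exists>c u. y - scale c (f m) = (\<Sum>k<m. scale (u k) (f k))"
      by (metis add_diff_cancel_right' sum.lessThan_Suc)
  qed
  finally show ?case .
qed

interpretation ZM: module "\<lambda>(k::int) (x::'a::field_char_0). of_int k * x"
  by unfold_locales (simp_all add: algebra_simps)

interpretation QV: vector_space "\<lambda>(q::rat) (x::'a::field_char_0). of_rat q * x"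
  by unfold_locales (simp_all add: algebra_simps of_rat_add of_rat_mult)

text \<open>As rewrite rules these would merge nested casts into one, against
  \<open>of_int_mult\<close>, \<open>of_rat_mult\<close> and associativity.\<close>

declare ZM.scale_scale [simp del] QV.scale_scale [simp del]

text \<open>Induction on the generators. The coefficients of the new generator \<open>a\<close> that
  occur in \<open>H\<close> form a subgroup \<open>J\<close> of the integers. An element
  \<open>h0\<close> of \<open>H\<close> over the least positive member of \<open>J\<close>, together
  with generators of the part of \<open>H\<close> in the old span, generates
  \<open>H\<close>.\<close>

lemma subgroup_of_fg:
  fixes S :: "'a::field_char_0 set"
  assumes "finite S" "ZM.subspace H" "H \<subseteq> ZM.span S"
  shows "\<exists>T. finite T \<and> ZM.span T = H"
  using assms
proof (induction S arbitrary: H rule: finite_induct)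
  case empty
  then have "H = {0}" using ZM.subspace_0 by auto
  then show ?case by (intro exI[of _ "{}"]) auto
next
  case (insert a S)
  define J where "J = {k::int. \<exists>h\<in>H. h - of_int k * a \<in> ZM.span S}"
  obtain T where T: "finite T" "ZM.span T = H \<inter> ZM.span S"
    using insert.IH[of "H \<inter> ZM.span S"] insert.prems ZM.subspace_inter by blast
  have J_ex: "\<exists>k\<in>J. h - of_int k * a \<in> ZM.span S" if "h \<in> H" for h
  proof -
    have "h \<in> ZM.span (insert a S)" using that insert.prems(2) by blast
    then obtain k where "h - of_int k * a \<in> ZM.span S"
      using ZM.span_breakdown_eq[of h a S] by blast
    then show ?thesis using that unfolding J_def by blast
  qed
  show ?case
  proof (cases "J \<subseteq> {0}")
    case True
    have "H \<subseteq> ZM.span S" using J_ex True by fastforce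
    then show ?thesis using T by (metis inf.absorb_iff1)
  next
    case False
    then obtain k where k: "k \<in> J" "k \<noteq> 0" by auto
    have neg: "- j \<in> J" if "j \<in> J" for j
    proof -
      from that obtain h where "h \<in> H" "h - of_int j * a \<in> ZM.span S" unfolding J_def by blast
      then have "- h \<in> H" "- h - of_int (- j) * a \<in> ZM.span S"
        using ZM.subspace_neg[OF insert.prems(1)] ZM.span_neg[of "h - of_int j * a"] by auto
      then show ?thesis unfolding J_def by blast
    qed
    define P where "P = (\<lambda>n::nat. n > 0 \<and> int n \<in> J)"
    have "P (nat \<bar>k\<bar>)" using k neg[of k] unfolding P_def by (auto simp: abs_if)
    define d where "d = (LEAST n. P n)"
    have d: "d > 0" "int d \<in> J" using LeastI[of P, OF \<open>P (nat \<bar>k\<bar>)\<close>] unfolding d_def P_def by auto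
    obtain h0 where h0: "h0 \<in> H" "h0 - of_int (int d) * a \<in> ZM.span S" using d J_def by auto
    have sub: "H \<subseteq> ZM.span (insert h0 T)"
    proof
      fix h assume h: "h \<in> H"
      then obtain j where j: "h - of_int j * a \<in> ZM.span S" using J_ex by auto
      \<comment> \<open>The remainder \<open>r\<close> is again in \<open>J\<close> and below its
        least positive member, hence 0.\<close>
      define q r where "q = j div int d" and "r = j mod int d"
      have jqr: "j = q * int d + r" unfolding q_def r_def by simp
      define g where "g = h - of_int q * h0"
      have gH: "g \<in> H" unfolding g_def using h h0 insert.prems(1)
        by (simp add: ZM.subspace_diff ZM.subspace_scale)
      have "h - of_int j * a - of_int q * (h0 - of_int (int d) * a) \<in> ZM.span S"
        by (intro ZM.span_diff j ZM.span_scale h0)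
      then have gr: "g - of_int r * a \<in> ZM.span S" unfolding g_def jqr by (simp add: algebra_simps)
      then have "r \<in> J" using gH J_def by auto
      have "r = 0"
      proof (rule ccontr)
        assume "r \<noteq> 0"
        moreover have "0 \<le> r" "r < int d" unfolding r_def using d by auto
        ultimately have "P (nat r)" "nat r < d" using \<open>r \<in> J\<close> unfolding P_def by auto
        then show False using not_less_Least[of "nat r" P] d_def by auto
      qed
      then have "g \<in> ZM.span T" using gr gH T by simp
      then show "h \<in> ZM.span (insert h0 T)" unfolding g_def ZM.span_breakdown_eq by blast
    qed
    have "insert h0 T \<subseteq> H" using h0 T ZM.span_superset[of T] by auto
    then have "ZM.span (insert h0 T) \<subseteq> H" using insert.prems(1) ZM.span_minimal by blast
    then show ?thesis using sub T by (intro exI[of _ "insert h0 T"]) auto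
  qed
qed

lemma algebraic_int_if_power_in_span:
  fixes x :: "'a::field_char_0"
  assumes "x ^ m \<in> ZM.span ((\<lambda>i. x ^ i) ` {..<m})"
  shows "algebraic_int x"
proof -
  obtain u where u: "x ^ m = (\<Sum>k<m. of_int (u k) * x ^ k)"
    using assms ZM.span_image_lessThan[of "x ^ m" "\<lambda>i. x ^ i" m] by auto
  define r :: "'a poly" where "r = (\<Sum>k<m. monom (of_int (u k)) k)"
  have coeff_r: "coeff r i = (if i < m then of_int (u i) else 0)" for i
    unfolding r_def by (simp add: coeff_sum if_distrib sum.delta cong: if_cong)
  define p where "p = monom 1 m - r"
  have coeff_p: "coeff p i = (if i = m then 1 else if i < m then - of_int (u i) else 0)" for i
    unfolding p_def by (simp add: coeff_r)
  have "degree p = m"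
  proof (rule antisym)
    show "degree p \<le> m" by (rule degree_le) (simp add: coeff_p)
    show "m \<le> degree p" by (rule le_degree) (simp add: coeff_p)
  qed
  then have "lead_coeff p = 1" by (simp add: coeff_p)
  moreover have "\<forall>i. coeff p i \<in> \<int>" by (simp add: coeff_p)
  moreover have "poly p x = 0"
    unfolding p_def r_def by (simp add: poly_monom poly_sum u)
  ultimately show ?thesis by (rule algebraic_int.intros)
qed

lemma algebraic_int_powers_in_span:
  fixes x :: "'a::field_char_0"
  assumes "algebraic_int x"
  obtains m where "\<And>k. x ^ k \<in> ZM.span ((\<lambda>i. x ^ i) ` {..<m})"
proof -
  obtain p where p: "poly (map_poly of_int p) x = 0" "lead_coeff p = 1"
    using assms by (auto simp: algebraic_int_altdef_ipoly)
  define m where "m = degree p"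
  let ?S = "ZM.span ((\<lambda>i. x ^ i) ` {..<m})"
  have "0 = (\<Sum>i\<le>m. of_int (coeff p i) * x ^ i)"
    using p(1) by (simp add: poly_altdef m_def degree_map_poly coeff_map_poly)
  also have "\<dots> = x ^ m + (\<Sum>i<m. of_int (coeff p i) * x ^ i)"
    using p(2) by (simp add: m_def flip: lessThan_Suc_atMost)
  finally have "x ^ m = - (\<Sum>i<m. of_int (coeff p i) * x ^ i)"
    by (simp add: eq_neg_iff_add_eq_0)
  moreover have "(\<Sum>i<m. of_int (coeff p i) * x ^ i) \<in> ?S"
    by (intro ZM.span_sum ZM.span_scale ZM.span_base) auto
  ultimately have xm: "x ^ m \<in> ?S" by (simp add: ZM.span_neg)
  have "x ^ k \<in> ?S" for k
  proof (induction k)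
    case 0
    have "x ^ 0 \<in> ?S" if "m > 0" using that by (intro ZM.span_base imageI) auto
    then show ?case using xm by (cases "m = 0") auto
  next
    case (Suc k)
    then obtain u where u: "x ^ k = (\<Sum>i<m. of_int (u i) * x ^ i)"
      using ZM.span_image_lessThan[of "x ^ k" "\<lambda>i. x ^ i" m] by auto
    have "x ^ Suc i \<in> ?S" if "i < m" for i
      using xm that by (cases "Suc i = m") (auto intro!: ZM.span_base simp del: power_Suc)
    then have "(\<Sum>i<m. of_int (u i) * x ^ Suc i) \<in> ?S"
      by (intro ZM.span_sum ZM.span_scale) auto
    also have "(\<Sum>i<m. of_int (u i) * x ^ Suc i) = x ^ Suc k"
      using u by (simp add: sum_distrib_left algebra_simps)
    finally show ?case .
  qed
  then show ?thesis using that by blast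
qed

text \<open>The group generated by all powers of \<open>x\<close> is finitely generated, and each
  generator involves finitely many powers, so some power is an integer combination of lower ones.
  The criterion yields sums and products of algebraic integers, and later the integrality of a
  multiplier that preserves an ideal.\<close>

lemma algebraic_int_if_powers_in_fg:
  fixes x :: "'a::field_char_0"
  assumes "finite S" "\<And>k. x ^ k \<in> ZM.span S"
  shows "algebraic_int x"
proof -
  let ?f = "\<lambda>i::nat. x ^ i"
  have "ZM.span (range ?f) \<subseteq> ZM.span S"
    using assms(2) by (intro ZM.span_minimal) auto
  then obtain T where T: "finite T" "ZM.span T = ZM.span (range ?f)"
    using subgroup_of_fg[OF assms(1)] ZM.subspace_span by blast
  have mono: "ZM.span (?f ` {..<m}) \<subseteq> ZM.span (?f ` {..<n})" if "m \<le> n" for m n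
    using that by (intro ZM.span_mono) auto
  have *: "\<exists>m. t \<in> ZM.span (?f ` {..<m})" if "t \<in> ZM.span (range ?f)" for t
    using that
  proof (induction rule: ZM.span_induct_alt)
    case base
    then show ?case by (auto intro: ZM.span_zero)
  next
    case (step c y z)
    then obtain m k where mk: "z \<in> ZM.span (?f ` {..<m})" "y = ?f k" by auto
    let ?n = "max m (Suc k)"
    have "y \<in> ZM.span (?f ` {..<?n})" using mk by (intro ZM.span_base) auto
    moreover have "z \<in> ZM.span (?f ` {..<?n})" using mk mono[of m ?n] by auto
    ultimately have "of_int c * y + z \<in> ZM.span (?f ` {..<?n})"
      by (intro ZM.span_add ZM.span_scale)
    then show ?case by blast
  qed
  have "\<exists>m. T \<subseteq> ZM.span (?f ` {..<m})"
  proof -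
    have "\<forall>t\<in>T. \<exists>m. t \<in> ZM.span (?f ` {..<m})"
      using * T(2) ZM.span_superset[of T] by blast
    then obtain g where g: "\<And>t. t \<in> T \<Longrightarrow> t \<in> ZM.span (?f ` {..<g t})" by metis
    have "t \<in> ZM.span (?f ` {..<Max (g ` T)})" if "t \<in> T" for t
      using g[OF that] mono[of "g t" "Max (g ` T)"] T(1) that by auto
    then show ?thesis by blast
  qed
  then obtain m where "T \<subseteq> ZM.span (?f ` {..<m})" by blast
  then have "ZM.span T \<subseteq> ZM.span (?f ` {..<m})" by (intro ZM.span_minimal) auto
  then have "x ^ m \<in> ZM.span (?f ` {..<m})" using T(2) ZM.span_base[of "x ^ m" "range ?f"] by auto
  then show ?thesis by (rule algebraic_int_if_power_in_span)
qed

lemma mult_in_ZM_span: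
  fixes x y :: "'a::field_char_0"
  assumes "x \<in> ZM.span A" "y \<in> ZM.span B"
  shows "x * y \<in> ZM.span ((\<lambda>(a, b). a * b) ` (A \<times> B))"
proof -
  have 1: "a * y \<in> ZM.span ((\<lambda>(a, b). a * b) ` (A \<times> B))" if "a \<in> A" for a
    using assms(2)
  proof (induction rule: ZM.span_induct_alt)
    case base
    then show ?case by (simp add: ZM.span_zero)
  next
    case (step c u v)
    have "a * u \<in> ZM.span ((\<lambda>(a, b). a * b) ` (A \<times> B))"
      using step that by (intro ZM.span_base) auto
    then have "of_int c * (a * u) + a * v \<in> ZM.span ((\<lambda>(a, b). a * b) ` (A \<times> B))"
      using step by (intro ZM.span_add ZM.span_scale)
    then show ?case by (simp add: algebra_simps)
  qed
  show ?thesis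
    using assms(1)
  proof (induction rule: ZM.span_induct_alt)
    case base
    then show ?case by (simp add: ZM.span_zero)
  next
    case (step c u v)
    have "of_int c * (u * y) + v * y \<in> ZM.span ((\<lambda>(a, b). a * b) ` (A \<times> B))"
      using step 1 by (intro ZM.span_add ZM.span_scale) auto
    then show ?case by (simp add: algebra_simps)
  qed
qed

text \<open>The products x^i y^j with i and j below the two degrees span a group containing every
  x^k y^l, hence all powers of the sum and of the product.\<close>

lemma
  fixes x y :: "'a::field_char_0"
  assumes "algebraic_int x" "algebraic_int y"
  shows algebraic_int_add: "algebraic_int (x + y)"
    and algebraic_int_mult: "algebraic_int (x * y)"
proof -
  obtain m where m: "\<And>k. x ^ k \<in> ZM.span ((\<lambda>i. x ^ i) ` {..<m})"
    using algebraic_int_powers_in_span assms(1) by blast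
  obtain n where n: "\<And>k. y ^ k \<in> ZM.span ((\<lambda>i. y ^ i) ` {..<n})"
    using algebraic_int_powers_in_span assms(2) by blast
  define S where "S = (\<lambda>(a, b). a * b) ` (((\<lambda>i. x ^ i) ` {..<m}) \<times> ((\<lambda>i. y ^ i) ` {..<n}))"
  have fin: "finite S" unfolding S_def by auto
  have *: "x ^ k * y ^ l \<in> ZM.span S" for k l
    unfolding S_def by (intro mult_in_ZM_span m n)
  have "(x + y) ^ k \<in> ZM.span S" for k
  proof -
    have "of_int (int (k choose i)) * (x ^ i * y ^ (k - i)) \<in> ZM.span S" for i
      by (intro ZM.span_scale *)
    then show ?thesis
      unfolding binomial_ring by (intro ZM.span_sum) (simp add: mult.assoc)
  qed
  then show "algebraic_int (x + y)" by (rule algebraic_int_if_powers_in_fg[OF fin])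
  have "(x * y) ^ k \<in> ZM.span S" for k using *[of k k] by (simp add: power_mult_distrib)
  then show "algebraic_int (x * y)" by (rule algebraic_int_if_powers_in_fg[OF fin])
qed

section \<open>Integers of a number field\<close>

lemma common_denominator:
  assumes "finite (A :: rat set)"
  shows "\<exists>D::int. D > 0 \<and> (\<forall>q\<in>A. of_int D * q \<in> \<int>)"
  using assms
proof (induction rule: finite_induct)
  case empty
  then show ?case by (intro exI[of _ 1]) auto
next
  case (insert q A)
  then obtain D :: int where D: "D > 0" "\<forall>q\<in>A. of_int D * q \<in> \<int>" by auto
  obtain a b where ab: "quotient_of q = (a, b)" by fastforce
  then have "b > 0" "q = of_int a / of_int b"
    using quotient_of_denom_pos quotient_of_div by blast+
  then have "of_int (b * D) * q = of_int (D * a)" by simp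
  moreover have "of_int (b * D) * r = of_int b * (of_int D * r)" for r :: rat by simp
  ultimately have "\<forall>r\<in>insert q A. of_int (b * D) * r \<in> \<int>"
    using D(2) by (metis Ints_mult Ints_of_int insert_iff)
  then show ?case using D(1) \<open>b > 0\<close> by (intro exI[of _ "b * D"]) simp
qed

locale numfield =
  fixes K :: "'a::field_char_0 set"
  assumes nf: "number_field K"
begin

lemma K_1: "1 \<in> K"
  and K_diff: "x \<in> K \<Longrightarrow> y \<in> K \<Longrightarrow> x - y \<in> K"
  and K_mult: "x \<in> K \<Longrightarrow> y \<in> K \<Longrightarrow> x * y \<in> K"
  and K_inverse: "x \<in> K \<Longrightarrow> inverse x \<in> K"
  using nf unfolding number_field_def by auto

lemma K_0: "0 \<in> K" using K_diff[OF K_1 K_1] by simp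
lemma K_neg: "x \<in> K \<Longrightarrow> - x \<in> K" using K_diff[OF K_0] by fastforce
lemma K_add: "x \<in> K \<Longrightarrow> y \<in> K \<Longrightarrow> x + y \<in> K" using K_diff[OF _ K_neg] by fastforce
lemma K_power: "x \<in> K \<Longrightarrow> x ^ n \<in> K" by (induction n) (auto simp: K_1 K_mult)
lemma K_of_nat: "of_nat n \<in> K" by (induction n) (auto simp: K_0 K_1 K_add)
lemma K_of_int: "of_int n \<in> K" by (cases n rule: int_cases2) (auto simp: K_of_nat K_neg)
lemma K_of_rat: "of_rat q \<in> K"
proof -
  obtain a b where "quotient_of q = (a, b)" by fastforce
  then have "b > 0" "q = of_int a / of_int b"
    using quotient_of_denom_pos quotient_of_div by blast+
  then show ?thesis
    by (simp add: of_rat_divide) (simp add: divide_inverse K_mult K_of_int K_inverse)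
qed

lemma subspace_K: "QV.subspace K"
  by (intro QV.subspaceI) (auto simp: K_0 K_add K_mult K_of_rat)

definition \<O> where "\<O> = {x \<in> K. algebraic_int x}"

lemma O_0: "0 \<in> \<O>" and O_1: "1 \<in> \<O>" and O_of_int: "of_int n \<in> \<O>" and O_of_nat: "of_nat k \<in> \<O>"
  by (auto simp: \<O>_def K_0 K_1 K_of_int K_of_nat)
lemma O_add: "x \<in> \<O> \<Longrightarrow> y \<in> \<O> \<Longrightarrow> x + y \<in> \<O>"
  and O_mult: "x \<in> \<O> \<Longrightarrow> y \<in> \<O> \<Longrightarrow> x * y \<in> \<O>"
  and O_neg: "x \<in> \<O> \<Longrightarrow> - x \<in> \<O>"
  by (auto simp: \<O>_def K_add K_mult K_neg algebraic_int_add algebraic_int_mult)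
lemma O_diff: "x \<in> \<O> \<Longrightarrow> y \<in> \<O> \<Longrightarrow> x - y \<in> \<O>" using O_add[OF _ O_neg] by fastforce
lemma O_K: "x \<in> \<O> \<Longrightarrow> x \<in> K" by (simp add: \<O>_def)

lemma subspace_O: "ZM.subspace \<O>"
  by (intro ZM.subspaceI) (auto simp: O_0 O_add O_mult O_of_int)

text \<open>Finite dimension forces a rational relation between some x^m and lower powers;
  multiplying \<open>x\<close> by a common denominator of its coefficients makes the equation monic
  and integral.\<close>

lemma integral_multiple:
  assumes "x \<in> K"
  obtains D :: nat where "D > 0" "of_nat D * x \<in> \<O>"
proof -
  obtain S where S: "finite S" "K \<subseteq> QV.span S"
    using nf unfolding number_field_def by auto
  let ?f = "\<lambda>i::nat. x ^ i"
  have "\<exists>m. x ^ m \<in> QV.span (?f ` {..<m})"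
  proof (rule ccontr)
    assume *: "\<not> ?thesis"
    have ind: "QV.independent (?f ` {..<m}) \<and> card (?f ` {..<m}) = m" for m
    proof (induction m)
      case 0
      then show ?case using QV.independent_empty by auto
    next
      case (Suc m)
      have 1: "x ^ m \<notin> QV.span (?f ` {..<m})" using * by blast
      then have 2: "x ^ m \<notin> ?f ` {..<m}" using QV.span_base[of "x ^ m" "?f ` {..<m}"] by metis
      have "?f ` {..<Suc m} = insert (x ^ m) (?f ` {..<m})" by (simp add: lessThan_Suc)
      then show ?case using Suc 1 2 QV.independent_insert[of "x ^ m" "?f ` {..<m}"] by simp
    qed
    have "?f ` {..<Suc (card S)} \<subseteq> QV.span S" using S K_power assms by auto
    then have "Suc (card S) \<le> card S"
      using QV.independent_span_bound[OF S(1), of "?f ` {..<Suc (card S)}"] ind[of "Suc (card S)"] by simp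
    then show False by simp
  qed
  then obtain m where "x ^ m \<in> QV.span (?f ` {..<m})" by blast
  then obtain u where u: "x ^ m = (\<Sum>k<m. of_rat (u k) * x ^ k)"
    using QV.span_image_lessThan[of "x ^ m" ?f m] by blast
  obtain D :: int where D: "D > 0" "\<forall>q\<in>u ` {..<m}. of_int D * q \<in> \<int>"
    using common_denominator[of "u ` {..<m}"] by auto
  define y where "y = of_int D * x"
  have "y ^ m = (\<Sum>k<m. of_rat (of_int (D ^ m) * u k) * x ^ k)"
    unfolding y_def by (simp add: power_mult_distrib u sum_distrib_left of_rat_mult of_rat_power mult.assoc)
  \<comment> \<open>D^m u_k x^k equals (D u_k) D^(m-1-k) (D x)^k, and D u_k is an integer, so the
    floor changes nothing.\<close>
  also have "\<dots> = (\<Sum>k<m. of_int (\<lfloor>of_int D * u k\<rfloor> * D ^ (m - Suc k)) * y ^ k)"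
  proof (rule sum.cong)
    fix k assume k: "k \<in> {..<m}"
    then have "of_int \<lfloor>of_int D * u k\<rfloor> = of_int D * u k" using D by (simp add: of_int_floor)
    then have 1: "of_int \<lfloor>of_int D * u k\<rfloor> = (of_rat (of_int D * u k) :: 'a)" by (metis of_rat_of_int_eq)
    have "m = Suc (m - Suc k + k)" using k by simp
    then have "D ^ m = D * D ^ (m - Suc k) * D ^ k" by (metis power_Suc power_add mult.assoc)
    then have 2: "of_int (D ^ m) = (of_int D * of_int D ^ (m - Suc k) * of_int D ^ k :: 'a)"
      by (metis of_int_mult of_int_power)
    show "of_rat (of_int (D ^ m) * u k) * x ^ k = of_int (\<lfloor>of_int D * u k\<rfloor> * D ^ (m - Suc k)) * y ^ k"
      unfolding of_int_mult 1 of_rat_mult of_rat_of_int_eq 2 y_def power_mult_distrib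
      by (simp add: mult_ac)
  qed simp
  finally have "y ^ m \<in> ZM.span ((\<lambda>i. y ^ i) ` {..<m})"
    unfolding ZM.span_image_lessThan
    by (rule exI[where x = "\<lambda>k. \<lfloor>of_int D * u k\<rfloor> * D ^ (m - Suc k)"])
  then have "algebraic_int y" by (rule algebraic_int_if_power_in_span)
  then have "of_nat (nat D) * x \<in> \<O>"
    using D assms by (simp add: \<O>_def y_def K_mult K_of_int)
  then show ?thesis using that[of "nat D"] D by simp
qed

text \<open>A spanning set is multiplied by denominators before a basis is extracted from it, so the
  basis consists of integers.\<close>

lemma integral_basis:
  obtains B where "finite B" "B \<subseteq> \<O>" "QV.independent B" "QV.span B = K"
proof -
  obtain S where S: "finite S" "S \<subseteq> K" "K \<subseteq> QV.span S"
    using nf unfolding number_field_def by auto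
  have "\<forall>s\<in>S. \<exists>D::nat. D > 0 \<and> of_nat D * s \<in> \<O>"
    using integral_multiple S(2) by (metis subsetD)
  then obtain D :: "'a \<Rightarrow> nat" where D: "\<And>s. s \<in> S \<Longrightarrow> D s > 0 \<and> of_nat (D s) * s \<in> \<O>" by metis
  define S' where "S' = (\<lambda>s. of_nat (D s) * s) ` S"
  have "s \<in> QV.span S'" if "s \<in> S" for s
  proof -
    have "of_rat (1 / of_nat (D s)) * (of_nat (D s) * s) \<in> QV.span S'"
      by (intro QV.span_scale QV.span_base) (use that S'_def in auto)
    then show ?thesis using D[OF that] by (simp add: of_rat_divide)
  qed
  then have "QV.span S \<subseteq> QV.span S'" by (intro QV.span_minimal) auto
  moreover obtain B where B: "B \<subseteq> S'" "QV.independent B" "S' \<subseteq> QV.span B"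
    using QV.maximal_independent_subset by blast
  moreover have "QV.span S' \<subseteq> QV.span B" using B by (intro QV.span_minimal) auto
  ultimately have "K \<subseteq> QV.span B" using S by blast
  have "S' \<subseteq> \<O>" using D S'_def by auto
  then have "B \<subseteq> \<O>" using B by auto
  moreover have "QV.span B \<subseteq> K"
    using calculation O_K by (intro QV.span_minimal subspace_K) auto
  moreover have "finite B" using B S finite_subset S'_def by blast
  ultimately show ?thesis using that B \<open>K \<subseteq> QV.span B\<close> by blast
qed

text \<open>Multiplication is continuous in coordinates, so the powers of an element with small coordinates
  tend to \<open>0\<close>; the powers of an algebraic integer have bounded denominators, so such an element is \<open>0\<close>.\<close>

lemma O_discrete:
  assumes B: "finite B" "QV.independent B" "QV.span B = K"
  obtains N :: nat where "N > 0"
    "\<And>y. y \<in> \<O> \<Longrightarrow> (\<And>b. b \<in> B \<Longrightarrow> of_nat N * \<bar>QV.representation B y b\<bar> \<le> 1) \<Longrightarrow> y = 0"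
proof -
  define rep where "rep = QV.representation B"
  have rep_sum: "(\<Sum>b\<in>B. of_rat (rep y b) * b) = y" if "y \<in> K" for y
    unfolding rep_def using QV.sum_representation_eq[OF B(2), of y B] that B by auto
  have BK: "b \<in> K" if "b \<in> B" for b using that B(3) QV.span_base[OF that] by auto
  have rep_add: "rep (x + y) = (\<lambda>b. rep x b + rep y b)" if "x \<in> K" "y \<in> K" for x y
    unfolding rep_def using that B by (intro QV.representation_add) auto
  have rep_scale: "rep (of_rat q * y) = (\<lambda>b. q * rep y b)" if "y \<in> K" for q y
    unfolding rep_def using that B by (intro QV.representation_scale) auto
  have rep_0: "rep 0 = (\<lambda>b. 0)" unfolding rep_def by (rule QV.representation_zero)
  have rep_sumf: "rep (sum f A) b = (\<Sum>i\<in>A. rep (f i) b)" if "\<And>i. i \<in> A \<Longrightarrow> f i \<in> K" for f :: "'i \<Rightarrow> 'a" and A b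
    unfolding rep_def using QV.representation_sum[OF B(2), of A f] that B(3) by simp
  define nm where "nm = (\<lambda>y. \<Sum>b\<in>B. \<bar>rep y b\<bar>)"
  have nm_nonneg: "nm y \<ge> 0" for y unfolding nm_def by (simp add: sum_nonneg)
  have nm_scale: "nm (of_rat q * y) = \<bar>q\<bar> * nm y" if "y \<in> K" for q y
    unfolding nm_def using that by (simp add: rep_scale abs_mult sum_distrib_left)
  have nm_sum: "nm (sum f A) \<le> (\<Sum>i\<in>A. nm (f i))" if "\<And>i. i \<in> A \<Longrightarrow> f i \<in> K" for f :: "'a \<Rightarrow> 'a" and A
  proof -
    have "nm (sum f A) = (\<Sum>b\<in>B. \<bar>\<Sum>i\<in>A. rep (f i) b\<bar>)"
      unfolding nm_def by (simp add: rep_sumf that)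
    also have "\<dots> \<le> (\<Sum>b\<in>B. \<Sum>i\<in>A. \<bar>rep (f i) b\<bar>)" by (intro sum_mono sum_abs)
    also have "\<dots> = (\<Sum>i\<in>A. nm (f i))" unfolding nm_def by (rule sum.swap)
    finally show ?thesis .
  qed
  \<comment> \<open>C dominates the sizes of 1 and of all products of basis elements, so
    \<open>nm\<close> is submultiplicative up to the factor C.\<close>
  define C where "C = 1 + nm 1 + (\<Sum>b\<in>B. \<Sum>b'\<in>B. nm (b * b'))"
  have C1: "C \<ge> 1" unfolding C_def by (simp add: nm_nonneg sum_nonneg)
  have C: "nm (b * b') \<le> C" if "b \<in> B" "b' \<in> B" for b b'
  proof -
    have "nm (b * b') \<le> (\<Sum>b'\<in>B. nm (b * b'))"
      using that B(1) by (intro member_le_sum) (auto simp: nm_nonneg)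
    also have "\<dots> \<le> (\<Sum>b\<in>B. \<Sum>b'\<in>B. nm (b * b'))"
      using that B(1) by (intro member_le_sum[where f="\<lambda>b. \<Sum>b'\<in>B. nm (b * b')"]) (auto simp: nm_nonneg sum_nonneg)
    also have "\<dots> \<le> C" using nm_nonneg[of 1] unfolding C_def by simp
    finally show ?thesis .
  qed
  have nm_mult: "nm (y * z) \<le> C * nm y * nm z" if "y \<in> K" "z \<in> K" for y z
  proof -
    have 1: "nm (b * z) \<le> C * nm z" if b: "b \<in> B" for b
    proof -
      have "b * z = (\<Sum>b'\<in>B. of_rat (rep z b') * (b * b'))"
        using rep_sum[OF \<open>z \<in> K\<close>] by (metis (no_types, lifting) mult.left_commute sum.cong sum_distrib_left)
      then have "nm (b * z) \<le> (\<Sum>b'\<in>B. nm (of_rat (rep z b') * (b * b')))"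
        using nm_sum[of B "\<lambda>b'. of_rat (rep z b') * (b * b')"] BK b by (simp add: K_mult K_of_rat)
      also have "\<dots> = (\<Sum>b'\<in>B. \<bar>rep z b'\<bar> * nm (b * b'))"
        using BK b by (intro sum.cong refl nm_scale) (auto simp: K_mult)
      also have "\<dots> \<le> (\<Sum>b'\<in>B. \<bar>rep z b'\<bar> * C)"
        using C b by (intro sum_mono mult_left_mono) auto
      also have "\<dots> = C * nm z" unfolding nm_def by (simp add: sum_distrib_left mult.commute)
      finally show ?thesis .
    qed
    have "y * z = (\<Sum>b\<in>B. of_rat (rep y b) * (b * z))"
      using rep_sum[OF \<open>y \<in> K\<close>] by (metis (no_types, lifting) mult.assoc sum.cong sum_distrib_right)
    then have "nm (y * z) \<le> (\<Sum>b\<in>B. nm (of_rat (rep y b) * (b * z)))"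
      using nm_sum[of B "\<lambda>b. of_rat (rep y b) * (b * z)"] BK that by (simp add: K_mult K_of_rat)
    also have "\<dots> = (\<Sum>b\<in>B. \<bar>rep y b\<bar> * nm (b * z))"
      using BK that by (intro sum.cong refl nm_scale) (auto simp: K_mult)
    also have "\<dots> \<le> (\<Sum>b\<in>B. \<bar>rep y b\<bar> * (C * nm z))"
      using 1 by (intro sum_mono mult_left_mono) auto
    also have "\<dots> = C * nm y * nm z" unfolding nm_def by (simp add: sum_distrib_left sum_distrib_right mult_ac)
    finally show ?thesis .
  qed
  have nm_pow: "nm (y ^ k) \<le> C * (C * nm y) ^ k" if "y \<in> K" for y k
  proof (induction k)
    case 0
    have "nm 1 \<le> C" unfolding C_def by (simp add: nm_nonneg sum_nonneg)
    then show ?case by simp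
  next
    case (Suc k)
    have "nm (y * y ^ k) \<le> C * nm y * nm (y ^ k)" using nm_mult that K_power by blast
    also have "\<dots> \<le> C * nm y * (C * (C * nm y) ^ k)"
      using Suc C1 nm_nonneg by (intro mult_left_mono) auto
    finally show ?case by (simp add: mult_ac)
  qed
  have small: "y = 0" if y: "y \<in> \<O>" and sm: "2 * (C * nm y) \<le> 1" for y
  proof -
    obtain m where m: "\<And>k. y ^ k \<in> ZM.span ((\<lambda>i. y ^ i) ` {..<m})"
      using algebraic_int_powers_in_span[of y] y \<O>_def by auto
    have yK: "y \<in> K" using y O_K by auto
    \<comment> \<open>Clearing denominators in the first m powers suffices, since every power is an
      integer combination of them.\<close>
    obtain D :: int where D: "D > 0" "\<forall>q\<in>(\<lambda>(i, b). rep (y ^ i) b) ` ({..<m} \<times> B). of_int D * q \<in> \<int>"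
      using common_denominator[of "(\<lambda>(i, b). rep (y ^ i) b) ` ({..<m} \<times> B)"] B(1) by auto
    have int: "of_int D * rep (y ^ k) b \<in> \<int>" if "b \<in> B" for k b
    proof -
      obtain u where u: "y ^ k = (\<Sum>i<m. of_int (u i) * y ^ i)"
        using m[of k] ZM.span_image_lessThan[of "y ^ k" "\<lambda>i. y ^ i" m] by blast
      have "rep (y ^ k) b = (\<Sum>i<m. rep (of_rat (of_int (u i)) * y ^ i) b)"
        unfolding u using yK by (subst rep_sumf) (auto simp: K_mult K_of_int K_power)
      also have "\<dots> = (\<Sum>i<m. of_int (u i) * rep (y ^ i) b)"
        using yK by (intro sum.cong refl) (simp only: rep_scale K_power)
      finally have "of_int D * rep (y ^ k) b = (\<Sum>i<m. of_int (u i) * (of_int D * rep (y ^ i) b))"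
        by (simp only: sum_distrib_left mult.left_commute)
      moreover have "of_int (u i) * (of_int D * rep (y ^ i) b) \<in> \<int>" if "i < m" for i
        using D(2) that \<open>b \<in> B\<close> by (auto intro: Ints_mult[OF Ints_of_int])
      ultimately show ?thesis by (auto intro!: Ints_sum)
    qed
    \<comment> \<open>With this k the size of y^k, at most C / 2^k, is below 1/D, whereas a nonzero
      coordinate would be at least 1/D.\<close>
    obtain k :: nat where k: "of_int D * C < 2 ^ k"
    proof -
      obtain n :: nat where "of_int D * C < of_nat n" using reals_Archimedean2 by blast
      also have "of_nat n < (2 ^ n :: rat)" by (rule of_nat_less_two_power)
      finally show ?thesis using that by blast
    qed
    have "y ^ k = 0"
    proof (rule ccontr)
      assume "y ^ k \<noteq> 0"
      then obtain b where b: "b \<in> B" "rep (y ^ k) b \<noteq> 0"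
        using rep_sum[OF K_power[OF yK], of k] by (metis (no_types, lifting) mult_zero_left of_rat_0 sum.neutral)
      have "1 \<le> \<bar>of_int D * rep (y ^ k) b\<bar>"
        using Ints_nonzero_abs_ge1[OF int[OF b(1)]] b D by simp
      also have "\<dots> = of_int D * \<bar>rep (y ^ k) b\<bar>" using D by (simp add: abs_mult)
      also have "\<dots> \<le> of_int D * nm (y ^ k)"
        unfolding nm_def using D b B(1) by (intro mult_left_mono member_le_sum[where f="\<lambda>b. \<bar>rep (y ^ k) b\<bar>"]) auto
      also have "\<dots> \<le> of_int D * (C * (C * nm y) ^ k)"
        using nm_pow[OF yK] D by (intro mult_left_mono) auto
      finally have "2 ^ k \<le> of_int D * C * (2 * (C * nm y)) ^ k"
        unfolding power_mult_distrib by (simp add: mult_ac)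
      also have "\<dots> \<le> of_int D * C * 1"
        using sm D C1 nm_nonneg[of y] by (intro mult_left_mono power_le_one) auto
      finally show False using k by simp
    qed
    then show ?thesis by simp
  qed
  \<comment> \<open>Coordinates of size at most 1/N bound \<open>nm y\<close> by
    \<open>card B\<close> / N; the summand 1 makes N positive.\<close>
  obtain N :: nat where N: "2 * C * of_nat (card B) + 1 \<le> of_nat N"
    using real_arch_simple by blast
  have "2 * C * of_nat (card B) \<ge> 0" using C1 by simp
  then have "0 < N" using N by (cases N) auto
  moreover have "y = 0" if "y \<in> \<O>" "\<And>b. b \<in> B \<Longrightarrow> of_nat N * \<bar>QV.representation B y b\<bar> \<le> 1" for y
  proof (rule small[OF that(1)])
    have "of_nat N * nm y \<le> of_nat (card B)"
      using sum_bounded_above[of B "\<lambda>b. of_nat N * \<bar>rep y b\<bar>" 1] that(2)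
      unfolding nm_def rep_def by (simp add: sum_distrib_left)
    then have "2 * C * (of_nat N * nm y) \<le> 2 * C * of_nat (card B)"
      using C1 by (intro mult_left_mono) auto
    also have "\<dots> \<le> of_nat N" using N by simp
    finally have "of_nat N * (2 * (C * nm y)) \<le> of_nat N * 1" by (simp add: mult_ac)
    then show "2 * (C * nm y) \<le> 1" using \<open>0 < N\<close> by (simp add: mult_le_cancel_left)
  qed
  ultimately show ?thesis using that by blast
qed

text \<open>By discreteness, elements whose fractional coordinates lie in the same small cell differ by an
  element of the lattice spanned by the basis.\<close>

lemma O_fg: obtains G where "finite G" "ZM.span G = \<O>"
proof -
  obtain B where B: "finite B" "B \<subseteq> \<O>" "QV.independent B" "QV.span B = K"
    by (rule integral_basis)
  obtain N :: nat where N: "N > 0"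
    "\<And>y. y \<in> \<O> \<Longrightarrow> (\<And>b. b \<in> B \<Longrightarrow> of_nat N * \<bar>QV.representation B y b\<bar> \<le> 1) \<Longrightarrow> y = 0"
    by (rule O_discrete[OF B(1) B(3) B(4)]) blast
  define rep where "rep = QV.representation B"
  define cell where "cell = (\<lambda>y. \<lambda>b\<in>B. \<lfloor>of_nat N * frac (rep y b)\<rfloor>)"
  have "cell y \<in> B \<rightarrow>\<^sub>E {0..<int N}" for y
  proof -
    have "of_nat N * frac q < of_nat N * 1" for q :: rat
      using N by (intro mult_strict_left_mono) (auto simp: frac_lt_1)
    then show ?thesis unfolding cell_def
      by (intro restrict_PiE_iff[THEN iffD2] ballI) (simp add: floor_less_iff)
  qed
  then have fin: "finite (cell ` \<O>)"
    using B(1) by (intro finite_subset[OF _ finite_PiE[of B "\<lambda>_. {0..<int N}"]]) auto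
  define ch where "ch = (\<lambda>c. SOME t. t \<in> \<O> \<and> cell t = c)"
  have ch: "ch (cell y) \<in> \<O> \<and> cell (ch (cell y)) = cell y" if "y \<in> \<O>" for y
    unfolding ch_def by (rule someI[of _ y]) (use that in auto)
  define G where "G = B \<union> ch ` cell ` \<O>"
  have "y \<in> ZM.span G" if y: "y \<in> \<O>" for y
  proof -
    define t where "t = ch (cell y)"
    have t: "t \<in> \<O>" "cell t = cell y" using ch[OF y] t_def by auto
    \<comment> \<open>\<open>k\<close> collects the differences of integer parts, so the coordinates
      of y - t - l are differences of fractional parts in the same cell.\<close>
    define k where "k = (\<lambda>b. \<lfloor>rep y b\<rfloor> - \<lfloor>rep t b\<rfloor>)"
    define l where "l = (\<Sum>b\<in>B. of_int (k b) * b)"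
    have lO: "l \<in> \<O>" unfolding l_def
      by (intro ZM.subspace_sum[OF subspace_O] ZM.subspace_scale[OF subspace_O]) (use B in auto)
    have repl: "rep l b = of_int (k b)" if "b \<in> B" for b
    proof -
      have "l = (\<Sum>b\<in>B. of_rat (of_int (k b)) * b)" unfolding l_def by simp
      moreover have "rep (\<Sum>b\<in>B. of_rat ((\<lambda>b. of_int (k b)) b) * b) b = (\<Sum>c\<in>B. rep (of_rat (of_int (k c)) * c) b)"
        unfolding rep_def using QV.representation_sum[OF B(3), of B "\<lambda>b. of_rat (of_int (k b)) * b"] B(4) B(2) O_K
        by (auto simp: K_mult K_of_rat K_of_int subset_iff)
      moreover have "rep (of_rat (of_int (k c)) * c) b = (if c = b then of_int (k c) else 0)" if "c \<in> B" for c
        unfolding rep_def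
        using QV.representation_scale[OF B(3), of c] QV.representation_basis[OF B(3), of c] that QV.span_base[of c B]
        by (auto simp del: of_rat_of_int_eq)
      ultimately show ?thesis using that B(1) by (simp add: sum.delta')
    qed
    have "y - t - l = 0"
    proof (rule N(2))
      show "y - t - l \<in> \<O>" using y t lO O_diff by auto
      fix b assume b: "b \<in> B"
      have "rep (y - t - l) b = rep y b - rep t b - rep l b"
        unfolding rep_def using B(3,4) y t lO O_K K_diff by (simp add: QV.representation_diff)
      also have "\<dots> = frac (rep y b) - frac (rep t b)" using repl[OF b] by (simp add: k_def frac_def)
      finally have "of_nat N * \<bar>QV.representation B (y - t - l) b\<bar>
          = \<bar>of_nat N * frac (rep y b) - of_nat N * frac (rep t b)\<bar>"
        unfolding rep_def[symmetric] by (metis abs_mult abs_of_nat right_diff_distrib)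
      moreover have "\<lfloor>of_nat N * frac (rep y b)\<rfloor> = \<lfloor>of_nat N * frac (rep t b)\<rfloor>"
        using fun_cong[OF t(2), of b] b by (simp add: cell_def)
      then have "\<bar>of_nat N * frac (rep y b) - of_nat N * frac (rep t b)\<bar> \<le> 1"
        by linarith
      ultimately show "of_nat N * \<bar>QV.representation B (y - t - l) b\<bar> \<le> 1" by simp
    qed
    then have "y = t + l" by (simp add: algebra_simps)
    moreover have "t \<in> ZM.span G" by (rule ZM.span_base) (use y in \<open>auto simp: G_def t_def\<close>)
    moreover have "l \<in> ZM.span G" unfolding l_def
      by (intro ZM.span_sum ZM.span_scale ZM.span_base) (auto simp: G_def)
    ultimately show ?thesis using ZM.span_add by auto
  qed
  moreover have "G \<subseteq> \<O>" unfolding G_def using B ch by auto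
  then have "ZM.span G \<subseteq> \<O>" by (intro ZM.span_minimal subspace_O)
  moreover have "finite G" using B fin G_def by auto
  ultimately show ?thesis using that by blast
qed

section \<open>The ring structure on the integers, and ideals as plain subsets of the field\<close>

abbreviation R where "R \<equiv> ring_of_integers K"

lemma R_simps [simp]:
  "carrier R = \<O>" "x \<otimes>\<^bsub>R\<^esub> y = x * y" "x \<oplus>\<^bsub>R\<^esub> y = x + y" "\<one>\<^bsub>R\<^esub> = 1" "\<zero>\<^bsub>R\<^esub> = 0"
  by (auto simp: ring_of_integers_def \<O>_def)

lemma cring_R: "cring R"
proof (rule cringI)
  show "abelian_group R"
  proof (rule abelian_groupI)
    show "\<exists>y\<in>carrier R. y \<oplus>\<^bsub>R\<^esub> x = \<zero>\<^bsub>R\<^esub>" if "x \<in> carrier R" for x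
      using that O_neg by (intro bexI[of _ "- x"]) auto
  qed (auto simp: O_add O_0)
  show "comm_monoid R"
    by (rule comm_monoidI) (auto simp: O_mult O_1)
qed (auto simp: algebra_simps)

sublocale cring R by (rule cring_R)

text \<open>Negation is multiplication by -1, so the subgroup axioms reduce to closure under
  addition. Later ideals are built and used through these closure conditions.\<close>

lemma ideal_iff:
  "ideal A R \<longleftrightarrow> A \<subseteq> \<O> \<and> 0 \<in> A \<and> (\<forall>x\<in>A. \<forall>y\<in>A. x + y \<in> A) \<and> (\<forall>x\<in>A. \<forall>r\<in>\<O>. r * x \<in> A)"
proof
  assume "ideal A R"
  then interpret A: ideal A R .
  have "A \<subseteq> \<O>" using A.a_subset by simp
  moreover have "0 \<in> A" using A.zero_closed by simp
  ultimately show "A \<subseteq> \<O> \<and> 0 \<in> A \<and> (\<forall>x\<in>A. \<forall>y\<in>A. x + y \<in> A) \<and> (\<forall>x\<in>A. \<forall>r\<in>\<O>. r * x \<in> A)"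
    using A.a_closed A.I_l_closed by auto
next
  assume *: "A \<subseteq> \<O> \<and> 0 \<in> A \<and> (\<forall>x\<in>A. \<forall>y\<in>A. x + y \<in> A) \<and> (\<forall>x\<in>A. \<forall>r\<in>\<O>. r * x \<in> A)"
  have neg: "- x \<in> A" if "x \<in> A" for x
    using *[THEN conjunct2, THEN conjunct2, THEN conjunct2] that O_neg[OF O_1] by (metis mult_minus1)
  have "\<ominus>\<^bsub>R\<^esub> x = - x" if "x \<in> \<O>" for x
    using that minus_equality[of "- x" x] O_neg by simp
  then have "subgroup A (add_monoid R)"
    using * neg by (intro add.subgroupI) (auto simp flip: a_inv_def)
  then show "ideal A R"
    using * by (intro idealI ring_axioms) (auto simp: mult.commute)
qed

lemma
  assumes "ideal A R"
  shows ideal_subset: "x \<in> A \<Longrightarrow> x \<in> \<O>" and ideal_0: "0 \<in> A"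
    and ideal_add: "x \<in> A \<Longrightarrow> y \<in> A \<Longrightarrow> x + y \<in> A"
    and ideal_lmult: "x \<in> A \<Longrightarrow> r \<in> \<O> \<Longrightarrow> r * x \<in> A"
    and ideal_rmult: "x \<in> A \<Longrightarrow> r \<in> \<O> \<Longrightarrow> x * r \<in> A"
    and ideal_diff: "x \<in> A \<Longrightarrow> y \<in> A \<Longrightarrow> x - y \<in> A"
proof -
  note * = assms[unfolded ideal_iff]
  show "x \<in> A \<Longrightarrow> x \<in> \<O>" "0 \<in> A" "x \<in> A \<Longrightarrow> y \<in> A \<Longrightarrow> x + y \<in> A" "x \<in> A \<Longrightarrow> r \<in> \<O> \<Longrightarrow> r * x \<in> A"
    using * by auto
  show "x \<in> A \<Longrightarrow> r \<in> \<O> \<Longrightarrow> x * r \<in> A" using * by (metis mult.commute)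
  have neg: "x \<in> A \<Longrightarrow> - x \<in> A" for x using * O_neg[OF O_1] by (metis mult_minus1)
  then show "x \<in> A \<Longrightarrow> y \<in> A \<Longrightarrow> x - y \<in> A" using * by (metis diff_conv_add_uminus)
qed

lemma ideal_whole: "ideal \<O> R" using oneideal by simp

lemma ideal_eq_whole_iff: "ideal A R \<Longrightarrow> A = \<O> \<longleftrightarrow> 1 \<in> A"
  using ideal_rmult[of A 1] ideal_subset[of A] O_1 by auto

lemma ideal_principal:
  assumes "a \<in> \<O>"
  shows "ideal ((\<lambda>r. r * a) ` \<O>) R" "a \<in> (\<lambda>r. r * a) ` \<O>"
proof -
  let ?A = "(\<lambda>r. r * a) ` \<O>"
  show "a \<in> ?A" using O_1 by force
  show "ideal ?A R"
    unfolding ideal_iff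
  proof (intro conjI ballI subsetI)
    show "0 \<in> ?A" using O_0 by force
    show "x \<in> \<O>" if "x \<in> ?A" for x using that assms O_mult by auto
    fix x assume "x \<in> ?A"
    then obtain r where r: "r \<in> \<O>" "x = r * a" by auto
    show "x + y \<in> ?A" if "y \<in> ?A" for y
      using that r O_add by (auto simp flip: distrib_right)
    show "s * x \<in> ?A" if "s \<in> \<O>" for s
      using that r O_mult by (auto simp flip: mult.assoc)
  qed
qed

text \<open>A + \<gamma>A is the product of \<open>A\<close> with the fractional ideal \<O> +
  \<gamma>\<O>, expressed without fractional ideals. It serves for inverting a prime and for
  dividing by one.\<close>

lemma ideal_add_multiple:
  fixes A and \<gamma> :: 'a
  defines "B \<equiv> {a + \<gamma> * b | a b. a \<in> A \<and> b \<in> A}"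
  assumes A: "ideal A R" and \<gamma>: "\<forall>x\<in>A. \<gamma> * x \<in> \<O>"
  shows "ideal B R" "A \<subseteq> B" "\<And>x. x \<in> A \<Longrightarrow> \<gamma> * x \<in> B"
proof -
  show "A \<subseteq> B" "\<And>x. x \<in> A \<Longrightarrow> \<gamma> * x \<in> B" unfolding B_def using ideal_0[OF A] by force+
  then have "0 \<in> B" using ideal_0[OF A] by auto
  then show "ideal B R" unfolding ideal_iff
  proof (intro conjI ballI subsetI)
    show "x \<in> \<O>" if "x \<in> B" for x using that ideal_subset[OF A] \<gamma> O_add B_def by auto
    fix x assume "x \<in> B"
    then obtain a b where ab: "a \<in> A" "b \<in> A" "x = a + \<gamma> * b" using B_def by auto
    show "x + y \<in> B" if y: "y \<in> B" for y
    proof -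
      from y obtain d e where de: "d \<in> A" "e \<in> A" "y = d + \<gamma> * e" using B_def by auto
      then have "x + y = (a + d) + \<gamma> * (b + e)" using ab by (simp add: algebra_simps)
      then show ?thesis unfolding B_def using ab de ideal_add[OF A] by blast
    qed
    show "r * x \<in> B" if "r \<in> \<O>" for r
    proof -
      have "r * x = r * a + \<gamma> * (r * b)" using ab by (simp add: algebra_simps)
      then show ?thesis unfolding B_def using ab that ideal_lmult[OF A] by blast
    qed
  qed
qed

section \<open>Residue classes\<close>

abbreviation coset where "coset A x \<equiv> (\<lambda>a. a + x) ` A"

definition cosets where "cosets A = coset A ` \<O>"

lemma coset_in_cosets: "x \<in> \<O> \<Longrightarrow> coset A x \<in> cosets A"
  unfolding cosets_def by (rule imageI)

lemma abs_norm_eq: "abs_norm K A = card (cosets A)"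
proof -
  have "a_r_coset R A x = coset A x" for x by (auto simp: a_r_coset_def')
  then have "a_rcosets\<^bsub>R\<^esub> A = cosets A"
    unfolding A_RCOSETS_def' cosets_def by auto
  then show ?thesis
    unfolding abs_norm_def order_def FactRing_def by simp
qed

lemma coset_eq_iff:
  assumes "ideal A R"
  shows "coset A x = coset A y \<longleftrightarrow> x - y \<in> A"
proof
  assume "coset A x = coset A y"
  then have "x \<in> coset A y" using ideal_0[OF assms] by force
  then show "x - y \<in> A" by auto
next
  assume *: "x - y \<in> A"
  show "coset A x = coset A y"
  proof (intro equalityI subsetI)
    fix z assume "z \<in> coset A x"
    then obtain a where "a \<in> A" "z = a + x" by auto
    then have "z = (a + (x - y)) + y" "a + (x - y) \<in> A" using * ideal_add[OF assms] by auto
    then show "z \<in> coset A y" by blast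
  next
    fix z assume "z \<in> coset A y"
    then obtain a where "a \<in> A" "z = a + y" by auto
    then have "z = (a - (x - y)) + x" "a - (x - y) \<in> A" using * ideal_diff[OF assms] by auto
    then show "z \<in> coset A x" by blast
  qed
qed

text \<open>A fixed choice: the number of these generators is what the implied constant depends
  on.\<close>

definition gens where "gens = (SOME G. finite G \<and> ZM.span G = \<O>)"

lemma gens: "finite gens" "ZM.span gens = \<O>"
  using someI_ex[of "\<lambda>G. finite G \<and> ZM.span G = \<O>"] O_fg unfolding gens_def by blast+

definition residue_of where "residue_of u = (\<Sum>g\<in>gens. of_nat (u g) * g)"

lemma residue_of_ex:
  assumes "x \<in> \<O>" "m > (0::nat)"
  obtains u y where "u \<in> gens \<rightarrow>\<^sub>E {0..<m}" "y \<in> \<O>" "x = residue_of u + of_nat m * y"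
proof -
  obtain k where k: "x = (\<Sum>g\<in>gens. of_int (k g) * g)"
    using assms gens ZM.span_finite[OF gens(1)] by auto
  define u where "u = (\<lambda>g\<in>gens. nat (k g mod int m))"
  define y where "y = (\<Sum>g\<in>gens. of_int (k g div int m) * g)"
  have gO: "g \<in> \<O>" if "g \<in> gens" for g using ZM.span_base[OF that] gens(2) by simp
  have "y \<in> \<O>" unfolding y_def
    by (intro ZM.subspace_sum[OF subspace_O] ZM.subspace_scale[OF subspace_O] gO)
  moreover have "u \<in> gens \<rightarrow>\<^sub>E {0..<m}"
    unfolding u_def restrict_PiE_iff using assms(2)
    by (auto simp: nat_less_iff)
  moreover have "x = residue_of u + of_nat m * y"
  proof -
    have "of_int (k g) * g = of_nat (u g) * g + of_nat m * (of_int (k g div int m) * g)" if "g \<in> gens" for g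
    proof -
      have "k g = int (u g) + int m * (k g div int m)"
        using that assms(2) by (simp add: u_def)
      then have "(of_int (k g) :: 'a) = of_nat (u g) + of_nat m * of_int (k g div int m)"
        by (metis of_int_add of_int_mult of_int_of_nat_eq)
      then show ?thesis by (simp add: algebra_simps)
    qed
    then show ?thesis unfolding k residue_of_def y_def
      by (simp add: sum_distrib_left sum.distrib[symmetric])
  qed
  ultimately show ?thesis using that by blast
qed

text \<open>As m lies in \<open>A\<close>, coefficients with respect to \<open>gens\<close> matter
  only modulo m, which leaves at most m choices for each generator.\<close>

lemma
  assumes A: "ideal A R" "of_nat m \<in> A" "m > 0"
  shows finite_cosets_aux: "finite (cosets A)"
    and card_cosets_le: "card (cosets A) \<le> m ^ card gens"
proof -
  let ?U = "gens \<rightarrow>\<^sub>E {0..<m}"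
  have fin: "finite ?U" using gens by (intro finite_PiE) auto
  have sub: "cosets A \<subseteq> (\<lambda>u. coset A (residue_of u)) ` ?U"
  proof
    fix C assume "C \<in> cosets A"
    then obtain x where x: "x \<in> \<O>" "C = coset A x" unfolding cosets_def by auto
    obtain u y where u: "u \<in> ?U" "y \<in> \<O>" "x = residue_of u + of_nat m * y"
      using residue_of_ex[OF x(1) A(3)] .
    then have "x - residue_of u \<in> A" using ideal_rmult[OF A(1,2), of y] by simp
    then show "C \<in> (\<lambda>u. coset A (residue_of u)) ` ?U"
      using x u coset_eq_iff[OF A(1)] by blast
  qed
  show "finite (cosets A)" using sub fin finite_subset by blast
  have "card (cosets A) \<le> card ?U" by (rule surj_card_le[OF fin sub])
  also have "\<dots> = m ^ card gens" using gens by (simp add: card_PiE)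
  finally show "card (cosets A) \<le> m ^ card gens" .
qed

text \<open>Such an ideal is a union of cosets of the principal ideal (m), of which there are
  finitely many.\<close>

lemma finite_ideals_containing:
  assumes "m > 0"
  shows "finite {A. ideal A R \<and> of_nat m \<in> A}"
proof -
  let ?J = "(\<lambda>r. r * of_nat m) ` \<O>"
  have "{A. ideal A R \<and> of_nat m \<in> A} \<subseteq> Union ` Pow (cosets ?J)"
  proof (intro subsetI image_eqI)
    fix A assume "A \<in> {A. ideal A R \<and> of_nat m \<in> A}"
    then have A: "ideal A R" "of_nat m \<in> A" by auto
    have "?J \<subseteq> A" using ideal_lmult[OF A] by auto
    then have "coset ?J a \<subseteq> A" if "a \<in> A" for a using ideal_add[OF A(1) _ that] by auto
    moreover have "a \<in> coset ?J a" for a using ideal_0[OF ideal_principal(1)[OF O_of_nat]] by force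
    ultimately show "A = \<Union> (coset ?J ` A)" by (auto simp only: UN_iff subset_iff)
    show "coset ?J ` A \<in> Pow (cosets ?J)"
      unfolding Pow_iff image_subset_iff by (intro ballI coset_in_cosets ideal_subset[OF A(1)])
  qed
  moreover have "finite (cosets ?J)" by (rule finite_cosets_aux[OF ideal_principal[OF O_of_nat] assms])
  ultimately show ?thesis by (meson finite_Pow_iff finite_imageI finite_subset)
qed

lemma nonzero_dvd_integer:
  assumes "a \<in> \<O>" "a \<noteq> 0"
  obtains m r where "m > 0" "r \<in> \<O>" "a * r = of_nat m"
proof -
  obtain m where m: "m > 0" "of_nat m * inverse a \<in> \<O>"
    using integral_multiple[OF K_inverse[OF O_K[OF assms(1)]]] by blast
  show ?thesis using that[OF m] assms(2) by simp
qed

lemma ideal_contains_integer: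
  assumes "ideal A R" "A \<noteq> {0}"
  obtains m where "m > 0" "of_nat m \<in> A"
proof -
  obtain a where a: "a \<in> A" "a \<noteq> 0" using assms ideal_0 by blast
  then obtain m r where "m > 0" "r \<in> \<O>" "a * r = of_nat m"
    using nonzero_dvd_integer[of a] ideal_subset[OF assms(1)] by metis
  then show ?thesis using that ideal_rmult[OF assms(1) a(1), of r] by metis
qed

lemma finite_cosets: "ideal A R \<Longrightarrow> A \<noteq> {0} \<Longrightarrow> finite (cosets A)"
  using ideal_contains_integer[of A] finite_cosets_aux by metis

lemma abs_norm_whole: "abs_norm K \<O> = 1"
proof -
  have "coset \<O> x = coset \<O> 0" if "x \<in> \<O>" for x
    unfolding coset_eq_iff[OF ideal_whole] using that by simp
  then have "cosets \<O> = {coset \<O> 0}" unfolding cosets_def using O_0 by blast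
  then show ?thesis unfolding abs_norm_eq by simp
qed

text \<open>Pigeonhole: two of the integers from 0 up to the norm lie in the same class, and their
  difference is in \<open>A\<close>.\<close>

lemma integer_le_norm_in_ideal:
  assumes "ideal A R" "A \<noteq> {0}"
  obtains j where "0 < j" "j \<le> abs_norm K A" "of_nat j \<in> A"
proof -
  let ?f = "\<lambda>i::nat. coset A (of_nat i)"
  let ?n = "abs_norm K A"
  have "card (?f ` {..?n}) \<le> ?n"
    unfolding abs_norm_eq using finite_cosets[OF assms] O_of_nat
    by (intro card_mono) (auto simp: cosets_def)
  then have "\<not> inj_on ?f {..?n}" using card_image[of ?f "{..?n}"] by fastforce
  then obtain i j where ij: "i \<le> ?n" "j \<le> ?n" "i < j" "?f i = ?f j"
    unfolding inj_on_def by (metis atMost_iff nat_neq_iff)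
  then have "of_nat j - of_nat i \<in> A" using coset_eq_iff[OF assms(1)] by metis
  then have "of_nat (j - i) \<in> A" using ij by (simp add: of_nat_diff)
  then show ?thesis using that[of "j - i"] ij by auto
qed

lemma finite_ideals_of_bounded_norm: "finite {A \<in> nz_ideals K. abs_norm K A \<le> n}"
proof (rule finite_subset)
  show "{A \<in> nz_ideals K. abs_norm K A \<le> n} \<subseteq> (\<Union>j\<in>{1..n}. {A. ideal A R \<and> of_nat j \<in> A})"
  proof
    fix A assume A: "A \<in> {A \<in> nz_ideals K. abs_norm K A \<le> n}"
    then obtain j where "0 < j" "j \<le> abs_norm K A" "of_nat j \<in> A"
      using integer_le_norm_in_ideal[of A] unfolding nz_ideals_def by blast
    then show "A \<in> (\<Union>j\<in>{1..n}. {A. ideal A R \<and> of_nat j \<in> A})"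
      using A unfolding nz_ideals_def by (intro UN_I[of j]) auto
  qed
  show "finite (\<Union>j\<in>{1..n}. {A. ideal A R \<and> of_nat j \<in> A})"
    using finite_ideals_containing by auto
qed

text \<open>Reduction from classes modulo \<open>A\<close> to classes modulo \<open>B\<close> is
  onto and identifies the class of some b outside \<open>A\<close> with that of 0. This makes the
  norm a measure for induction on ideals.\<close>

lemma abs_norm_strict_antimono:
  assumes A: "ideal A R" "A \<noteq> {0}" and B: "ideal B R" and "A \<subset> B"
  shows "abs_norm K B < abs_norm K A"
proof -
  define f where "f = (\<lambda>C. (\<lambda>(c, b). b + c) ` (C \<times> B))"
  have f: "f (coset A x) = coset B x" for x
  proof (intro equalityI subsetI)
    fix z assume "z \<in> f (coset A x)"
    then obtain a b where "a \<in> A" "b \<in> B" "z = (b + a) + x" unfolding f_def by (auto simp: add_ac)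
    then show "z \<in> coset B x" using ideal_add[OF B] \<open>A \<subset> B\<close> by auto
  next
    fix z assume "z \<in> coset B x"
    then obtain b where b: "b \<in> B" "z = b + (0 + x)" by auto
    have "(0 + x, b) \<in> coset A x \<times> B" using b ideal_0[OF A(1)] by auto
    then show "z \<in> f (coset A x)" unfolding f_def b(2) by force
  qed
  have img: "f ` cosets A = cosets B" unfolding cosets_def image_image f ..
  have fin: "finite (cosets A)" using finite_cosets A by auto
  have "card (cosets B) \<noteq> card (cosets A)"
  proof
    assume "card (cosets B) = card (cosets A)"
    then have inj: "inj_on f (cosets A)" using img fin eq_card_imp_inj_on by metis
    obtain b where b: "b \<in> B" "b \<notin> A" using \<open>A \<subset> B\<close> by auto
    have "coset B b = coset B 0" unfolding coset_eq_iff[OF B] using b by simp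
    then have "f (coset A b) = f (coset A 0)" unfolding f .
    then have "coset A b = coset A 0"
      by (rule inj_onD[OF inj]) (intro coset_in_cosets ideal_subset[OF B b(1)] O_0)+
    then show False unfolding coset_eq_iff[OF A(1)] using b by simp
  qed
  moreover have "card (cosets B) \<le> card (cosets A)" using img fin card_image_le by metis
  ultimately show ?thesis unfolding abs_norm_eq by simp
qed

section \<open>Unique factorization of ideals\<close>

lemma nz_primesD:
  assumes "P \<in> nz_primes K"
  shows "ideal P R" "P \<noteq> {0}" "primeideal P R" "P \<noteq> \<O>" "1 \<notin> P" "P \<in> nz_ideals K"
proof -
  show P: "primeideal P R" "P \<noteq> {0}" using assms by (auto simp: nz_primes_def)
  then show I: "ideal P R" by (simp add: primeideal.axioms)
  show "P \<noteq> \<O>" using primeideal.I_notcarr[OF P(1)] by simp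
  then show "1 \<notin> P" using ideal_eq_whole_iff[OF I] by simp
  show "P \<in> nz_ideals K" using P I by (simp add: nz_ideals_def)
qed

lemma nz_idealsD: "A \<in> nz_ideals K \<Longrightarrow> ideal A R" "A \<in> nz_ideals K \<Longrightarrow> A \<noteq> {0}"
  by (auto simp: nz_ideals_def)

lemma whole_nz: "\<O> \<in> nz_ideals K"
  using ideal_whole O_1 by (auto simp: nz_ideals_def)

lemma prime_mult:
  assumes "P \<in> nz_primes K" "a \<in> \<O>" "b \<in> \<O>" "a * b \<in> P"
  shows "a \<in> P \<or> b \<in> P"
  using primeideal.I_prime[OF nz_primesD(3)[OF assms(1)]] assms by simp

lemma O_power: "x \<in> \<O> \<Longrightarrow> x ^ n \<in> \<O>"
  by (induction n) (auto simp: O_1 O_mult)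

text \<open>The residue ring is finite, so two powers of an element \<open>x\<close> outside
  \<open>P\<close> agree modulo \<open>P\<close>. Cancelling the smaller one shows that some
  positive power of \<open>x\<close> is 1 modulo \<open>P\<close>, whence 1 lies in
  \<open>J\<close>.\<close>

lemma prime_maximal:
  assumes P: "P \<in> nz_primes K" and J: "ideal J R" "P \<subset> J"
  shows "J = \<O>"
proof -
  obtain x where x: "x \<in> J" "x \<notin> P" using J by auto
  have xO: "x \<in> \<O>" using ideal_subset[OF J(1) x(1)] .
  have "finite (range (\<lambda>i::nat. coset P (x ^ i)))"
    using finite_cosets[OF nz_primesD(1,2)[OF P]] coset_in_cosets O_power[OF xO]
    by (elim finite_subset[rotated]) blast
  then have "\<not> inj (\<lambda>i::nat. coset P (x ^ i))" using finite_imageD infinite_UNIV_nat by blast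
  then obtain i j :: nat where ij: "i < j" "coset P (x ^ j) = coset P (x ^ i)"
    unfolding inj_on_def by (metis nat_neq_iff)
  then have "x ^ j - x ^ i \<in> P" using coset_eq_iff[OF nz_primesD(1)[OF P]] by blast
  moreover have "x ^ j = x ^ i * x ^ (j - i)" using ij by (simp flip: power_add)
  ultimately have "x ^ i * (x ^ (j - i) - 1) \<in> P" by (simp add: algebra_simps)
  moreover have "x ^ i \<notin> P" for i
  proof (induction i)
    case 0
    then show ?case using nz_primesD(5)[OF P] by simp
  next
    case (Suc i)
    then show ?case using prime_mult[OF P xO O_power[OF xO]] x by auto
  qed
  ultimately have "x ^ (j - i) - 1 \<in> P"
    using prime_mult[OF P] O_power[OF xO] O_diff O_1 by blast
  then have 1: "x ^ (j - i) - 1 \<in> J" using J by auto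
  have "x ^ (j - i) = x * x ^ (j - i - 1)" using ij by (metis power_minus_mult mult.commute zero_less_diff)
  then have "x ^ (j - i) \<in> J" using ideal_rmult[OF J(1) x(1) O_power[OF xO]] by simp
  then have "x ^ (j - i) - (x ^ (j - i) - 1) \<in> J" using 1 ideal_diff[OF J(1)] by blast
  then show ?thesis using ideal_eq_whole_iff[OF J(1)] by simp
qed

lemma primes_subset_eq: "P \<in> nz_primes K \<Longrightarrow> Q \<in> nz_primes K \<Longrightarrow> P \<subseteq> Q \<Longrightarrow> P = Q"
  using prime_maximal nz_primesD(1,4) by blast

section \<open>Products of ideals over multisets\<close>

lemma ideal_mult_subsetI:
  assumes "\<And>x y. x \<in> A \<Longrightarrow> y \<in> B \<Longrightarrow> x * y \<in> C" "\<And>x y. x \<in> C \<Longrightarrow> y \<in> C \<Longrightarrow> x + y \<in> C"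
  shows "ideal_mult K A B \<subseteq> C"
proof
  fix z assume "z \<in> ideal_mult K A B"
  then show "z \<in> C" by (induction rule: ideal_prod.induct) (auto simp: assms)
qed

lemma mult_in_ideal_mult: "x \<in> A \<Longrightarrow> y \<in> B \<Longrightarrow> x * y \<in> ideal_mult K A B"
  using ideal_prod.prod[of x A y B R] by simp

lemma ideal_mult_nz:
  assumes "A \<in> nz_ideals K" "B \<in> nz_ideals K"
  shows "ideal_mult K A B \<in> nz_ideals K"
proof -
  obtain a b where "a \<in> A" "a \<noteq> 0" "b \<in> B" "b \<noteq> 0"
    using assms ideal_0 unfolding nz_ideals_def by blast
  then have "a * b \<in> ideal_mult K A B" "a * b \<noteq> 0" using mult_in_ideal_mult by auto
  then show ?thesis using assms ideal_prod_is_ideal by (auto simp: nz_ideals_def)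
qed

lemma ideal_mult_whole: "ideal A R \<Longrightarrow> ideal_mult K A \<O> = A"
  using ideal_prod_one by simp

lemma ideal_mult_subset: "ideal A R \<Longrightarrow> ideal B R \<Longrightarrow> ideal_mult K A B \<subseteq> A \<inter> B"
  by (rule ideal_prod_inter)

text \<open>Extending the product by the absorbing value \<open>{}\<close> makes it commutative on all sets, as
  \<open>fold_mset\<close> requires.\<close>

definition pmul where "pmul A B = (if ideal A R \<and> ideal B R then ideal_mult K A B else {})"

lemma not_ideal_empty: "\<not> ideal {} R" using ideal_0 by blast

interpretation pmul: comp_fun_commute pmul
proof
  fix A B
  show "pmul A \<circ> pmul B = pmul B \<circ> pmul A"
  proof
    fix C
    show "(pmul A \<circ> pmul B) C = (pmul B \<circ> pmul A) C"
    proof (cases "ideal A R \<and> ideal B R \<and> ideal C R")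
      case True
      then have "ideal_mult K A (ideal_mult K B C) = ideal_mult K B (ideal_mult K A C)"
        using ideal_prod_assoc[of A B C] ideal_prod_assoc[of B A C] ideal_prod_commute[of A B] by simp
      then show ?thesis using True by (simp add: pmul_def ideal_prod_is_ideal)
    next
      case False
      then show ?thesis by (auto simp: pmul_def not_ideal_empty)
    qed
  qed
qed

definition iprod where "iprod M = fold_mset pmul \<O> M"

lemma iprod_empty [simp]: "iprod {#} = \<O>"
  by (simp add: iprod_def)

lemma iprod_add_aux: "iprod (add_mset A M) = pmul A (iprod M)"
  by (simp add: iprod_def pmul.fold_mset_add_mset)

lemma iprod_nz: "set_mset M \<subseteq> nz_ideals K \<Longrightarrow> iprod M \<in> nz_ideals K"
proof (induction M)
  case empty
  then show ?case by (simp add: whole_nz)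
next
  case (add A M)
  then show ?case using ideal_mult_nz[of A "iprod M"]
    by (auto simp: iprod_add_aux pmul_def nz_idealsD(1))
qed

lemma iprod_add_mset:
  "set_mset M \<subseteq> nz_ideals K \<Longrightarrow> A \<in> nz_ideals K \<Longrightarrow> iprod (add_mset A M) = ideal_mult K A (iprod M)"
  using iprod_nz[of M] by (simp add: iprod_add_aux pmul_def nz_idealsD(1))

lemma iprod_union:
  "set_mset M \<subseteq> nz_ideals K \<Longrightarrow> set_mset N \<subseteq> nz_ideals K \<Longrightarrow> iprod (M + N) = ideal_mult K (iprod M) (iprod N)"
proof (induction M)
  case empty
  then have N: "ideal (iprod N) R" using iprod_nz[of N] nz_idealsD(1) by simp
  show ?case using ideal_mult_whole[OF N] ideal_prod_commute[OF N ideal_whole] by simp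
next
  case (add A M)
  then show ?case
    using ideal_prod_assoc[of A "iprod M" "iprod N"] iprod_nz[of M] iprod_nz[of N]
    by (simp add: iprod_add_mset nz_idealsD(1))
qed

abbreviation pmsets where "pmsets \<equiv> {M. set_mset M \<subseteq> nz_primes K}"

lemma primes_subset_ideals: "nz_primes K \<subseteq> nz_ideals K" using nz_primesD(6) by auto

lemma pmsets_nz: "M \<in> pmsets \<Longrightarrow> iprod M \<in> nz_ideals K"
  using iprod_nz primes_subset_ideals by blast

lemma iprod_add_prime: "P \<in> nz_primes K \<Longrightarrow> M \<in> pmsets \<Longrightarrow> iprod (add_mset P M) = ideal_mult K P (iprod M)"
  using iprod_add_mset primes_subset_ideals by blast

lemma iprod_plus: "M \<in> pmsets \<Longrightarrow> N \<in> pmsets \<Longrightarrow> iprod (M + N) = ideal_mult K (iprod M) (iprod N)"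
  using iprod_union primes_subset_ideals by blast

definition adjoin where "adjoin A x = {a + r * x | a r. a \<in> A \<and> r \<in> \<O>}"

lemma
  assumes "ideal A R" "x \<in> \<O>"
  shows ideal_adjoin: "ideal (adjoin A x) R" and subset_adjoin: "A \<subseteq> adjoin A x" and in_adjoin: "x \<in> adjoin A x"
proof -
  show "A \<subseteq> adjoin A x" "x \<in> adjoin A x"
    unfolding adjoin_def using O_0 O_1 ideal_0[OF assms(1)] by force+
  have "adjoin A x = set_add R A ((\<lambda>r. r * x) ` \<O>)" unfolding adjoin_def set_add_def' by auto
  then show "ideal (adjoin A x) R" using add_ideals[OF assms(1) ideal_principal(1)[OF assms(2)]] by simp
qed

text \<open>If \<open>A\<close> is neither the whole ring nor prime, there are x, y outside
  \<open>A\<close> with product in \<open>A\<close>. Both A + (x) and A + (y) have smaller norm, and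
  the product of the prime products found inside them lies in \<open>A\<close>.\<close>

lemma ideal_contains_prime_product:
  assumes "A \<in> nz_ideals K"
  shows "\<exists>M\<in>pmsets. iprod M \<subseteq> A"
  using assms
proof (induction "abs_norm K A" arbitrary: A rule: less_induct)
  case less
  have A: "ideal A R" "A \<noteq> {0}" using less.prems nz_idealsD by auto
  consider "A = \<O>" | "A \<in> nz_primes K" | "A \<noteq> \<O>" "A \<notin> nz_primes K" by blast
  then show ?case
  proof cases
    case 1
    then show ?thesis by (intro bexI[of _ "{#}"]) auto
  next
    case 2
    have "ideal_mult K A \<O> = A" using ideal_mult_whole A by auto
    then show ?thesis using 2 by (intro bexI[of _ "{#A#}"]) (auto simp: iprod_add_prime)
  next
    case 3
    then have "\<not> primeideal A R" using A by (auto simp: nz_primes_def)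
    then obtain x y where xy: "x \<in> \<O>" "y \<in> \<O>" "x * y \<in> A" "x \<notin> A" "y \<notin> A"
      using primeidealI[OF A(1) cring_R] 3 by auto
    have *: "\<exists>M\<in>pmsets. iprod M \<subseteq> adjoin A z" if "z \<in> \<O>" "z \<notin> A" for z
    proof -
      have sub: "A \<subset> adjoin A z" using subset_adjoin[OF A(1) that(1)] in_adjoin[OF A(1) that(1)] that(2) by auto
      then have "adjoin A z \<in> nz_ideals K"
        using ideal_adjoin[OF A(1) that(1)] A ideal_0[OF A(1)] by (auto simp: nz_ideals_def)
      moreover have "abs_norm K (adjoin A z) < abs_norm K A"
        using abs_norm_strict_antimono[OF A ideal_adjoin[OF A(1) that(1)] sub] .
      ultimately show ?thesis using less.hyps by blast
    qed
    obtain M N where MN: "M \<in> pmsets" "N \<in> pmsets" "iprod M \<subseteq> adjoin A x" "iprod N \<subseteq> adjoin A y"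
      using * xy by meson
    have "u * v \<in> A" if "u \<in> iprod M" "v \<in> iprod N" for u v
    proof -
      have "u \<in> adjoin A x" "v \<in> adjoin A y" using that MN by auto
      then obtain a r b s where ar: "a \<in> A" "r \<in> \<O>" "u = a + r * x"
        and bs: "b \<in> A" "s \<in> \<O>" "v = b + s * y" unfolding adjoin_def by blast
      have "u * v = a * v + (r * x) * b + (r * s) * (x * y)" using ar bs by (simp add: algebra_simps)
      moreover have "v \<in> \<O>" using bs xy ideal_subset[OF A(1)] by (simp add: O_add O_mult)
      ultimately show ?thesis
        using ar bs xy by (simp add: ideal_add[OF A(1)] ideal_lmult[OF A(1)] ideal_rmult[OF A(1)] O_mult)
    qed
    then have "ideal_mult K (iprod M) (iprod N) \<subseteq> A"
      by (intro ideal_mult_subsetI) (auto simp: ideal_add[OF A(1)])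
    then show ?thesis using MN iprod_plus[of M N] by (intro bexI[of _ "M + N"]) auto
  qed
qed

text \<open>A prime ideal containing a product contains a factor, and one nonzero prime contains
  another only if they are equal.\<close>

lemma prime_contains_iprod:
  assumes "P \<in> nz_primes K" "M \<in> pmsets" "iprod M \<subseteq> P"
  shows "P \<in># M"
  using assms(2,3)
proof (induction M)
  case empty
  then show ?case using nz_primesD(1,4)[OF assms(1)] ideal_subset by auto
next
  case (add Q M)
  then have Q: "Q \<in> nz_primes K" "M \<in> pmsets" by auto
  then have "Q \<subseteq> P \<or> iprod M \<subseteq> P"
    using add.prems(2) primeideal_divides_ideal_prod[OF nz_primesD(3)[OF assms(1)] nz_primesD(1)[OF Q(1)], of "iprod M"]
      pmsets_nz[OF Q(2)] nz_idealsD(1) iprod_add_prime by auto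
  then show ?case using primes_subset_eq[OF Q(1) assms(1)] add.IH Q by auto
qed

text \<open>For nonzero a in \<open>A\<close> all \<gamma>^k a lie in \<open>A\<close>, so all
  powers of \<gamma> lie in the finitely generated group obtained from \<open>gens\<close> by
  division by a.\<close>

lemma stable_multiplier_integral:
  assumes "ideal A R" "A \<noteq> {0}" "\<gamma> \<in> K" "\<And>x. x \<in> A \<Longrightarrow> \<gamma> * x \<in> A"
  shows "\<gamma> \<in> \<O>"
proof -
  obtain a where a: "a \<in> A" "a \<noteq> 0" using assms ideal_0 by blast
  have "\<gamma> ^ k * a \<in> A" for k by (induction k) (use a assms(4) in \<open>auto simp: mult.assoc\<close>)
  then have "\<gamma> ^ k * a \<in> ZM.span gens" for k using ideal_subset[OF assms(1)] gens(2) by auto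
  then have *: "\<gamma> ^ k * a * inverse a \<in> ZM.span ((\<lambda>(a, b). a * b) ` (gens \<times> {inverse a}))" for k
    by (intro mult_in_ZM_span) (auto intro: ZM.span_base)
  have "\<gamma> ^ k \<in> ZM.span ((\<lambda>(a, b). a * b) ` (gens \<times> {inverse a}))" for k
    using *[of k] a(2) by (simp add: mult.assoc)
  then have "algebraic_int \<gamma>" by (rule algebraic_int_if_powers_in_fg[rotated]) (use gens(1) in auto)
  then show ?thesis using assms(3) by (simp add: \<O>_def)
qed

text \<open>Take a nonzero a in \<open>P\<close> and a shortest product of primes inside (a).
  \<open>P\<close> is one of its factors; the product of the others is not inside (a), so it
  contains some b outside (a), and \<gamma> = b/a maps \<open>P\<close> into the integers without
  being integral. The last equation expresses by elements that \<open>P\<close> times \<O> +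
  \<gamma>\<O> is the whole ring.\<close>

lemma prime_invertible:
  assumes P: "P \<in> nz_primes K"
  obtains \<gamma> p p' where "\<gamma> \<in> K" "\<gamma> \<notin> \<O>" "\<And>x. x \<in> P \<Longrightarrow> \<gamma> * x \<in> \<O>" "p \<in> P" "p' \<in> P" "p + \<gamma> * p' = 1"
proof -
  note PI = nz_primesD[OF P]
  obtain a where a: "a \<in> P" "a \<noteq> 0" using PI ideal_0 by blast
  have aO: "a \<in> \<O>" using a PI ideal_subset by auto
  define A where "A = (\<lambda>r. r * a) ` \<O>"
  have A: "ideal A R" and "a \<in> A" unfolding A_def by (rule ideal_principal[OF aO])+
  then have "A \<in> nz_ideals K" using A a by (auto simp: nz_ideals_def)
  then obtain M0 where "M0 \<in> pmsets \<and> iprod M0 \<subseteq> A" using ideal_contains_prime_product by blast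
  from ex_has_least_nat[of "\<lambda>M. M \<in> pmsets \<and> iprod M \<subseteq> A", OF this, of size]
  obtain M where M: "M \<in> pmsets" "iprod M \<subseteq> A"
    and min: "\<And>N. N \<in> pmsets \<Longrightarrow> iprod N \<subseteq> A \<Longrightarrow> size M \<le> size N"
    by blast
  have "A \<subseteq> P" unfolding A_def using a ideal_lmult[OF PI(1)] by auto
  then have "P \<in># M" using prime_contains_iprod[OF P] M by auto
  then obtain N where N: "M = add_mset P N" by (metis multi_member_split)
  then have Np: "N \<in> pmsets" using M by auto
  then have "\<not> iprod N \<subseteq> A" using min[of N] N by auto
  then obtain b where b: "b \<in> iprod N" "b \<notin> A" by auto
  have bO: "b \<in> \<O>" using b pmsets_nz[OF Np] nz_idealsD ideal_subset by blast
  define \<gamma> where "\<gamma> = b * inverse a"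
  have gK: "\<gamma> \<in> K" unfolding \<gamma>_def using aO bO O_K K_mult K_inverse by auto
  have gnO: "\<gamma> \<notin> \<O>"
  proof
    assume "\<gamma> \<in> \<O>"
    then have "\<gamma> * a \<in> A" unfolding A_def by blast
    moreover have "\<gamma> * a = b" unfolding \<gamma>_def using a by simp
    ultimately show False using b by simp
  qed
  have gP: "\<gamma> * x \<in> \<O>" if "x \<in> P" for x
  proof -
    have "x * b \<in> A" using mult_in_ideal_mult[OF that b(1)] M(2) N iprod_add_prime[OF P Np] by auto
    then obtain r where "r \<in> \<O>" "x * b = r * a" unfolding A_def by auto
    then have "\<gamma> * x = r" unfolding \<gamma>_def using a by (simp add: field_simps)
    then show ?thesis using \<open>r \<in> \<O>\<close> by simp
  qed
  define J where "J = {p + \<gamma> * p' | p p'. p \<in> P \<and> p' \<in> P}"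
  have "\<forall>x\<in>P. \<gamma> * x \<in> \<O>" using gP by blast
  note J = ideal_add_multiple[OF PI(1) this, folded J_def]
  \<comment> \<open>Otherwise \<gamma> would preserve \<open>P\<close> and thus be integral. By
    maximality of \<open>P\<close>, the larger ideal P + \<gamma>P is everything.\<close>
  have "P \<noteq> J"
  proof
    assume "P = J"
    then have "\<gamma> * x \<in> P" if "x \<in> P" for x using J(3)[OF that] by simp
    then show False using stable_multiplier_integral[OF PI(1,2) gK] gnO by blast
  qed
  then have "J = \<O>" using prime_maximal[OF P J(1)] J(2) by blast
  then have "1 \<in> J" using O_1 by simp
  then obtain p p' where "p \<in> P" "p' \<in> P" "p + \<gamma> * p' = 1" unfolding J_def by auto
  then show ?thesis using that gK gnO gP by blast
qed

text \<open>The cofactor is \<open>A + \<gamma>A\<close>, since \<open>\<O> + \<gamma>\<O>\<close> is inverse to \<open>P\<close>.\<close>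

lemma factor_out_prime:
  assumes P: "P \<in> nz_primes K" and A: "A \<in> nz_ideals K" "A \<subseteq> P"
  obtains B where "B \<in> nz_ideals K" "A = ideal_mult K P B" "A \<subset> B"
proof -
  obtain \<gamma> p p' where g: "\<gamma> \<in> K" "\<gamma> \<notin> \<O>" "\<And>x. x \<in> P \<Longrightarrow> \<gamma> * x \<in> \<O>" "p \<in> P" "p' \<in> P" "p + \<gamma> * p' = 1"
    using prime_invertible[OF P] by blast
  note AI = nz_idealsD[OF A(1)]
  define B where "B = {a + \<gamma> * b | a b. a \<in> A \<and> b \<in> A}"
  have gA: "\<forall>x\<in>A. \<gamma> * x \<in> \<O>" using g(3) A(2) by auto
  note BI = ideal_add_multiple(1)[OF AI(1) gA, folded B_def]
    and AB = ideal_add_multiple(2)[OF AI(1) gA, folded B_def]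
    and gB = ideal_add_multiple(3)[OF AI(1) gA, folded B_def]
  have "B \<in> nz_ideals K" using BI AB AI ideal_0[OF AI(1)] by (auto simp: nz_ideals_def)
  moreover have "A \<noteq> B"
    using stable_multiplier_integral[OF AI g(1)] gB g(2) by blast
  moreover have "A = ideal_mult K P B"
  proof (rule equalityI)
    show "A \<subseteq> ideal_mult K P B"
    proof
      fix a assume a: "a \<in> A"
      have "a = (p + \<gamma> * p') * a" using g(6) by simp
      also have "\<dots> = p * a + p' * (\<gamma> * a)" by (simp add: algebra_simps)
      also have "\<dots> \<in> ideal_mult K P B"
        using ideal_prod.sum[of "p * a" R P B "p' * (\<gamma> * a)"] mult_in_ideal_mult[of p P a B]
          mult_in_ideal_mult[of p' P "\<gamma> * a" B] g AB gB a by auto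
      finally show "a \<in> ideal_mult K P B" .
    qed
    show "ideal_mult K P B \<subseteq> A"
    proof (rule ideal_mult_subsetI)
      fix x y assume x: "x \<in> P" and "y \<in> B"
      then obtain a b where ab: "a \<in> A" "b \<in> A" "y = a + \<gamma> * b" using B_def by auto
      have "x * y = x * a + (\<gamma> * x) * b" using ab by (simp add: algebra_simps)
      then show "x * y \<in> A"
        using ab g(3)[OF x] ideal_subset[OF nz_primesD(1)[OF P] x] ideal_add[OF AI(1)] ideal_lmult[OF AI(1)] by simp
    qed (rule ideal_add[OF AI(1)])
  qed
  ultimately show ?thesis using that AB by blast
qed

text \<open>Multiplication by the inverse of \<open>P\<close>: a = p a + \<gamma> (p' a), where p a
  and p' a lie in the product of \<open>P\<close> and \<open>B\<close>, which \<gamma> maps into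
  \<open>B\<close>.\<close>

lemma ideal_mult_prime_cancel:
  assumes P: "P \<in> nz_primes K" and A: "ideal A R" and B: "ideal B R"
    and sub: "ideal_mult K P A \<subseteq> ideal_mult K P B"
  shows "A \<subseteq> B"
proof
  fix a assume a: "a \<in> A"
  obtain \<gamma> p p' where g: "\<gamma> \<in> K" "\<gamma> \<notin> \<O>" "\<And>x. x \<in> P \<Longrightarrow> \<gamma> * x \<in> \<O>" "p \<in> P" "p' \<in> P" "p + \<gamma> * p' = 1"
    using prime_invertible[OF P] by blast
  have "ideal_mult K P B \<subseteq> {z \<in> B. \<gamma> * z \<in> B}"
  proof (rule ideal_mult_subsetI)
    fix x y assume xy: "x \<in> P" "y \<in> B"
    then show "x * y \<in> {z \<in> B. \<gamma> * z \<in> B}"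
      using ideal_lmult[OF B xy(2) g(3)[OF xy(1)]] ideal_lmult[OF B xy(2) ideal_subset[OF nz_primesD(1)[OF P]]]
      by (auto simp: mult.assoc)
  qed (auto simp: ideal_add[OF B] distrib_left)
  then have "p * a \<in> B" "\<gamma> * (p' * a) \<in> B"
    using mult_in_ideal_mult[of p P a A] mult_in_ideal_mult[of p' P a A] g a sub by auto
  moreover have "a = (p + \<gamma> * p') * a" using g(6) by simp
  then have "a = p * a + \<gamma> * (p' * a)" by (simp add: algebra_simps)
  ultimately show "a \<in> B" using ideal_add[OF B] by metis
qed

text \<open>A proper ideal of least norm among those containing \<open>A\<close> is maximal.\<close>

lemma contained_in_prime:
  assumes "A \<in> nz_ideals K" "A \<noteq> \<O>"
  obtains P where "P \<in> nz_primes K" "A \<subseteq> P"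
proof -
  let ?S = "\<lambda>J. ideal J R \<and> A \<subseteq> J \<and> J \<noteq> \<O>"
  have "?S A" using assms nz_idealsD by auto
  then obtain J where J: "?S J" and min: "\<And>L. ?S L \<Longrightarrow> abs_norm K J \<le> abs_norm K L"
    using ex_has_least_nat[of ?S A "abs_norm K"] by blast
  have nzJ: "J \<noteq> {0}" using J assms nz_idealsD ideal_0 by blast
  have "maximalideal J R"
  proof (rule maximalidealI)
    show "L = J \<or> L = carrier R" if "ideal L R" "J \<subseteq> L" "L \<subseteq> carrier R" for L
    proof (rule ccontr)
      assume "\<not> ?thesis"
      then have "J \<subset> L" "?S L" using that J by auto
      then show False using min[of L] abs_norm_strict_antimono[of J L] J nzJ that by fastforce
    qed
  qed (use J in auto)
  then have "primeideal J R" by (rule maximalideal_prime)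
  then show ?thesis using that J nzJ by (auto simp: nz_primes_def)
qed

lemma iprod_surj:
  assumes "A \<in> nz_ideals K"
  shows "\<exists>M\<in>pmsets. A = iprod M"
  using assms
proof (induction "abs_norm K A" arbitrary: A rule: less_induct)
  case less
  show ?case
  proof (cases "A = \<O>")
    case True
    then show ?thesis by (intro bexI[of _ "{#}"]) auto
  next
    case False
    obtain P where P: "P \<in> nz_primes K" "A \<subseteq> P" using contained_in_prime[OF less.prems False] .
    obtain B where B: "B \<in> nz_ideals K" "A = ideal_mult K P B" "A \<subset> B"
      using factor_out_prime[OF P(1) less.prems P(2)] .
    have "abs_norm K B < abs_norm K A"
      using abs_norm_strict_antimono B(3) nz_idealsD[OF less.prems] nz_idealsD[OF B(1)] by blast
    then obtain M where "M \<in> pmsets" "B = iprod M" using less.hyps B(1) by blast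
    then show ?thesis using P(1) B(2) iprod_add_prime by (intro bexI[of _ "add_mset P M"]) auto
  qed
qed

lemma iprod_subset_prime_iff:
  assumes "P \<in> nz_primes K" "M \<in> pmsets"
  shows "iprod M \<subseteq> P \<longleftrightarrow> P \<in># M"
proof
  assume "P \<in># M"
  then obtain N where N: "M = add_mset P N" by (metis multi_member_split)
  then have Np: "N \<in> pmsets" using assms by auto
  show "iprod M \<subseteq> P"
    using iprod_add_prime[OF assms(1) Np] N
      ideal_mult_subset[OF nz_primesD(1)[OF assms(1)] nz_idealsD(1)[OF pmsets_nz[OF Np]]] by simp
qed (use prime_contains_iprod assms in blast)

lemma iprod_inj:
  assumes "M \<in> pmsets" "N \<in> pmsets" "iprod M = iprod N"
  shows "M = N"
  using assms
proof (induction M arbitrary: N)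
  case empty
  show ?case
  proof (rule ccontr)
    assume "{#} \<noteq> N"
    then obtain P where "P \<in># N" by (metis multiset_nonemptyE)
    then show False
      using empty iprod_subset_prime_iff[of P N] nz_primesD(5)[of P] O_1 by auto
  qed
next
  case (add P M)
  then have P: "P \<in> nz_primes K" "M \<in> pmsets" by auto
  have "iprod N \<subseteq> P"
    using iprod_subset_prime_iff[OF P(1) add.prems(1)] add.prems(3) by simp
  then have "P \<in># N" by (rule prime_contains_iprod[OF P(1) add.prems(2)])
  then obtain N' where N': "N = add_mset P N'" by (metis multi_member_split)
  then have N'p: "N' \<in> pmsets" using add.prems by auto
  then have eq: "ideal_mult K P (iprod M) = ideal_mult K P (iprod N')"
    using add.prems(3) P N' iprod_add_prime by simp
  have "iprod M = iprod N'"
    using ideal_mult_prime_cancel[OF P(1) nz_idealsD(1)[OF pmsets_nz[OF P(2)]] nz_idealsD(1)[OF pmsets_nz[OF N'p]]]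
      ideal_mult_prime_cancel[OF P(1) nz_idealsD(1)[OF pmsets_nz[OF N'p]] nz_idealsD(1)[OF pmsets_nz[OF P(2)]]] eq
    by simp
  then show ?case using add.IH[OF P(2) N'p] N' by simp
qed

lemma bij_betw_iprod: "bij_betw iprod pmsets (nz_ideals K)"
  unfolding bij_betw_def
proof
  show "inj_on iprod pmsets" using iprod_inj by (intro inj_onI)
  show "iprod ` pmsets = nz_ideals K" using iprod_surj pmsets_nz by blast
qed

text \<open>To contain is to divide: the primes of \<open>M\<close> are split off from
  \<open>A\<close> one at a time, and what remains is factored by \<open>iprod_surj\<close>.\<close>

lemma subset_imp_dvd:
  assumes "M \<in> pmsets" "A \<in> nz_ideals K" "A \<subseteq> iprod M"
  obtains N where "N \<in> pmsets" "A = iprod (M + N)"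
proof -
  have "\<exists>N\<in>pmsets. A = iprod (M + N)" using assms
  proof (induction M arbitrary: A)
    case empty
    then show ?case using iprod_surj by simp
  next
    case (add P M)
    then have P: "P \<in> nz_primes K" "M \<in> pmsets" by auto
    have M: "ideal (iprod M) R" using P pmsets_nz nz_idealsD by auto
    have sub: "A \<subseteq> ideal_mult K P (iprod M)" using add.prems iprod_add_prime[OF P] by simp
    also have "\<dots> \<subseteq> P" using ideal_mult_subset[OF nz_primesD(1)[OF P(1)] M] by auto
    finally obtain B where B: "B \<in> nz_ideals K" "A = ideal_mult K P B"
      using factor_out_prime[OF P(1) add.prems(2)] by blast
    then have "B \<subseteq> iprod M" using ideal_mult_prime_cancel[OF P(1) _ M] nz_idealsD(1) sub by blast
    then obtain N where N: "N \<in> pmsets" "B = iprod (M + N)" using add.IH[OF P(2) B(1)] by blast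
    then have "A = iprod (add_mset P (M + N))" using B P iprod_add_prime[of P "M + N"] by auto
    then show ?case using N by auto
  qed
  then show ?thesis using that by blast
qed

text \<open>A modulo PA is a line over the field \<O>/P: any \<open>a\<close> in A outside PA
  generates it, and s a lies in PA only for s in P. Hence pairs of a class modulo A and a class
  modulo P parametrize the classes modulo PA.\<close>

lemma abs_norm_prime_mult:
  assumes P: "P \<in> nz_primes K" and A: "A \<in> nz_ideals K"
  shows "abs_norm K (ideal_mult K P A) = abs_norm K P * abs_norm K A"
proof -
  note PI = nz_primesD[OF P] and AI = nz_idealsD[OF A]
  let ?C = "ideal_mult K P A"
  have C: "?C \<in> nz_ideals K" using ideal_mult_nz[OF PI(6) A] .
  note CI = nz_idealsD[OF C]
  have CP: "?C \<subseteq> P" and CA: "?C \<subseteq> A" using ideal_mult_subset[OF PI(1) AI(1)] by auto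
  obtain M where M: "M \<in> pmsets" "A = iprod M" using iprod_surj[OF A] by blast
  have CM: "?C = iprod (add_mset P M)" using iprod_add_prime[OF P M(1)] M(2) by simp
  have "?C \<noteq> A" using iprod_inj[of "add_mset P M" M] M P CM by auto
  then obtain a where a: "a \<in> A" "a \<notin> ?C" using CA by auto
  have aO: "a \<in> \<O>" using a AI ideal_subset by auto
  \<comment> \<open>No ideal lies strictly between PA and A: its multiset of primes would lie
    strictly between \<open>M\<close> and \<open>add_mset P M\<close>.\<close>
  have A_eq: "A = adjoin ?C a"
  proof -
    have J: "ideal (adjoin ?C a) R" "?C \<subseteq> adjoin ?C a" "a \<in> adjoin ?C a"
      using ideal_adjoin[OF CI(1) aO] subset_adjoin[OF CI(1) aO] in_adjoin[OF CI(1) aO] .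
    have Jnz: "adjoin ?C a \<in> nz_ideals K" using J a ideal_0[OF CI(1)] by (auto simp: nz_ideals_def)
    have "adjoin ?C a \<subseteq> A"
      unfolding adjoin_def using CA a ideal_add[OF AI(1)] ideal_lmult[OF AI(1)] by auto
    then obtain N where N: "N \<in> pmsets" "adjoin ?C a = iprod (M + N)"
      using subset_imp_dvd[OF M(1) Jnz] M(2) by auto
    then obtain N' where N': "N' \<in> pmsets" "?C = iprod (M + N + N')"
      using subset_imp_dvd[of "M + N" ?C] C J(2) M(1) by auto
    then have "add_mset P M = M + N + N'"
      using iprod_inj[of "add_mset P M" "M + N + N'"] CM M N P by auto
    then have "{#P#} = N + N'" by (metis add_mset_add_single add_left_cancel union_assoc)
    then have "N = {#} \<or> N' = {#}" by (metis single_is_union)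
    moreover have "N' \<noteq> {#}" using N N' J(3) a by auto
    ultimately show ?thesis using N M by simp
  qed
  \<comment> \<open>The multipliers carrying \<open>a\<close> into PA form an ideal containing P;
    were it larger than P, it would contain 1.\<close>
  have ker: "s \<in> P" if "s \<in> \<O>" "a * s \<in> ?C" for s
  proof (rule ccontr)
    assume "s \<notin> P"
    define L where "L = {x \<in> \<O>. a * x \<in> ?C}"
    have "ideal L R" unfolding ideal_iff L_def
      using ideal_0[OF CI(1)] ideal_add[OF CI(1)] ideal_lmult[OF CI(1)] O_0 O_add O_mult
      by (auto simp: distrib_left mult.left_commute)
    moreover have "P \<subset> L"
      using \<open>s \<notin> P\<close> that ideal_subset[OF PI(1)] mult_in_ideal_mult[of _ P a A] a unfolding L_def
      by (auto simp: mult.commute)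
    ultimately have "L = \<O>" using prime_maximal[OF P] by blast
    then have "a * 1 \<in> ?C" using O_1 L_def by blast
    then show False using a by simp
  qed
  obtain TP where TP: "TP \<subseteq> \<O>" "inj_on (coset P) TP" "cosets P = coset P ` TP"
    using subset_image_inj[of "cosets P" "coset P" \<O>] unfolding cosets_def by auto
  obtain TA where TA: "TA \<subseteq> \<O>" "inj_on (coset A) TA" "cosets A = coset A ` TA"
    using subset_image_inj[of "cosets A" "coset A" \<O>] unfolding cosets_def by auto
  let ?f = "\<lambda>(t, s). coset ?C (t + a * s)"
  have "bij_betw ?f (TA \<times> TP) (cosets ?C)"
    unfolding bij_betw_def
  proof
    show "inj_on ?f (TA \<times> TP)"
    proof (rule inj_onI, clarify)
      fix t s t' s'
      assume ts: "t \<in> TA" "s \<in> TP" "t' \<in> TA" "s' \<in> TP" and eq: "coset ?C (t + a * s) = coset ?C (t' + a * s')"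
      have sO: "s \<in> \<O>" "s' \<in> \<O>" using ts TP by auto
      have d: "t + a * s - (t' + a * s') \<in> ?C" using eq coset_eq_iff[OF CI(1)] by blast
      then have "t + a * s - (t' + a * s') \<in> A" using CA by auto
      moreover have "a * s - a * s' \<in> A" using ideal_diff[OF AI(1)] ideal_rmult[OF AI(1) a(1)] sO by blast
      ultimately have "t + a * s - (t' + a * s') - (a * s - a * s') \<in> A" using ideal_diff[OF AI(1)] by blast
      then have "t - t' \<in> A" by (simp add: algebra_simps)
      then have "t = t'" using TA(2) ts coset_eq_iff[OF AI(1)] unfolding inj_on_def by blast
      then have "a * (s - s') \<in> ?C" using d by (simp add: algebra_simps)
      then have "s - s' \<in> P" using ker[of "s - s'"] O_diff[OF sO] by blast
      then have "s = s'" using TP(2) ts coset_eq_iff[OF PI(1)] unfolding inj_on_def by blast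
      then show "t = t' \<and> s = s'" using \<open>t = t'\<close> by simp
    qed
    show "?f ` (TA \<times> TP) = cosets ?C"
    proof (intro equalityI subsetI)
      fix D assume "D \<in> ?f ` (TA \<times> TP)"
      then obtain t s where "t \<in> TA" "s \<in> TP" "D = coset ?C (t + a * s)" by auto
      then show "D \<in> cosets ?C" using coset_in_cosets[of "t + a * s" ?C] TA(1) TP(1) aO O_add O_mult by blast
    next
      fix D assume "D \<in> cosets ?C"
      then obtain x where x: "x \<in> \<O>" "D = coset ?C x" unfolding cosets_def by auto
      have "coset A x \<in> coset A ` TA" using coset_in_cosets[OF x(1), of A] TA(3) by simp
      then obtain t where t: "t \<in> TA" "coset A x = coset A t" by auto
      then have "x - t \<in> adjoin ?C a" using coset_eq_iff[OF AI(1)] A_eq by blast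
      then obtain z r where zr: "z \<in> ?C" "r \<in> \<O>" "x - t = z + r * a" unfolding adjoin_def by auto
      have "coset P r \<in> coset P ` TP" using coset_in_cosets[OF zr(2), of P] TP(3) by simp
      then obtain s where s: "s \<in> TP" "coset P r = coset P s" by auto
      then have "r - s \<in> P" using coset_eq_iff[OF PI(1)] by blast
      then have "(r - s) * a \<in> ?C" using mult_in_ideal_mult a by blast
      then have "z + (r - s) * a \<in> ?C" using zr ideal_add[OF CI(1)] by blast
      moreover have "x - (t + a * s) = z + (r - s) * a" using zr(3) by (simp add: algebra_simps)
      ultimately have "coset ?C x = coset ?C (t + a * s)" using coset_eq_iff[OF CI(1)] by metis
      then show "D \<in> ?f ` (TA \<times> TP)" using x t s by (intro image_eqI[of _ _ "(t, s)"]) auto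
    qed
  qed
  then have "card (cosets ?C) = card TA * card TP"
    using bij_betw_same_card card_cartesian_product by metis
  moreover have "card (cosets P) = card TP" "card (cosets A) = card TA"
    using TP TA card_image by metis+
  ultimately show ?thesis unfolding abs_norm_eq by (simp add: mult.commute)
qed

lemma abs_norm_iprod: "M \<in> pmsets \<Longrightarrow> abs_norm K (iprod M) = (\<Prod>P\<in>#M. abs_norm K P)"
proof (induction M)
  case empty
  then show ?case by (simp add: abs_norm_whole)
next
  case (add P M)
  then show ?case using abs_norm_prime_mult[of P "iprod M"] pmsets_nz[of M] by (simp add: iprod_add_prime)
qed

lemma abs_norm_prime_ge2: "P \<in> nz_primes K \<Longrightarrow> abs_norm K P \<ge> 2"
  using abs_norm_strict_antimono[OF _ _ ideal_whole, of P] nz_primesD[of P] ideal_subset[of P] abs_norm_whole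
  by (metis One_nat_def Suc_leI numeral_2_eq_2 psubsetI subsetI)

text \<open>Each such prime divides (j) and every prime has norm at least 2, so the number of
  factors is at most the binary logarithm of the norm of (j).\<close>

lemma card_primes_containing:
  assumes "j > 0"
  shows "finite {P \<in> nz_primes K. of_nat j \<in> P}" "card {P \<in> nz_primes K. of_nat j \<in> P} \<le> j * card gens"
proof -
  let ?F = "{P \<in> nz_primes K. of_nat j \<in> P}"
  define A where "A = (\<lambda>x. x * of_nat j) ` \<O>"
  have AI: "ideal A R" and jA: "of_nat j \<in> A" unfolding A_def by (rule ideal_principal[OF O_of_nat])+
  have "of_nat j \<noteq> (0::'a)" using assms by simp
  then have "A \<in> nz_ideals K" using AI jA by (auto simp: nz_ideals_def)
  then obtain M where M: "M \<in> pmsets" "A = iprod M" using iprod_surj by blast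
  have sub: "?F \<subseteq> set_mset M"
  proof clarify
    fix P assume P: "P \<in> nz_primes K" "of_nat j \<in> P"
    then have "A \<subseteq> P" unfolding A_def using ideal_lmult[OF nz_primesD(1)] by auto
    then show "P \<in># M" using prime_contains_iprod[OF P(1) M(1)] M(2) by simp
  qed
  then show "finite ?F" using finite_subset by blast
  have "2 ^ size N \<le> (\<Prod>P\<in>#N. abs_norm K P)" if "N \<in> pmsets" for N
    using that by (induction N) (use abs_norm_prime_ge2 in \<open>auto intro: mult_mono\<close>)
  then have "2 ^ size M \<le> abs_norm K A" using M abs_norm_iprod by simp
  also have "\<dots> \<le> j ^ card gens" unfolding abs_norm_eq using card_cosets_le[OF AI jA assms] .
  \<comment> \<open>The crude bound j <= 2^j allows the exponents to be compared.\<close>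
  also have "\<dots> \<le> (2 ^ j) ^ card gens" by (intro power_mono) auto
  finally have "(2::nat) ^ size M \<le> 2 ^ (j * card gens)" by (simp add: power_mult)
  then have "size M \<le> j * card gens" by simp
  moreover have "card (set_mset M) \<le> size M"
    by (metis mset_set_set_mset_msubset size_mset_mono size_mset_set)
  ultimately show "card ?F \<le> j * card gens"
    using card_mono[OF _ sub] by force
qed

text \<open>A prime of norm at most n contains some positive integer j <= n. The quadratic bound is
  wasteful, but only its logarithm affects the final estimate.\<close>

lemma card_primes_of_bounded_norm: "card {P \<in> nz_primes K. abs_norm K P \<le> n} \<le> n * (n * card gens)"
proof -
  let ?F = "\<lambda>j. {P \<in> nz_primes K. of_nat j \<in> P}"
  have sub: "{P \<in> nz_primes K. abs_norm K P \<le> n} \<subseteq> (\<Union>j\<in>{1..n}. ?F j)"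
  proof
    fix P assume P: "P \<in> {P \<in> nz_primes K. abs_norm K P \<le> n}"
    then obtain j where "0 < j" "j \<le> abs_norm K P" "of_nat j \<in> P"
      using integer_le_norm_in_ideal[of P] nz_primesD(1,2)[of P] by blast
    then show "P \<in> (\<Union>j\<in>{1..n}. ?F j)" using P by (intro UN_I[of j]) auto
  qed
  have "card {P \<in> nz_primes K. abs_norm K P \<le> n} \<le> card (\<Union>j\<in>{1..n}. ?F j)"
    using card_primes_containing(1) by (intro card_mono[OF _ sub]) auto
  also have "\<dots> \<le> (\<Sum>j\<in>{1..n}. card (?F j))" by (rule card_UN_le) simp
  also have "\<dots> \<le> of_nat (card {1..n}) * (n * card gens)"
  proof (rule sum_bounded_above)
    fix j assume j: "j \<in> {1..n}"
    then have "card (?F j) \<le> j * card gens" using card_primes_containing(2) by auto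
    also have "\<dots> \<le> n * card gens" using j by auto
    finally show "card (?F j) \<le> n * card gens" .
  qed
  finally show ?thesis by simp
qed

end

section \<open>Separation of variables\<close>

text \<open>\<open>tens f B\<close>: \<open>f\<close> is a combination of products \<open>u i * v j\<close> of functions bounded by \<open>1\<close>, with
  coefficients of total weight \<open>B\<close>.\<close>

inductive tens :: "('i \<Rightarrow> 'j \<Rightarrow> complex) \<Rightarrow> real \<Rightarrow> bool" where
  rank_one: "(\<And>i. cmod (u i) \<le> 1) \<Longrightarrow> (\<And>j. cmod (v j) \<le> 1) \<Longrightarrow> tens (\<lambda>i j. u i * v j) 1"
| add: "tens f a \<Longrightarrow> tens g b \<Longrightarrow> tens (\<lambda>i j. f i j + g i j) (a + b)"
| scale: "tens f a \<Longrightarrow> s \<ge> 0 \<Longrightarrow> tens (\<lambda>i j. of_real s * f i j) (s * a)"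

lemma tens_nonneg: "tens f B \<Longrightarrow> 0 \<le> B"
  by (induction rule: tens.induct) auto

lemma tens_bound: "tens f B \<Longrightarrow> cmod (f i j) \<le> B"
proof (induction rule: tens.induct)
  case (rank_one u v)
  then show ?case by (simp add: norm_mult mult_le_one)
next
  case (add f a g b)
  then show ?case using norm_triangle_mono by blast
next
  case (scale f a s)
  then show ?case by (simp add: norm_mult mult_left_mono)
qed

lemma tens_comp: "tens f B \<Longrightarrow> tens (\<lambda>i j. f (p i) (q j)) B"
proof (induction rule: tens.induct)
  case (rank_one u v)
  then show ?case using tens.rank_one[of "\<lambda>i. u (p i)" "\<lambda>j. v (q j)"] by simp
qed (auto intro: tens.intros)

lemma tens_flip: "tens f B \<Longrightarrow> tens (\<lambda>j i. f i j) B"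
proof (induction rule: tens.induct)
  case (rank_one u v)
  then show ?case using tens.rank_one[of v u] by (simp add: mult.commute)
qed (auto intro: tens.intros)

lemma tens_mult:
  assumes "tens f A" "tens g B"
  shows "tens (\<lambda>i j. f i j * g i j) (A * B)"
  using assms(1)
proof (induction rule: tens.induct)
  case (rank_one u v)
  from assms(2) have "tens (\<lambda>i j. u i * v j * g i j) B"
  proof (induction rule: tens.induct)
    case (rank_one u' v')
    have "tens (\<lambda>i j. (u i * u' i) * (v j * v' j)) 1"
      using rank_one \<open>\<And>i. cmod (u i) \<le> 1\<close> \<open>\<And>j. cmod (v j) \<le> 1\<close>
      by (intro tens.rank_one) (auto simp: norm_mult mult_le_one)
    then show ?case by (simp add: mult_ac)
  next
    case (add f a g b)
    then show ?case using tens.add[OF add.IH] by (simp add: distrib_left)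
  next
    case (scale f a s)
    then show ?case using tens.scale[OF scale.IH scale.hyps(2)] by (simp add: mult_ac)
  qed
  then show ?case by simp
next
  case (add f a g b)
  then show ?case using tens.add[OF add.IH] by (simp add: distrib_right)
next
  case (scale f a s)
  then show ?case using tens.scale[OF scale.IH scale.hyps(2)] by (simp add: mult_ac)
qed

text \<open>Equality of last binary digits is (1 + (-1)^i (-1)^j) / 2, of total weight 1.
  Multiplying over the digits keeps the weight 1, however many there are.\<close>

lemma tens_eq: "\<exists>f. tens f 1 \<and> (\<forall>i<2^L. \<forall>j<2^L. f i j = of_bool (i = (j::nat)))"
proof (induction L)
  case 0
  have "tens (\<lambda>i j::nat. 1 * 1) 1" by (rule tens.rank_one) auto
  then show ?case by (intro exI[of _ "\<lambda>i j. 1"]) auto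
next
  case (Suc L)
  then obtain f :: "nat \<Rightarrow> nat \<Rightarrow> complex" where f: "tens f 1" "\<forall>i<2^L. \<forall>j<2^L. f i j = of_bool (i = j)" by auto
  define g :: "nat \<Rightarrow> nat \<Rightarrow> complex" where
    "g = (\<lambda>i j. of_real (1/2) * (1 * 1) + of_real (1/2) * ((-1)^i * (-1)^j))"
  have "tens g (1/2 * 1 + 1/2 * 1)" unfolding g_def
    by (intro tens.add tens.scale tens.rank_one) (auto simp: norm_power)
  then have "tens (\<lambda>i j. f (i div 2) (j div 2) * g i j) (1 * 1)"
    using tens_mult[OF tens_comp[OF f(1)]] by simp
  moreover have "f (i div 2) (j div 2) * g i j = of_bool (i = j)" if "i < 2 ^ Suc L" "j < 2 ^ Suc L" for i j
  proof -
    have "f (i div 2) (j div 2) = of_bool (i div 2 = j div 2)" using f(2) that by auto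
    moreover have "g i j = of_bool (even i = even j)" unfolding g_def by auto
    moreover have "i = j \<longleftrightarrow> i div 2 = j div 2 \<and> (even i = even j)"
      by (metis div_mult_mod_eq even_iff_mod_2_eq_zero odd_iff_mod_2_eq_one)
    ultimately show ?thesis by auto
  qed
  ultimately show ?case by (intro exI[of _ "\<lambda>i j. f (i div 2) (j div 2) * g i j"]) auto
qed

text \<open>Comparing binary digits from the top, \<open>i < j\<close> splits into one event per digit position; each is
  an equality of prefixes, which is an average of Walsh characters.\<close>

lemma tens_less: "\<exists>f. tens f (real L) \<and> (\<forall>i<2^L. \<forall>j<2^L. f i j = of_bool (i < (j::nat)))"
proof (induction L)
  case 0
  have "tens (\<lambda>i j::nat. of_real 0 * (1 * 1)) (0 * 1)" by (intro tens.scale tens.rank_one) auto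
  then show ?case by (intro exI[of _ "\<lambda>i j. 0"]) auto
next
  case (Suc L)
  then obtain f :: "nat \<Rightarrow> nat \<Rightarrow> complex" where f: "tens f (real L)" "\<forall>i<2^L. \<forall>j<2^L. f i j = of_bool (i < j)" by auto
  obtain e :: "nat \<Rightarrow> nat \<Rightarrow> complex" where e: "tens e 1" "\<forall>i<2^L. \<forall>j<2^L. e i j = of_bool (i = j)"
    using tens_eq[of L] by auto
  \<comment> \<open>The new event, equal prefixes followed by digits 0 and 1, is prefix equality
    times a single product, so each digit adds weight 1.\<close>
  have "tens (\<lambda>i j. of_bool (even i) * of_bool (odd j)) 1" by (rule tens.rank_one) auto
  then have "tens (\<lambda>i j. e (i div 2) (j div 2) * (of_bool (even i) * of_bool (odd j))) (1 * 1)"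
    by (rule tens_mult[OF tens_comp[OF e(1)]])
  then have "tens (\<lambda>i j. f (i div 2) (j div 2) + e (i div 2) (j div 2) * (of_bool (even i) * of_bool (odd j))) (real L + 1 * 1)"
    by (rule tens.add[OF tens_comp[OF f(1)]])
  moreover have "f (i div 2) (j div 2) + e (i div 2) (j div 2) * (of_bool (even i) * of_bool (odd j)) = of_bool (i < j)"
    if "i < 2 ^ Suc L" "j < 2 ^ Suc L" for i j
  proof -
    have "f (i div 2) (j div 2) = of_bool (i div 2 < j div 2)" using f(2) that by auto
    moreover have "e (i div 2) (j div 2) = of_bool (i div 2 = j div 2)" using e(2) that by auto
    moreover have "i < j \<longleftrightarrow> i div 2 < j div 2 \<or> (i div 2 = j div 2 \<and> even i \<and> odd j)" by presburger
    ultimately show ?thesis by auto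
  qed
  ultimately show ?case
    by (intro exI[of _ "\<lambda>i j. f (i div 2) (j div 2) + e (i div 2) (j div 2) * (of_bool (even i) * of_bool (odd j))"]) (auto simp: add.commute)
qed

section \<open>Divisor sums over multisets\<close>

definition subms :: "'p multiset \<Rightarrow> 'p multiset set" where "subms n = {d. d \<subseteq># n}"

lemma finite_subms [simp]: "finite (subms n)"
proof (induction n)
  case empty
  then show ?case by (simp add: subms_def)
next
  case (add x n)
  have "subms (add_mset x n) \<subseteq> subms n \<union> add_mset x ` subms n"
  proof
    fix d assume d: "d \<in> subms (add_mset x n)"
    show "d \<in> subms n \<union> add_mset x ` subms n"
    proof (cases "x \<in># d")
      case True
      then obtain d' where "d = add_mset x d'" by (metis multi_member_split)
      then show ?thesis using d by (auto simp: subms_def)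
    next
      case False
      have "count d y \<le> count n y" for y
      proof -
        have "count d y \<le> count (add_mset x n) y" using d unfolding subms_def subseteq_mset_def by blast
        then show ?thesis using False by (cases "y = x") (simp_all add: not_in_iff)
      qed
      then show ?thesis unfolding subms_def subseteq_mset_def by blast
    qed
  qed
  then show ?case using add finite_subset by blast
qed

text \<open>Grouping by a = r + d. This turns the Moebius expansion for each r into a divisor sum
  over \<open>a\<close>, the variable that the bilinear hypotheses see.\<close>

lemma sum_subms_swap:
  "(\<Sum>r\<in>subms n. \<Sum>d\<in>subms (n - r). F r d) = (\<Sum>a\<in>subms n. \<Sum>r\<in>subms a. F r (a - r))"
proof -
  have "(\<Sum>r\<in>subms n. \<Sum>d\<in>subms (n - r). F r d) = (\<Sum>(r, d)\<in>Sigma (subms n) (\<lambda>r. subms (n - r)). F r d)"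
    by (rule sum.Sigma) auto
  also have "\<dots> = (\<Sum>(a, r)\<in>Sigma (subms n) subms. F r (a - r))"
  proof (rule sum.reindex_bij_witness[where i = "\<lambda>(a, r). (r, a - r)" and j = "\<lambda>(r, d). (r + d, r)"])
    fix z assume "z \<in> Sigma (subms n) (\<lambda>r. subms (n - r))"
    then obtain r d where z: "z = (r, d)" "r \<subseteq># n" "d \<subseteq># n - r" by (auto simp: subms_def)
    then have "r + d \<subseteq># n" using subset_mset.le_diff_conv2[of r n d] by (simp add: add.commute)
    then show "(case z of (r, d) \<Rightarrow> (r + d, r)) \<in> Sigma (subms n) subms" using z by (auto simp: subms_def)
  next
    fix z assume "z \<in> Sigma (subms n) subms"
    then obtain a r where z: "z = (a, r)" "a \<subseteq># n" "r \<subseteq># a" by (auto simp: subms_def)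
    then have "r \<subseteq># n" by auto
    moreover have "a - r \<subseteq># n - r" using z by (simp add: subseteq_mset_def diff_le_mono)
    ultimately show "(case z of (a, r) \<Rightarrow> (r, a - r)) \<in> Sigma (subms n) (\<lambda>r. subms (n - r))"
      using z by (auto simp: subms_def)
  qed (auto simp: subms_def)
  also have "\<dots> = (\<Sum>a\<in>subms n. \<Sum>r\<in>subms a. F r (a - r))"
    by (rule sum.Sigma[symmetric]) auto
  finally show ?thesis .
qed

lemma diff_diff_submset: "b \<subseteq># n \<Longrightarrow> n - (n - b) = b"
  by (simp add: multiset_eq_iff subseteq_mset_def)

lemma sum_subms_complement: "(\<Sum>a\<in>subms n. F a (n - a)) = (\<Sum>b\<in>subms n. F (n - b) b)"
  by (rule sum.reindex_bij_witness[where i = "\<lambda>b. n - b" and j = "\<lambda>b. n - b"])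
     (auto simp: subms_def diff_diff_submset)

text \<open>The divisor function d_k: a list with sum \<open>n\<close> is an ordered
  factorization.\<close>

definition tau :: "nat \<Rightarrow> 'p multiset \<Rightarrow> nat" where
  "tau k n = card {ms. length ms = k \<and> sum_list ms = n}"

lemma finite_factorizations: "finite {ms :: 'p multiset list. length ms = k \<and> sum_list ms = n}"
proof -
  have "m \<in># mset ms \<Longrightarrow> m \<subseteq># sum_list ms" for ms and m :: "'p multiset"
    by (induction ms) (auto intro: subset_mset.order_trans)
  then have "{ms. length ms = k \<and> sum_list ms = n} \<subseteq> {ms. set ms \<subseteq> subms n \<and> length ms = k}"
    by (auto simp: subms_def)
  moreover have "finite {ms. set ms \<subseteq> subms n \<and> length ms = k}" by (rule finite_lists_length_eq) simp
  ultimately show ?thesis using finite_subset by blast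
qed

text \<open>Padding with a unit gives d_2 <= d_3, which makes sums of bounded terms over the
  divisors of one variable admissible as coefficients.\<close>

lemma card_subms_le_tau: "card (subms n) \<le> tau 3 n"
proof -
  have "inj_on (\<lambda>r. [r, n - r, {#}]) (subms n)" by (auto simp: inj_on_def)
  moreover have "(\<lambda>r. [r, n - r, {#}]) ` subms n \<subseteq> {ms. length ms = 3 \<and> sum_list ms = n}"
    by (auto simp: subms_def)
  ultimately show ?thesis unfolding tau_def using finite_factorizations by (rule card_inj_on_le)
qed

lemma card_subms_pos: "1 \<le> card (subms n)"
proof -
  have "n \<in> subms n" by (simp add: subms_def)
  then show ?thesis by (metis card_0_eq empty_iff finite_subms less_one linorder_not_le)
qed

lemma tau_pos: "1 \<le> tau 3 n"
  using card_subms_le_tau[of n] card_subms_pos[of n] by linarith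

text \<open>A chain of divisors r of a of n is a factorization into three parts; two units pad it to
  the five parts of the weight for which summability is assumed.\<close>

lemma sum_card_subms_le_tau: "(\<Sum>a\<in>subms n. card (subms a)) \<le> tau 5 n"
proof -
  have "(\<Sum>a\<in>subms n. card (subms a)) = card (Sigma (subms n) subms)" by simp
  also have "\<dots> \<le> tau 5 n" unfolding tau_def
  proof (rule card_inj_on_le[OF _ _ finite_factorizations])
    let ?f = "\<lambda>(a, r). [r, a - r, n - a, {#}, {#}]"
    show "inj_on ?f (Sigma (subms n) subms)"
    proof (rule inj_onI)
      fix z w assume z: "z \<in> Sigma (subms n) subms" and w: "w \<in> Sigma (subms n) subms" and eq: "?f z = ?f w"
      obtain a r where zar: "z = (a, r)" by force
      obtain b s where wbs: "w = (b, s)" by force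
      have "r = s" "a - r = b - s" using eq zar wbs by auto
      moreover have "r \<subseteq># a" "s \<subseteq># b" using z w zar wbs by (auto simp: subms_def)
      ultimately have "a = b" by (metis subset_mset.add_diff_inverse)
      then show "z = w" using \<open>r = s\<close> zar wbs by simp
    qed
    show "?f ` Sigma (subms n) subms \<subseteq> {ms. length ms = 5 \<and> sum_list ms = n}"
      by (auto simp: subms_def add.assoc[symmetric])
  qed
  finally show ?thesis .
qed

lemma card_subms_le_tau5: "card (subms n) \<le> tau 5 n"
proof -
  have "card (subms n) \<le> (\<Sum>a\<in>subms n. card (subms a))"
    by (rule member_le_sum[of n "subms n" "\<lambda>a. card (subms a)"]) (auto, simp add: subms_def)
  then show ?thesis using sum_card_subms_le_tau[of n] by linarith
qed

lemma tau5_pos: "1 \<le> tau 5 n"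
  using card_subms_le_tau5[of n] card_subms_pos[of n] by linarith

section \<open>Truncated Moebius sums\<close>

lemma sum_Pow_split:
  fixes f :: "'p set \<Rightarrow> complex"
  assumes "finite A" "m \<in> A"
  shows "(\<Sum>D\<in>Pow A. f D) = (\<Sum>D\<in>Pow (A - {m}). f D + f (insert m D))"
proof -
  have "Pow A = Pow (insert m (A - {m}))" using assms(2) by (simp add: insert_absorb)
  also have "\<dots> = Pow (A - {m}) \<union> insert m ` Pow (A - {m})" by (rule Pow_insert)
  finally have eq: "Pow A = Pow (A - {m}) \<union> insert m ` Pow (A - {m})" .
  have "(\<Sum>D\<in>Pow A. f D) = (\<Sum>D\<in>Pow (A - {m}). f D) + (\<Sum>D\<in>insert m ` Pow (A - {m}). f D)"
    unfolding eq using assms(1) by (intro sum.union_disjoint) auto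
  also have "(\<Sum>D\<in>insert m ` Pow (A - {m}). f D) = (\<Sum>D\<in>Pow (A - {m}). f (insert m D))"
    by (rule sum.reindex_cong[of "insert m"]) (auto simp: inj_on_def)
  finally show ?thesis by (simp add: sum.distrib)
qed

text \<open>\<open>D\<close> and \<open>insert m D\<close> carry opposite signs, so they cancel
  unless adding m violates \<theta>.\<close>

lemma sum_Pow_cancel:
  fixes \<theta> :: "'p set \<Rightarrow> bool"
  assumes "finite A" "m \<in> A" "\<And>D. D \<subseteq> A - {m} \<Longrightarrow> \<theta> (insert m D) \<Longrightarrow> \<theta> D"
  shows "(\<Sum>D\<in>Pow A. (-1) ^ card D * of_bool (\<theta> D)) =
     (\<Sum>D\<in>Pow (A - {m}). (-1) ^ card D * (of_bool (\<theta> D \<and> \<not> \<theta> (insert m D)) :: complex))"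
  unfolding sum_Pow_split[OF assms(1,2)]
proof (intro sum.cong refl, goal_cases)
  case D: (1 D)
  then have "card (insert m D) = Suc (card D)"
    using assms(1) finite_subset[of D A] by (subst card_insert_disjoint) auto
  then show ?case
    using assms(3)[of D] D by (cases "\<theta> D"; cases "\<theta> (insert m D)") simp_all
qed

text \<open>Numbering the primes turns comparisons of least primes into comparisons of integers up
  to \<open>card Q\<close>, which can be separated digit by digit. Any numbering serves; the size of
  a prime enters the sieve through its norm.\<close>

locale prime_set =
  fixes Q :: "'p set" and idx :: "'p \<Rightarrow> nat"
  assumes finite_Q: "finite Q" and idx: "bij_betw idx Q {..<card Q}"
begin

definition free :: "'p multiset \<Rightarrow> bool" where "free e \<longleftrightarrow> (\<forall>p\<in>Q. p \<notin># e)"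

definition mob :: "'p multiset \<Rightarrow> complex" where
  "mob d = (if set_mset d \<subseteq> Q \<and> (\<forall>p. count d p \<le> 1) then (-1) ^ size d else 0)"

text \<open>\<open>idx (minp e)\<close> is the least index of a prime of \<open>Q\<close> in \<open>e\<close>; if there is none, \<open>low e\<close> is \<open>card Q\<close>
  and \<open>minp e\<close> is meaningless.\<close>

definition low :: "'p multiset \<Rightarrow> nat" where
  "low e = Min (insert (card Q) (idx ` (Q \<inter> set_mset e)))"

definition minp :: "'p multiset \<Rightarrow> 'p" where "minp e = inv_into Q idx (low e)"

lemma cmod_mob: "cmod (mob d) \<le> 1"
  by (simp add: mob_def norm_power)

lemma low_le_card: "low e \<le> card Q"
  unfolding low_def using finite_Q by (intro Min_le) auto

lemma low_le: "p \<in> Q \<Longrightarrow> p \<in># e \<Longrightarrow> low e \<le> idx p"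
  unfolding low_def using finite_Q by (intro Min_le) auto

lemma idx_less: "p \<in> Q \<Longrightarrow> idx p < card Q"
  using idx bij_betwE by fastforce

lemma idx_inj: "p \<in> Q \<Longrightarrow> q \<in> Q \<Longrightarrow> idx p = idx q \<Longrightarrow> p = q"
  using idx unfolding bij_betw_def inj_on_def by blast

lemma minp:
  assumes "low e < card Q"
  shows "minp e \<in> Q" "minp e \<in># e" "idx (minp e) = low e"
proof -
  have "low e \<in> insert (card Q) (idx ` (Q \<inter> set_mset e))"
    unfolding low_def using finite_Q by (intro Min_in) auto
  then obtain p where p: "p \<in> Q" "p \<in># e" "low e = idx p" using assms by auto
  then have "minp e = p" unfolding minp_def using idx by (simp add: bij_betw_def inv_into_f_f)
  then show "minp e \<in> Q" "minp e \<in># e" "idx (minp e) = low e" using p by auto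
qed

lemma low_less_iff: "low e < card Q \<longleftrightarrow> \<not> free e"
proof
  assume "low e < card Q"
  then show "\<not> free e" using minp unfolding free_def by blast
next
  assume "\<not> free e"
  then obtain p where "p \<in> Q" "p \<in># e" unfolding free_def by blast
  then show "low e < card Q" using low_le idx_less by fastforce
qed

lemma low_antimono: "e' \<subseteq># e \<Longrightarrow> low e \<le> low e'"
  using minp[of e'] low_le[of "minp e'" e] low_le_card[of e] low_le_card[of e']
    mset_subset_eqD[of e' e "minp e'"]
  by (cases "low e' < card Q") simp_all

lemma low_greater:
  assumes "j < card Q" "\<And>p. p \<in> Q \<Longrightarrow> p \<in># e \<Longrightarrow> j < idx p"
  shows "j < low e"
proof (cases "low e < card Q")
  case True
  then show ?thesis using minp[of e] assms(2)[of "minp e"] by simp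
next
  case False
  then show ?thesis using assms(1) by linarith
qed

lemma sum_mob:
  "(\<Sum>d\<in>subms e. mob d * h d) = (\<Sum>D\<in>Pow (Q \<inter> set_mset e). (-1) ^ card D * h (mset_set D))"
proof -
  let ?S = "{d \<in> subms e. set_mset d \<subseteq> Q \<and> (\<forall>p. count d p \<le> 1)}"
  have "(\<Sum>d\<in>subms e. mob d * h d) = (\<Sum>d\<in>?S. mob d * h d)"
    by (rule sum.mono_neutral_right) (auto simp: mob_def)
  also have "\<dots> = (\<Sum>D\<in>Pow (Q \<inter> set_mset e). (-1) ^ card D * h (mset_set D))"
  proof (rule sum.reindex_bij_witness[where i = mset_set and j = set_mset])
    fix d assume d: "d \<in> ?S"
    show *: "mset_set (set_mset d) = d"
    proof (rule multiset_eqI)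
      fix p
      have "count d p \<le> 1" using d by auto
      show "count (mset_set (set_mset d)) p = count d p"
      proof (cases "p \<in># d")
        case True
        then have "count d p \<ge> 1" using count_greater_eq_one_iff[of d p] by blast
        then have "count d p = 1" using \<open>count d p \<le> 1\<close> by linarith
        then show ?thesis using True count_mset_set(1)[of "set_mset d" p] by simp
      next
        case False
        then show ?thesis using count_mset_set(3)[of p "set_mset d"] not_in_iff[of p d] by simp
      qed
    qed
    show "set_mset d \<in> Pow (Q \<inter> set_mset e)" using d by (auto simp: subms_def dest: mset_subset_eqD)
    have "size d = card (set_mset d)" using * by (metis size_mset_set)
    then show "(-1) ^ card (set_mset d) * h (mset_set (set_mset d)) = mob d * h d"
      using d * by (simp add: mob_def)
  next
    fix D assume D: "D \<in> Pow (Q \<inter> set_mset e)"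
    then have fin: "finite D" using finite_Q finite_subset by blast
    then show "set_mset (mset_set D) = D" by simp
    have "mset_set D \<subseteq># mset_set (set_mset e)" using D fin by (intro subset_imp_msubset_mset_set) auto
    also have "\<dots> \<subseteq># e" by (rule mset_set_set_mset_msubset)
    finally show "mset_set D \<in> ?S" using D fin by (auto simp: subms_def count_mset_set')
  qed
  finally show ?thesis .
qed

text \<open>Adding or removing the least prime of \<open>Q\<close> dividing \<open>e\<close> pairs off all terms of the Moebius sum
  except those where this prime carries \<open>d\<close> across the threshold \<open>\<theta>\<close>.\<close>

lemma
  assumes t0: "\<theta> {#}" and mono: "\<And>p d. p \<in> Q \<Longrightarrow> p \<in># e \<Longrightarrow> d \<subseteq># e \<Longrightarrow> \<theta> (add_mset p d) \<Longrightarrow> \<theta> d"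
  shows buchstab_below: "of_bool (free e) = (\<Sum>d\<in>subms e. mob d * of_bool (\<theta> d))
      - (\<Sum>d\<in>subms e. mob d * of_bool (\<theta> d \<and> \<not> \<theta> (add_mset (minp (e - d)) d) \<and> low (e - d) < low d))" (is ?below)
    and buchstab_above: "of_bool (free e) = (\<Sum>d\<in>subms e. mob d * of_bool (\<theta> d))
      + (\<Sum>d\<in>subms e. mob d * of_bool (\<theta> (d - {#minp d#}) \<and> \<not> \<theta> d \<and> low d \<le> low (e - d)))" (is ?above)
proof -
  let ?A = "Q \<inter> set_mset e"
  have finA: "finite ?A" using finite_Q by auto
  have "?below \<and> ?above"
  proof (cases "free e")
    case True
    then have A: "?A = {}" by (auto simp: free_def)
    have "low e = card Q" "low {#} = card Q" using True low_less_iff[of e] low_le_card[of e] by (simp, simp add: low_def)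
    then show ?thesis unfolding sum_mob A using True t0 by simp
  next
    case False
    define m where "m = minp e"
    have le: "low e < card Q" using False low_less_iff by blast
    have m: "m \<in> Q" "m \<in># e" "idx m = low e" using minp[OF le] m_def by auto
    then have mA: "m \<in> ?A" by auto
    have sub: "mset_set D \<subseteq># e" if "D \<subseteq> ?A" for D
    proof -
      have "mset_set D \<subseteq># mset_set (set_mset e)" using that by (intro subset_imp_msubset_mset_set) auto
      also have "\<dots> \<subseteq># e" by (rule mset_set_set_mset_msubset)
      finally show ?thesis .
    qed
    \<comment> \<open>Terms without the least prime m. The strict comparison in
      \<open>buchstab_below\<close> keeps exactly these.\<close>
    have notin: "low (e - mset_set D) = low e" "low e < low (mset_set D)" "minp (e - mset_set D) = m"
      if D: "D \<subseteq> ?A - {m}" for D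
    proof -
      have fin: "finite D" using D finA finite_subset by blast
      have "count (mset_set D) m = 0" using D by (auto simp: count_mset_set')
      then have "m \<in># e - mset_set D" using m(2) by (simp add: in_diff_count)
      then have "low (e - mset_set D) \<le> low e" using low_le[OF m(1)] m(3) by metis
      moreover have "low e \<le> low (e - mset_set D)" by (rule low_antimono) auto
      ultimately show 1: "low (e - mset_set D) = low e" by simp
      then show "minp (e - mset_set D) = m" unfolding m_def minp_def by simp
      show "low e < low (mset_set D)"
      proof (rule low_greater[OF le])
        fix p assume p: "p \<in> Q" "p \<in># mset_set D"
        then have "p \<in> D" using fin by simp
        then have "p \<in># e" "p \<noteq> m" using D by auto
        then show "low e < idx p" using low_le[OF p(1)] idx_inj[OF p(1) m(1)] m(3)
          by (metis le_neq_implies_less)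
      qed
    qed
    \<comment> \<open>Terms containing m, which are those kept in \<open>buchstab_above\<close>. As
      m may divide \<open>e\<close> repeatedly, \<open>low (e - d)\<close> may equal
      \<open>low d\<close>; hence the comparison is weak there and strict in
      \<open>buchstab_below\<close>.\<close>
    have isin: "low (mset_set (insert m D)) = low e" "low e \<le> low (e - mset_set (insert m D))"
      "minp (mset_set (insert m D)) = m" "mset_set (insert m D) = add_mset m (mset_set D)"
      "card (insert m D) = Suc (card D)"
      if D: "D \<subseteq> ?A - {m}" for D
    proof -
      have fin: "finite D" using D finA finite_subset by blast
      have mD: "m \<notin> D" using D by blast
      have "low (mset_set (insert m D)) \<le> low e" using low_le[OF m(1), of "mset_set (insert m D)"] m(3) fin by simp
      moreover have "low e \<le> low (mset_set (insert m D))" using sub[of "insert m D"] D mA low_antimono by blast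
      ultimately show 1: "low (mset_set (insert m D)) = low e" by simp
      show "low e \<le> low (e - mset_set (insert m D))" by (rule low_antimono) auto
      show "minp (mset_set (insert m D)) = m" unfolding m_def minp_def 1[unfolded m_def minp_def] ..
      show "mset_set (insert m D) = add_mset m (mset_set D)" using fin mD by (rule mset_set.insert)
      show "card (insert m D) = Suc (card D)" using fin mD by (rule card_insert_disjoint)
    qed
    have first: "(\<Sum>d\<in>subms e. mob d * of_bool (\<theta> d)) =
        (\<Sum>D\<in>Pow (?A - {m}). (-1) ^ card D * of_bool (\<theta> (mset_set D) \<and> \<not> \<theta> (mset_set (insert m D))))"
      unfolding sum_mob
    proof (rule sum_Pow_cancel[OF finA mA])
      fix D assume "D \<subseteq> ?A - {m}" "\<theta> (mset_set (insert m D))"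
      then show "\<theta> (mset_set D)" using isin(4) mono[OF m(1,2), of "mset_set D"] sub[of D] by auto
    qed
    have "(\<Sum>d\<in>subms e. mob d * of_bool (\<theta> d \<and> \<not> \<theta> (add_mset (minp (e - d)) d) \<and> low (e - d) < low d)) =
        (\<Sum>D\<in>Pow (?A - {m}). (-1) ^ card D * of_bool (\<theta> (mset_set D) \<and> \<not> \<theta> (mset_set (insert m D))))"
      unfolding sum_mob sum_Pow_split[OF finA mA]
    proof (intro sum.cong refl, goal_cases)
      case (1 D)
      then have D: "D \<subseteq> ?A - {m}" by auto
      show ?case using notin[OF D] isin(1,2)[OF D] isin(4)[OF D] by auto
    qed
    moreover have "(\<Sum>d\<in>subms e. mob d * of_bool (\<theta> (d - {#minp d#}) \<and> \<not> \<theta> d \<and> low d \<le> low (e - d))) =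
        - (\<Sum>D\<in>Pow (?A - {m}). (-1) ^ card D * of_bool (\<theta> (mset_set D) \<and> \<not> \<theta> (mset_set (insert m D))))"
      unfolding sum_mob sum_Pow_split[OF finA mA] sum_negf[symmetric]
    proof (intro sum.cong refl, goal_cases)
      case (1 D)
      then have D: "D \<subseteq> ?A - {m}" by auto
      have "mset_set (insert m D) - {#m#} = mset_set D" using isin(4)[OF D] by simp
      then show ?case using notin[OF D] isin(1,2,3,5)[OF D] by auto
    qed
    ultimately show ?thesis using False first by simp
  qed
  then show ?below ?above by auto
qed

end

section \<open>The sieve on multisets\<close>

lemma infsum_finite_sum:
  fixes f :: "'i \<Rightarrow> 'b \<Rightarrow> complex"
  assumes "finite S" "\<And>r. f r summable_on A"
  shows "(\<lambda>n. \<Sum>r\<in>S. f r n) summable_on A \<and>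
    (\<Sum>r\<in>S. infsum (f r) A) = (\<Sum>\<^sub>\<infinity>n\<in>A. \<Sum>r\<in>S. f r n)"
  using assms(1) by (induction rule: finite_induct) (simp_all add: assms(2) infsum_add summable_on_add)

text \<open>\<open>v\<close> will be the difference of the two weights, so it may change sign; the
  sieve sees it only through the linear functional \<open>T\<close>.\<close>

locale weighted =
  fixes P :: "'p set" and nrm :: "'p \<Rightarrow> nat" and v :: "'p multiset \<Rightarrow> real"
  assumes nrm_pos: "p \<in> P \<Longrightarrow> 1 \<le> nrm p"
    and summ: "(\<lambda>n. real (tau 5 n) * v n) abs_summable_on {m. set_mset m \<subseteq> P}"
begin

definition I where "I = {m. set_mset m \<subseteq> P}"

definition N :: "'p multiset \<Rightarrow> nat" where "N m = (\<Prod>p\<in>#m. nrm p)"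

definition T :: "('p multiset \<Rightarrow> complex) \<Rightarrow> complex" where
  "T G = (\<Sum>\<^sub>\<infinity>n\<in>I. G n * complex_of_real (v n))"

text \<open>Growth that keeps \<open>T\<close> absolutely convergent. The additivity of
  \<open>T\<close> rests on it, since \<open>infsum\<close> of a non-summable family is 0.\<close>

definition adm :: "('p multiset \<Rightarrow> complex) \<Rightarrow> bool" where
  "adm G \<longleftrightarrow> (\<exists>C. \<forall>n\<in>I. cmod (G n) \<le> C * real (tau 5 n))"

lemma N_add: "N (a + b) = N a * N b" and N_add_mset: "N (add_mset p a) = nrm p * N a"
  by (simp_all add: N_def)

lemma I_sub: "n \<in> I \<Longrightarrow> d \<subseteq># n \<Longrightarrow> d \<in> I"
  unfolding I_def by (auto dest: mset_subset_eqD)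

lemma N_pos: "m \<in> I \<Longrightarrow> 1 \<le> N m"
proof (induction m)
  case empty
  then show ?case by (simp add: N_def)
next
  case (add p m)
  then have "1 \<le> nrm p" "1 \<le> N m" using nrm_pos by (auto simp: I_def)
  then have "1 * 1 \<le> nrm p * N m" by (intro mult_le_mono)
  then show ?case by (simp add: N_add_mset)
qed

lemma adm_abs_summable: "adm G \<Longrightarrow> (\<lambda>n. G n * complex_of_real (v n)) abs_summable_on I"
proof -
  assume "adm G"
  then obtain C where C: "\<And>n. n \<in> I \<Longrightarrow> cmod (G n) \<le> C * real (tau 5 n)" unfolding adm_def by blast
  have "(\<lambda>n. C * (real (tau 5 n) * v n)) abs_summable_on I"
    using summable_on_cmult_right[OF summ, of "\<bar>C\<bar>"] unfolding I_def by (simp add: abs_mult)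
  then show ?thesis
  proof (rule abs_summable_on_comparison_test)
    fix n assume "n \<in> I"
    then have "cmod (G n) * \<bar>v n\<bar> \<le> C * real (tau 5 n) * \<bar>v n\<bar>" using C by (intro mult_right_mono) auto
    also have "\<dots> \<le> \<bar>C * real (tau 5 n) * \<bar>v n\<bar>\<bar>" by (rule abs_ge_self)
    finally show "norm (G n * complex_of_real (v n)) \<le> norm (C * (real (tau 5 n) * v n))"
      by (simp add: norm_mult abs_mult)
  qed
qed

lemma adm_summable: "adm G \<Longrightarrow> (\<lambda>n. G n * complex_of_real (v n)) summable_on I"
  by (rule abs_summable_summable[OF adm_abs_summable])

lemma adm_add: "adm F \<Longrightarrow> adm G \<Longrightarrow> adm (\<lambda>n. F n + G n)"
proof -
  assume "adm F" "adm G"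
  then obtain C D where C: "\<And>n. n \<in> I \<Longrightarrow> cmod (F n) \<le> C * real (tau 5 n)"
    and D: "\<And>n. n \<in> I \<Longrightarrow> cmod (G n) \<le> D * real (tau 5 n)" unfolding adm_def by blast
  have "cmod (F n + G n) \<le> (C + D) * real (tau 5 n)" if "n \<in> I" for n
    using norm_triangle_mono[OF C[OF that] D[OF that]] by (simp add: distrib_right)
  then show ?thesis unfolding adm_def by blast
qed

lemma T_add: "adm F \<Longrightarrow> adm G \<Longrightarrow> T (\<lambda>n. F n + G n) = T F + T G"
  unfolding T_def by (simp add: distrib_right infsum_add adm_summable)

lemma T_cmult: "T (\<lambda>n. c * G n) = c * T G"
  unfolding T_def by (simp add: mult.assoc infsum_cmult_right')

lemma T_cong: "(\<And>n. n \<in> I \<Longrightarrow> F n = G n) \<Longrightarrow> T F = T G"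
  unfolding T_def by (intro infsum_cong) simp

lemma norm_double_sum_le:
  assumes "\<And>a r. a \<subseteq># n \<Longrightarrow> r \<subseteq># a \<Longrightarrow> cmod (F r a) \<le> B" "B \<ge> 0"
  shows "cmod (\<Sum>a\<in>subms n. \<Sum>r\<in>subms a. F r a) \<le> B * real (tau 5 n)"
proof -
  have "cmod (\<Sum>a\<in>subms n. \<Sum>r\<in>subms a. F r a) \<le> (\<Sum>a\<in>subms n. \<Sum>r\<in>subms a. B)"
    using assms(1) by (intro sum_norm_le order.trans[OF norm_sum sum_mono]) (auto simp: subms_def)
  also have "\<dots> = B * real (\<Sum>a\<in>subms n. card (subms a))" by (simp add: sum_distrib_left mult.commute)
  also have "\<dots> \<le> B * real (tau 5 n)"
    using sum_card_subms_le_tau[of n] assms(2) by (intro mult_left_mono) linarith+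
  finally show ?thesis .
qed

lemma adm_double_sum:
  assumes "\<And>r a n. cmod (F r a n) \<le> B" "B \<ge> 0"
  shows "adm (\<lambda>n. \<Sum>a\<in>subms n. \<Sum>r\<in>subms a. F r a n)"
  unfolding adm_def by (intro exI[of _ B] ballI norm_double_sum_le assms)

lemma le_tau: "c \<le> 1 \<Longrightarrow> c \<le> real (tau 3 m)"
  using tau_pos[of m] by linarith

lemma norm_inner_sum_le:
  assumes "\<And>r. r \<subseteq># a \<Longrightarrow> cmod (F r) \<le> 1"
  shows "cmod (\<Sum>r\<in>subms a. F r) \<le> real (tau 3 a)"
proof -
  have "cmod (\<Sum>r\<in>subms a. F r) \<le> (\<Sum>r\<in>subms a. 1)"
    using assms by (intro sum_norm_le) (auto simp: subms_def)
  also have "\<dots> \<le> real (tau 3 a)" using card_subms_le_tau[of a] by simp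
  finally show ?thesis .
qed

text \<open>For a single product, the first factor is summed over the divisors \<open>r\<close> of
  \<open>a\<close>, which gives a coefficient bounded by \<open>tau 3\<close>, and the second
  becomes the other coefficient. The weights follow the construction of \<open>f\<close>. The factor
  \<sigma> needs no separation because \<open>hyp\<close> already contains it.\<close>

lemma bilinear_tens:
  assumes "tens f B"
    and hyp: "\<And>A b. (\<And>m. cmod (A m) \<le> real (tau 3 m)) \<Longrightarrow> (\<And>m. cmod (b m) \<le> 1) \<Longrightarrow>
      cmod (T (\<lambda>n. \<Sum>a\<in>subms n. A a * b (n - a) * \<sigma> a (n - a))) \<le> Y"
    and k: "\<And>r a. cmod (k r a) \<le> 1" and \<sigma>: "\<And>a e. cmod (\<sigma> a e) \<le> 1"
  shows "cmod (T (\<lambda>n. \<Sum>a\<in>subms n. \<Sum>r\<in>subms a. k r a * f (r, a) (n - a) * \<sigma> a (n - a))) \<le> B * Y"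
proof -
  let ?D = "\<lambda>f n. \<Sum>a\<in>subms n. \<Sum>r\<in>subms a. k r a * f (r, a) (n - a) * \<sigma> a (n - a)"
  have adm: "adm (?D f)"
    if "tens f B" for f B
  proof -
    have "cmod (k r a * f (r, a) e * \<sigma> a e) \<le> B" for r a e
    proof -
      have "cmod (k r a) * cmod (f (r, a) e) * cmod (\<sigma> a e) \<le> 1 * B * 1"
        using k \<sigma> tens_bound[OF that] tens_nonneg[OF that] by (intro mult_mono) auto
      then show ?thesis by (simp add: norm_mult)
    qed
    then show ?thesis by (rule adm_double_sum[OF _ tens_nonneg[OF that]])
  qed
  show ?thesis using assms(1)
  proof (induction rule: tens.induct)
    case (rank_one u w)
    have "cmod (T (\<lambda>n. \<Sum>a\<in>subms n. (\<Sum>r\<in>subms a. k r a * u (r, a)) * w (n - a) * \<sigma> a (n - a))) \<le> Y"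
    proof (rule hyp)
      show "cmod (\<Sum>r\<in>subms m. k r m * u (r, m)) \<le> real (tau 3 m)" for m
        using rank_one(1) k by (intro norm_inner_sum_le) (simp add: norm_mult mult_le_one)
    qed (rule rank_one(2))
    then show ?case by (simp add: sum_distrib_right mult.assoc)
  next
    case (add f a g b)
    have "T (\<lambda>n. \<Sum>a\<in>subms n. \<Sum>r\<in>subms a. k r a * (f (r, a) (n - a) + g (r, a) (n - a)) * \<sigma> a (n - a))
      = T (?D f) +
        T (?D g)"
      using T_add[OF adm[OF add.hyps(1)] adm[OF add.hyps(2)]]
      by (simp add: sum.distrib distrib_left distrib_right)
    then show ?case using norm_triangle_mono[OF add.IH] by (simp add: distrib_right)
  next
    case (scale f a s)
    have "T (\<lambda>n. \<Sum>a\<in>subms n. \<Sum>r\<in>subms a. k r a * (of_real s * f (r, a) (n - a)) * \<sigma> a (n - a))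
      = of_real s * T (?D f)"
      unfolding T_cmult[symmetric] by (simp add: sum_distrib_left mult_ac)
    then show ?case using mult_left_mono[OF scale.IH scale.hyps(2)] scale.hyps(2)
      by (simp add: norm_mult mult.assoc)
  qed
qed

text \<open>Substitution n = a + b: summability over pairs permits the regrouping, and the inner
  sums are finite.\<close>

lemma T_pair_sum:
  assumes "(\<lambda>(a, b). F a b * complex_of_real (v (a + b))) summable_on {(a, b). a \<in> I \<and> b \<in> I \<and> C a}"
  shows "(\<Sum>\<^sub>\<infinity>(a, b)\<in>{(a, b). a \<in> I \<and> b \<in> I \<and> C a}. F a b * complex_of_real (v (a + b)))
    = T (\<lambda>n. \<Sum>a\<in>subms n. F a (n - a) * of_bool (C a))"
proof -
  let ?P = "{(a, b). a \<in> I \<and> b \<in> I \<and> C a}"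
  let ?S = "Sigma I (\<lambda>n. {a \<in> subms n. C a})"
  let ?f = "\<lambda>(a, b). F a b * complex_of_real (v (a + b))"
  have bij: "bij_betw (\<lambda>(n, a). (a, n - a)) ?S ?P"
  proof (rule bij_betwI[where g = "\<lambda>(a, b). (a + b, a)"])
    show "(\<lambda>(n, a). (a, n - a)) \<in> ?S \<rightarrow> ?P"
      using I_sub by (auto simp: subms_def)
    show "(\<lambda>(a, b). (a + b, a)) \<in> ?P \<rightarrow> ?S"
      by (auto simp: subms_def I_def)
  qed (auto simp: subms_def)
  have sm: "(\<lambda>z. ?f (case z of (n, a) \<Rightarrow> (a, n - a))) summable_on ?S"
    using assms unfolding summable_on_reindex_bij_betw[OF bij, of ?f] .
  have "infsum ?f ?P = (\<Sum>\<^sub>\<infinity>z\<in>?S. ?f (case z of (n, a) \<Rightarrow> (a, n - a)))"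
    by (rule infsum_reindex_bij_betw[OF bij, symmetric])
  also have "\<dots> = (\<Sum>\<^sub>\<infinity>n\<in>I. \<Sum>\<^sub>\<infinity>a\<in>{a \<in> subms n. C a}. F a (n - a) * complex_of_real (v (a + (n - a))))"
    using infsum_Sigma_banach[OF sm] by simp
  also have "\<dots> = T (\<lambda>n. \<Sum>a\<in>subms n. F a (n - a) * of_bool (C a))"
    unfolding T_def
  proof (rule infsum_cong)
    fix n assume "n \<in> I"
    have "(\<Sum>\<^sub>\<infinity>a\<in>{a \<in> subms n. C a}. F a (n - a) * complex_of_real (v (a + (n - a))))
       = (\<Sum>a\<in>{a \<in> subms n. C a}. F a (n - a) * complex_of_real (v (a + (n - a))))"
      by (rule infsum_finite) simp
    also have "\<dots> = (\<Sum>a\<in>{a \<in> subms n. C a}. F a (n - a) * complex_of_real (v n))"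
      by (rule sum.cong) (auto simp: subms_def)
    also have "\<dots> = (\<Sum>a\<in>subms n. F a (n - a) * of_bool (C a) * complex_of_real (v n))"
      by (rule sum.mono_neutral_cong_left) auto
    finally show "(\<Sum>\<^sub>\<infinity>a\<in>{a \<in> subms n. C a}. F a (n - a) * complex_of_real (v (a + (n - a))))
       = (\<Sum>a\<in>subms n. F a (n - a) * of_bool (C a)) * complex_of_real (v n)"
      by (simp only: sum_distrib_right)
  qed
  finally show ?thesis .
qed

text \<open>Substitution n = a + r merges the sifted sums for the finitely many \<open>r\<close>
  into a single divisor sum.\<close>

lemma sifted_eq_T:
  assumes "finite S" "S \<subseteq> I"
  shows "(\<Sum>r\<in>S. c r * (\<Sum>\<^sub>\<infinity>a\<in>{a \<in> I. C a}. complex_of_real (v (a + r))))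
    = T (\<lambda>n. \<Sum>r\<in>subms n. c r * of_bool (r \<in> S) * of_bool (C (n - r)))"
proof -
  let ?h = "\<lambda>r n. of_bool (r \<subseteq># n \<and> C (n - r)) * complex_of_real (v n)"
  have inner: "(\<Sum>\<^sub>\<infinity>a\<in>{a \<in> I. C a}. complex_of_real (v (a + r))) = (\<Sum>\<^sub>\<infinity>n\<in>I. ?h r n)" if "r \<in> S" for r
  proof -
    have "r \<in> I" using that assms by auto
    have "(\<Sum>\<^sub>\<infinity>a\<in>{a \<in> I. C a}. complex_of_real (v (a + r)))
       = (\<Sum>\<^sub>\<infinity>n\<in>{n \<in> I. r \<subseteq># n \<and> C (n - r)}. complex_of_real (v n))"
    proof (rule infsum_reindex_bij_witness[where i = "\<lambda>n. n - r" and j = "\<lambda>a. a + r"])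
      show "a + r \<in> {n \<in> I. r \<subseteq># n \<and> C (n - r)}" if "a \<in> {a \<in> I. C a}" for a
        using that \<open>r \<in> I\<close> by (auto simp: I_def)
      show "n - r \<in> {a \<in> I. C a}" if "n \<in> {n \<in> I. r \<subseteq># n \<and> C (n - r)}" for n
        using that I_sub[of n "n - r"] by auto
    qed auto
    also have "\<dots> = (\<Sum>\<^sub>\<infinity>n\<in>I. ?h r n)" by (rule infsum_cong_neutral) auto
    finally show ?thesis .
  qed
  have sm: "(\<lambda>n. c r * ?h r n) summable_on I" for r
  proof -
    have "adm (\<lambda>n. of_bool (r \<subseteq># n \<and> C (n - r)))"
      unfolding adm_def
    proof (intro exI[of _ 1] ballI)
      show "cmod (of_bool (r \<subseteq># n \<and> C (n - r))) \<le> 1 * real (tau 5 n)" for n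
        using tau5_pos[of n] by auto
    qed
    then show ?thesis by (intro summable_on_cmult_right adm_summable)
  qed
  have "(\<Sum>r\<in>S. c r * (\<Sum>\<^sub>\<infinity>a\<in>{a \<in> I. C a}. complex_of_real (v (a + r)))) = (\<Sum>r\<in>S. \<Sum>\<^sub>\<infinity>n\<in>I. c r * ?h r n)"
    using inner by (simp add: infsum_cmult_right')
  also have "\<dots> = (\<Sum>\<^sub>\<infinity>n\<in>I. \<Sum>r\<in>S. c r * ?h r n)"
    by (rule conjunct2[OF infsum_finite_sum[OF assms(1) sm]])
  also have "\<dots> = T (\<lambda>n. \<Sum>r\<in>subms n. c r * of_bool (r \<in> S) * of_bool (C (n - r)))"
    unfolding T_def
  proof (rule infsum_cong)
    fix n
    have "(\<Sum>r\<in>S. c r * ?h r n) = (\<Sum>r\<in>S \<inter> subms n. c r * ?h r n)"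
      by (rule sum.mono_neutral_right) (use assms in \<open>auto simp: subms_def\<close>)
    also have "\<dots> = (\<Sum>r\<in>subms n. c r * of_bool (r \<in> S) * of_bool (C (n - r)) * complex_of_real (v n))"
      by (rule sum.mono_neutral_cong_left) (simp, auto simp: subms_def)
    finally show "(\<Sum>r\<in>S. c r * ?h r n) = (\<Sum>r\<in>subms n. c r * of_bool (r \<in> S) * of_bool (C (n - r))) * complex_of_real (v n)"
      by (simp only: sum_distrib_right)
  qed
  finally show ?thesis .
qed

end

text \<open>Here \<open>lo\<close>, \<open>hi\<close> and \<open>xk\<close> stand for
  x^(\<mu>-\<iota>), x^(\<mu>+\<kappa>) and x^\<kappa>. The indices compared go up to
  \<open>card Q + 1\<close>, whence the condition on \<open>L\<close>.\<close>

locale sieve = weighted P nrm v + prime_set Q idx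
  for P :: "'p set" and nrm :: "'p \<Rightarrow> nat" and v :: "'p multiset \<Rightarrow> real"
    and Q :: "'p set" and idx :: "'p \<Rightarrow> nat" +
  fixes M lo hi xk Y :: real and L :: nat
  assumes Q_P: "Q \<subseteq> P" and Q_norm: "p \<in> Q \<Longrightarrow> real (nrm p) \<le> xk" and xk_pos: "xk > 0"
    and L: "card Q + 2 \<le> 2 ^ L"
    and typeI: "\<And>A :: 'p multiset \<Rightarrow> complex. (\<And>m. cmod (A m) \<le> real (tau 3 m)) \<Longrightarrow>
      cmod (T (\<lambda>n. \<Sum>a\<in>subms n. A a * of_bool (real (N a) \<le> M))) \<le> Y"
    and typeII: "\<And>A B :: 'p multiset \<Rightarrow> complex. (\<And>m. cmod (A m) \<le> real (tau 3 m)) \<Longrightarrow> (\<And>m. cmod (B m) \<le> real (tau 3 m)) \<Longrightarrow>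
      cmod (T (\<lambda>n. \<Sum>a\<in>subms n. A a * B (n - a) * of_bool (lo \<le> real (N a) \<and> real (N a) \<le> hi))) \<le> Y"
begin

definition sft :: "('p multiset \<Rightarrow> complex) \<Rightarrow> 'p multiset \<Rightarrow> complex" where
  "sft g n = (\<Sum>r\<in>subms n. g r * of_bool (free (n - r)))"

lemma tens_less_card:
  "\<exists>f. tens f (real L) \<and> (\<forall>i\<le>Suc (card Q). \<forall>j\<le>Suc (card Q). f i j = of_bool (i < j))"
proof -
  have "i < 2 ^ L" if "i \<le> Suc (card Q)" for i using that L by linarith
  then show ?thesis using tens_less[of L] by blast
qed

text \<open>A product a = r d of norm at most z <= M falls under Type I: its coefficient is a sum of
  bounded terms over the divisors \<open>r\<close> of \<open>a\<close>.\<close>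

lemma sieve_low_part:
  assumes z: "z \<le> M" and g: "\<And>r. cmod (g r) \<le> 1"
    and th: "\<And>a. \<theta> a \<Longrightarrow> real (N a) \<le> z"
  shows "adm (\<lambda>n. \<Sum>a\<in>subms n. \<Sum>r\<in>subms a. g r * mob (a - r) * of_bool (\<theta> a))"
    and "cmod (T (\<lambda>n. \<Sum>a\<in>subms n. \<Sum>r\<in>subms a. g r * mob (a - r) * of_bool (\<theta> a))) \<le> Y"
proof -
  have gm: "cmod (g r * mob (a - r) * of_bool (\<theta> a)) \<le> 1" for r a
    using mult_le_one[OF g _ cmod_mob, of "a - r" r] by (simp add: norm_mult)
  show "adm (\<lambda>n. \<Sum>a\<in>subms n. \<Sum>r\<in>subms a. g r * mob (a - r) * of_bool (\<theta> a))"
    by (rule adm_double_sum[OF gm]) simp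
  have "cmod (T (\<lambda>n. \<Sum>a\<in>subms n. (\<Sum>r\<in>subms a. g r * mob (a - r) * of_bool (\<theta> a)) * of_bool (real (N a) \<le> M))) \<le> Y"
    using gm by (intro typeI norm_inner_sum_le)
  moreover have eq: "(\<Sum>r\<in>subms a. g r * mob (a - r) * of_bool (\<theta> a)) * of_bool (real (N a) \<le> M)
      = (\<Sum>r\<in>subms a. g r * mob (a - r) * of_bool (\<theta> a))" for a
    using th[of a] z by (cases "\<theta> a") auto
  ultimately show "cmod (T (\<lambda>n. \<Sum>a\<in>subms n. \<Sum>r\<in>subms a. g r * mob (a - r) * of_bool (\<theta> a))) \<le> Y"
    unfolding eq by blast
qed

lemma diff_diff_eq: "r \<subseteq># a \<Longrightarrow> n - r - (a - r) = n - (a::'p multiset)"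
  by (metis diff_diff_add_mset subset_mset.add_diff_inverse)

text \<open>When \<open>d\<close> is built up from its largest prime downwards, the norm of \<open>r d\<close> crosses \<open>z\<close> inside the
  Type II range; only the order of the least primes couples the two factors.\<close>

lemma sieve_small:
  assumes z: "lo \<le> z" "z \<le> M" "z * xk \<le> hi"
    and g: "\<And>r. cmod (g r) \<le> 1" "\<And>r. g r \<noteq> 0 \<Longrightarrow> real (N r) \<le> hi"
  shows "cmod (T (sft g)) \<le> (2 + real L) * Y"
proof -
  let ?\<theta> = "\<lambda>r d. real (N (r + d)) < z"
  \<comment> \<open>An \<open>r\<close> of norm at least z is in the Type II range by itself, with
    the sifting condition as second coefficient; only smaller ones need the Moebius sum.\<close>
  define g1 where "g1 r = g r * of_bool (real (N r) < z)" for r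
  define g2 where "g2 r = g r * of_bool (\<not> real (N r) < z)" for r
  have g1: "cmod (g1 r) \<le> 1" and g2: "cmod (g2 r) \<le> 1" for r
    using g(1)[of r] by (simp_all add: g1_def g2_def norm_mult)
  have adm1: "adm (sft h)" if "\<And>r. cmod (h r) \<le> 1" for h
  proof -
    have "cmod (sft h n) \<le> 1 * real (tau 5 n)" for n
    proof -
      have "cmod (sft h n) \<le> (\<Sum>r\<in>subms n. 1)"
        unfolding sft_def using that by (intro sum_norm_le) (simp add: norm_mult)
      also have "\<dots> \<le> real (tau 5 n)" using card_subms_le_tau5[of n] by simp
      finally show ?thesis by simp
    qed
    then show ?thesis unfolding adm_def by blast
  qed
  have split: "T (sft g) = T (sft g1) + T (sft g2)"
  proof -
    have "g r = g1 r + g2 r" for r by (simp add: g1_def g2_def)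
    then show ?thesis by (subst T_add[symmetric, OF adm1[OF g1] adm1[OF g2]]) (simp add: sft_def[abs_def] distrib_right sum.distrib)
  qed
  have part2: "cmod (T (sft g2)) \<le> Y"
  proof -
    have "cmod (T (\<lambda>n. \<Sum>r\<in>subms n. g2 r * of_bool (free (n - r)) * of_bool (lo \<le> real (N r) \<and> real (N r) \<le> hi))) \<le> Y"
    proof (rule typeII)
      show "cmod (g2 m) \<le> real (tau 3 m)" for m using g2[of m] tau_pos[of m] by linarith
      show "cmod (of_bool (free m)) \<le> real (tau 3 m)" for m using tau_pos[of m] by auto
    qed
    moreover have "g2 r * c * of_bool (lo \<le> real (N r) \<and> real (N r) \<le> hi) = g2 r * c" for r c
      using g(2)[of r] z(1) by (auto simp: g2_def)
    ultimately show ?thesis by (simp add: sft_def[abs_def])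
  qed
  \<comment> \<open>Coefficient of the terms where the norm of a = r d has reached z, but not before
    the least prime of d was included.\<close>
  define kk where "kk r a = g1 r * mob (a - r) * of_bool (?\<theta> r (a - r - {#minp (a - r)#}) \<and> \<not> real (N a) < z)" for r a
  have kk: "cmod (kk r a) \<le> 1" for r a
    using mult_le_one[OF g1 _ cmod_mob, of "a - r" r] by (simp add: norm_mult kk_def)
  have kk_range: "lo \<le> real (N a) \<and> real (N a) \<le> hi" if nz: "kk r a \<noteq> 0" and "r \<subseteq># a" "a \<in> I" for r a
  proof -
    have c: "g1 r \<noteq> 0" "mob (a - r) \<noteq> 0" "?\<theta> r (a - r - {#minp (a - r)#})" "\<not> real (N a) < z"
      using nz by (auto simp: kk_def)
    \<comment> \<open>Hence d = a - r is nonempty, \<open>minp d\<close> is a genuine prime of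
      \<open>Q\<close>, and z is overshot by a factor of at most \<open>xk\<close>.\<close>
    have "real (N r) < z" using c(1) by (auto simp: g1_def)
    then have "a - r \<noteq> {#}" using c(4) \<open>r \<subseteq># a\<close> by (metis subset_mset.add_diff_inverse add_0_right)
    moreover have "set_mset (a - r) \<subseteq> Q" using c(2) by (auto simp: mob_def split: if_splits)
    ultimately have "\<not> free (a - r)" unfolding free_def by (metis multiset_nonemptyE subsetD)
    then have p: "minp (a - r) \<in> Q" "minp (a - r) \<in># a - r" using minp low_less_iff by blast+
    define b where "b = r + (a - r - {#minp (a - r)#})"
    have "a = r + (a - r)" using \<open>r \<subseteq># a\<close> by simp
    also have "a - r = add_mset (minp (a - r)) (a - r - {#minp (a - r)#})" by (rule insert_DiffM[OF p(2), symmetric])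
    finally have ab: "a = add_mset (minp (a - r)) b" unfolding b_def by simp
    then have "b \<subseteq># a" by (metis mset_subset_eq_add_mset_cancel subset_mset.order_refl mset_subset_eq_add_right add_mset_add_single union_commute mset_subset_eq_add_left)
    have "real (N a) = real (nrm (minp (a - r))) * real (N b)" using ab N_add_mset by (metis of_nat_mult)
    also have "\<dots> \<le> xk * z" using c(3) Q_norm[OF p(1)] xk_pos unfolding b_def[symmetric]
      by (intro mult_mono) auto
    finally show ?thesis using z c(4) by (auto simp: mult.commute)
  qed
  obtain f where f: "tens f (real L)" "\<And>i j. i \<le> Suc (card Q) \<Longrightarrow> j \<le> Suc (card Q) \<Longrightarrow> f i j = of_bool (i < j)"
    using tens_less_card by blast
  \<comment> \<open>The weak inequality between \<open>low (a - r)\<close> and \<open>low e\<close>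
    becomes a strict one against \<open>Suc (low e)\<close>.\<close>
  define F where "F = (\<lambda>(r, a) e. f (low (a - r)) (Suc (low e)))"
  have tF: "tens F (real L)"
    using tens_comp[OF f(1), of "\<lambda>(r, a). low (a - r)" "\<lambda>e. Suc (low e)"] by (simp add: F_def case_prod_unfold)
  have F: "F (r, a) e = of_bool (low (a - r) \<le> low e)" for r a e
    using f(2)[of "low (a - r)" "Suc (low e)"] low_le_card[of "a - r"] low_le_card[of e] by (simp add: F_def less_Suc_eq_le)
  let ?\<sigma> = "\<lambda>a (e::'p multiset). of_bool (lo \<le> real (N a) \<and> real (N a) \<le> hi) :: complex"
  have hi_bound: "cmod (T (\<lambda>n. \<Sum>a\<in>subms n. \<Sum>r\<in>subms a. kk r a * F (r, a) (n - a) * ?\<sigma> a (n - a))) \<le> real L * Y"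
  proof (rule bilinear_tens[OF tF])
    fix A b :: "'p multiset \<Rightarrow> complex" assume A: "\<And>m. cmod (A m) \<le> real (tau 3 m)" and b: "\<And>m. cmod (b m) \<le> 1"
    show "cmod (T (\<lambda>n. \<Sum>a\<in>subms n. A a * b (n - a) * ?\<sigma> a (n - a))) \<le> Y"
      by (rule typeII[OF A le_tau[OF b]])
  qed (auto intro: kk)
  have adm_hi: "adm (\<lambda>n. \<Sum>a\<in>subms n. \<Sum>r\<in>subms a. kk r a * F (r, a) (n - a) * ?\<sigma> a (n - a))"
  proof -
    have "cmod (kk r a * F (r, a) e * ?\<sigma> a e) \<le> 1" for r a e
      using kk[of r a] by (auto simp: norm_mult F)
    then show ?thesis by (rule adm_double_sum) simp
  qed
  have "T (sft g1)
    = T (\<lambda>n. (\<Sum>a\<in>subms n. \<Sum>r\<in>subms a. g1 r * mob (a - r) * of_bool (real (N a) < z)) +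
        (\<Sum>a\<in>subms n. \<Sum>r\<in>subms a. kk r a * F (r, a) (n - a) * ?\<sigma> a (n - a)))"
  proof (rule T_cong)
    fix n assume n: "n \<in> I"
    have "sft g1 n =
      (\<Sum>r\<in>subms n. (\<Sum>d\<in>subms (n - r). g1 r * (mob d * of_bool (?\<theta> r d)))
        + (\<Sum>d\<in>subms (n - r). g1 r * (mob d * of_bool (?\<theta> r (d - {#minp d#}) \<and> \<not> ?\<theta> r d \<and> low d \<le> low (n - r - d)))))"
      unfolding sft_def
    proof (intro sum.cong refl, goal_cases)
      case (1 r)
      show ?case
      proof (cases "real (N r) < z")
        case True
        have mono: "?\<theta> r d" if "p \<in> Q" "?\<theta> r (add_mset p d)" for p d
        proof -
          have "1 \<le> nrm p" using that Q_P nrm_pos by auto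
          then have "1 * real (N (r + d)) \<le> real (nrm p) * real (N (r + d))" by (intro mult_right_mono) auto
          then show ?thesis using that(2) by (simp add: N_add_mset)
        qed
        show ?thesis
          using buchstab_above[of "?\<theta> r" "n - r"] True mono
          by (simp add: sum_distrib_left[symmetric] distrib_left)
      next
        case False
        then show ?thesis by (simp add: g1_def)
      qed
    qed
    also have "\<dots> = (\<Sum>a\<in>subms n. \<Sum>r\<in>subms a. g1 r * (mob (a - r) * of_bool (?\<theta> r (a - r)))) +
      (\<Sum>a\<in>subms n. \<Sum>r\<in>subms a. g1 r * (mob (a - r) * of_bool (?\<theta> r (a - r - {#minp (a - r)#}) \<and> \<not> ?\<theta> r (a - r) \<and> low (a - r) \<le> low (n - r - (a - r)))))"
      unfolding sum.distrib sum_subms_swap ..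
    also have "\<dots> = (\<Sum>a\<in>subms n. \<Sum>r\<in>subms a. g1 r * mob (a - r) * of_bool (real (N a) < z)) +
        (\<Sum>a\<in>subms n. \<Sum>r\<in>subms a. kk r a * F (r, a) (n - a) * ?\<sigma> a (n - a))"
    proof (intro arg_cong2[where f = "(+)"] sum.cong refl)
      fix a r assume ar: "a \<in> subms n" "r \<in> subms a"
      then have r: "r + (a - r) = a" and sub: "r \<subseteq># a" "a \<in> I" using n I_sub by (auto simp: subms_def)
      show "g1 r * (mob (a - r) * of_bool (?\<theta> r (a - r))) = g1 r * mob (a - r) * of_bool (real (N a) < z)"
        unfolding r by simp
      have "kk r a * F (r, a) (n - a) * ?\<sigma> a (n - a) = kk r a * F (r, a) (n - a)"
        using kk_range[OF _ sub] by (cases "kk r a = 0") auto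
      then show "g1 r * (mob (a - r) * of_bool (?\<theta> r (a - r - {#minp (a - r)#}) \<and> \<not> ?\<theta> r (a - r) \<and> low (a - r) \<le> low (n - r - (a - r))))
        = kk r a * F (r, a) (n - a) * ?\<sigma> a (n - a)"
        unfolding r diff_diff_eq[OF sub(1)] by (auto simp: kk_def F)
    qed
    finally show "sft g1 n = \<dots>" .
  qed
  also have "\<dots> = T (\<lambda>n. \<Sum>a\<in>subms n. \<Sum>r\<in>subms a. g1 r * mob (a - r) * of_bool (real (N a) < z)) +
        T (\<lambda>n. \<Sum>a\<in>subms n. \<Sum>r\<in>subms a. kk r a * F (r, a) (n - a) * ?\<sigma> a (n - a))"
    using z by (intro T_add sieve_low_part[of z] adm_hi g1) auto
  finally have "cmod (T (sft g1)) \<le> Y + real L * Y"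
    using norm_triangle_mono[OF sieve_low_part(2)[of z g1 "\<lambda>a. real (N a) < z"] hi_bound] z g1 by simp
  then show ?thesis unfolding split using norm_triangle_mono[OF _ part2] by (fastforce simp: algebra_simps)
qed

text \<open>Here the factor \<open>b\<close> just before crossing \<open>z\<close> is kept, and it is the complementary factor of \<open>n\<close>
  that lies in the Type II range unless the norm of \<open>n\<close> is exceptional.\<close>

lemma sieve_large:
  assumes z: "0 < z" "z \<le> M" "z < 2 ^ L"
    and g: "\<And>r. cmod (g r) \<le> 1" "\<And>r. g r \<noteq> 0 \<Longrightarrow> real (N r) \<le> z"
    and out: "(\<Sum>\<^sub>\<infinity>n\<in>{n \<in> I. real (N n) \<notin> {z * lo..z * hi / xk}}. real (tau 5 n) * \<bar>v n\<bar>) \<le> E"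
  shows "cmod (T (sft g)) \<le> (1 + real L * real L) * Y + E"
proof -
  let ?\<theta> = "\<lambda>r d. real (N (r + d)) \<le> z"
  define kk where "kk r b = g r * mob (b - r) * of_bool (real (N b) \<le> z)" for r b
  have kk: "cmod (kk r b) \<le> 1" for r b
    using mult_le_one[OF g(1) _ cmod_mob, of "b - r" r] by (simp add: norm_mult kk_def)
  define C where "C r b e \<longleftrightarrow> \<not> real (N (add_mset (minp e) b)) \<le> z \<and> low e < low (b - r)" for r b e
  let ?\<sigma> = "\<lambda>(b::'p multiset) e. of_bool (lo \<le> real (N e) \<and> real (N e) \<le> hi) :: complex"
  obtain f1 where f1: "tens f1 (real L)" "\<And>i j. i \<le> Suc (card Q) \<Longrightarrow> j \<le> Suc (card Q) \<Longrightarrow> f1 i j = of_bool (i < j)"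
    using tens_less_card by blast
  obtain f2 where f2: "tens f2 (real L)" "\<forall>i<2^L. \<forall>j<2^L. f2 i j = of_bool (i < (j::nat))"
    using tens_less[of L] by blast
  \<comment> \<open>N(p b) > z is equivalent to N b exceeding the integer part of z / N p, a
    comparison of two integers below 2^L.\<close>
  define s where "s e = nat \<lfloor>z / real (nrm (minp e))\<rfloor>" for e
  define F where "F = (\<lambda>(r, b) e. f1 (low e) (low (b - r)) * f2 (s e) (N b))"
  have tF: "tens F (real L * real L)"
    using tens_flip[OF tens_mult[OF tens_comp[OF f1(1), of low "\<lambda>j. low (snd j - fst j)"]
        tens_comp[OF f2(1), of s "\<lambda>j. N (snd j)"]]]
    by (simp add: F_def case_prod_unfold)
  have F: "kk r b * F (r, b) e = kk r b * of_bool (C r b e)" for r b e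
  proof (cases "real (N b) \<le> z \<and> low e < low (b - r)")
    case False
    then show ?thesis
      using f1(2)[of "low e" "low (b - r)"] low_le_card[of e] low_le_card[of "b - r"]
      by (auto simp: kk_def F_def C_def)
  next
    case True
    \<comment> \<open>This excludes the default value \<open>card Q\<close>, so
      \<open>minp e\<close> is a genuine prime.\<close>
    then have "low e < card Q" using low_le_card[of "b - r"] by linarith
    then have np: "1 \<le> nrm (minp e)" using minp(1) Q_P nrm_pos by blast
    have "real (N b) < 2 ^ L" using True z by linarith
    then have Nb: "N b < 2 ^ L" by (metis of_nat_less_iff of_nat_numeral of_nat_power)
    have "z / real (nrm (minp e)) \<le> z / 1" using np z by (intro divide_left_mono) auto
    then have "z / real (nrm (minp e)) < 2 ^ L" using z by linarith
    then have "\<lfloor>z / real (nrm (minp e))\<rfloor> < 2 ^ L" by (simp add: floor_less_iff)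
    then have "s e < 2 ^ L" unfolding s_def by (simp add: nat_less_iff z(1) less_imp_le)
    then have "f2 (s e) (N b) = of_bool (s e < N b)" using f2(2) Nb by simp
    moreover have "s e < N b \<longleftrightarrow> z / real (nrm (minp e)) < real (N b)"
      unfolding s_def using z np by (simp add: nat_less_iff floor_less_iff)
    moreover have "\<dots> \<longleftrightarrow> \<not> real (N (add_mset (minp e) b)) \<le> z"
      using np by (simp add: N_add_mset field_simps not_le)
    ultimately show ?thesis
      using f1(2)[of "low e" "low (b - r)"] low_le_card[of e] low_le_card[of "b - r"] True
      by (simp add: F_def C_def)
  qed
  define Gin where "Gin n = (\<Sum>b\<in>subms n. \<Sum>r\<in>subms b. kk r b * F (r, b) (n - b) * ?\<sigma> b (n - b))" for n
  \<comment> \<open>Terms whose complementary factor misses the Type II range; they are bounded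
    trivially by \<open>tau 5\<close>.\<close>
  define Gout where "Gout n = (\<Sum>b\<in>subms n. \<Sum>r\<in>subms b. kk r b * of_bool (C r b (n - b)) * (1 - ?\<sigma> b (n - b)))" for n
  define Glow where "Glow n = (\<Sum>a\<in>subms n. \<Sum>r\<in>subms a. g r * mob (a - r) * of_bool (real (N a) \<le> z))" for n
  have Gin: "cmod (T Gin) \<le> real L * real L * Y"
    unfolding Gin_def
  proof (rule bilinear_tens[OF tF])
    fix A b :: "'p multiset \<Rightarrow> complex" assume A: "\<And>m. cmod (A m) \<le> real (tau 3 m)" and b: "\<And>m. cmod (b m) \<le> 1"
    \<comment> \<open>The Type II variable is now the complementary factor, so the two coefficients
      exchange their places.\<close>
    have "cmod (T (\<lambda>n. \<Sum>d\<in>subms n. b d * A (n - d) * of_bool (lo \<le> real (N d) \<and> real (N d) \<le> hi))) \<le> Y"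
      by (rule typeII[OF le_tau[OF b] A])
    then show "cmod (T (\<lambda>n. \<Sum>a\<in>subms n. A a * b (n - a) * ?\<sigma> a (n - a))) \<le> Y"
      using sum_subms_complement[of "\<lambda>d e. b d * A e * of_bool (lo \<le> real (N d) \<and> real (N d) \<le> hi)"]
      by (simp add: mult_ac)
  qed (auto intro: kk)
  have adm_in: "adm Gin"
  proof -
    have "cmod (kk r b * F (r, b) e * ?\<sigma> b e) \<le> 1" for r b e
      using kk[of r b] by (auto simp: norm_mult F)
    then show ?thesis unfolding Gin_def by (rule adm_double_sum) simp
  qed
  have Gout_le: "cmod (Gout n) \<le> 1 * real (tau 5 n)" for n
    unfolding Gout_def using kk by (intro norm_double_sum_le) (auto simp: norm_mult)
  have adm_out: "adm Gout" unfolding adm_def using Gout_le by blast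
  have Glow: "adm Glow" "cmod (T Glow) \<le> Y"
    unfolding Glow_def using sieve_low_part[of z g "\<lambda>a. real (N a) \<le> z"] z g(1) by auto
  let ?O = "{n \<in> I. real (N n) \<notin> {z * lo..z * hi / xk}}"
  \<comment> \<open>Crossing at b means z / xk < N b <= z. If N n lies in the given interval, the
    complementary norm N n / N b lies between \<open>lo\<close> and \<open>hi\<close>.\<close>
  have Gout_0: "Gout n = 0" if n: "n \<in> I" "n \<notin> ?O" for n
    unfolding Gout_def
  proof (intro sum.neutral ballI)
    fix b r assume "b \<in> subms n" "r \<in> subms b"
    then have b: "b \<subseteq># n" by (simp add: subms_def)
    show "kk r b * of_bool (C r b (n - b)) * (1 - ?\<sigma> b (n - b)) = 0"
    proof (rule ccontr)
      assume "\<not> ?thesis"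
      then have nz: "kk r b \<noteq> 0" "C r b (n - b)" "\<not> (lo \<le> real (N (n - b)) \<and> real (N (n - b)) \<le> hi)" by auto
      have Nb: "real (N b) \<le> z" using nz(1) by (auto simp: kk_def)
      have Npos: "1 \<le> N b" "1 \<le> N (n - b)" using N_pos I_sub[OF n(1)] b by auto
      have "low (n - b) < card Q" using nz(2) low_le_card[of "b - r"] by (auto simp: C_def)
      then have "real (nrm (minp (n - b))) \<le> xk" using minp(1) Q_norm by blast
      then have "real (nrm (minp (n - b))) * real (N b) \<le> xk * real (N b)" by (intro mult_right_mono) auto
      then have big: "z < xk * real (N b)" using nz(2) by (auto simp: C_def N_add_mset)
      have "n = b + (n - b)" using b by simp
      then have Nn: "real (N n) = real (N b) * real (N (n - b))" by (metis N_add of_nat_mult)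
      have "z * lo \<le> real (N n)" "real (N n) \<le> z * hi / xk" using n by auto
      then have in1: "z * lo \<le> real (N b) * real (N (n - b))" and in2: "real (N b) * real (N (n - b)) * xk \<le> z * hi"
        unfolding Nn using xk_pos by (simp_all add: field_simps)
      show False
      proof (cases "lo \<le> real (N (n - b))")
        case True
        then have "hi < real (N (n - b))" using nz(3) by simp
        then have "z * hi < z * real (N (n - b))" using z(1) by simp
        also have "\<dots> \<le> xk * real (N b) * real (N (n - b))" using big by (intro mult_right_mono) auto
        finally show False using in2 by (simp add: mult_ac)
      next
        case False
        have "real (N b) * real (N (n - b)) \<le> z * real (N (n - b))" using Nb by (intro mult_right_mono) auto
        also have "\<dots> < z * lo" using False z(1) by simp
        finally show False using in1 by simp
      qed
    qed
  qed
  have Gout: "cmod (T Gout) \<le> E"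
  proof -
    have sO: "(\<lambda>n. Gout n * complex_of_real (v n)) abs_summable_on ?O"
      using adm_abs_summable[OF adm_out] by (rule summable_on_subset_banach) auto
    have "(\<lambda>n. real (tau 5 n) * \<bar>v n\<bar>) summable_on I" using summ unfolding I_def by (simp add: abs_mult)
    then have sT: "(\<lambda>n. real (tau 5 n) * \<bar>v n\<bar>) summable_on ?O"
      by (rule summable_on_subset_banach) auto
    have "T Gout = (\<Sum>\<^sub>\<infinity>n\<in>?O. Gout n * complex_of_real (v n))"
      unfolding T_def using Gout_0 by (intro infsum_cong_neutral) auto
    also have "cmod \<dots> \<le> (\<Sum>\<^sub>\<infinity>n\<in>?O. cmod (Gout n * complex_of_real (v n)))"
      by (rule norm_infsum_bound[OF sO])
    also have "\<dots> \<le> (\<Sum>\<^sub>\<infinity>n\<in>?O. real (tau 5 n) * \<bar>v n\<bar>)"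
      using sO sT
    proof (rule infsum_mono)
      show "cmod (Gout n * complex_of_real (v n)) \<le> real (tau 5 n) * \<bar>v n\<bar>" for n
        using mult_right_mono[OF Gout_le[of n], of "\<bar>v n\<bar>"] by (simp add: norm_mult)
    qed
    also have "\<dots> \<le> E" by (rule out)
    finally show ?thesis .
  qed
  have "T (sft g) = T (\<lambda>n. Glow n + (-1) * (Gin n + Gout n))"
  proof (rule T_cong)
    fix n assume n: "n \<in> I"
    have "sft g n =
      (\<Sum>r\<in>subms n. (\<Sum>d\<in>subms (n - r). g r * (mob d * of_bool (?\<theta> r d)))
        - (\<Sum>d\<in>subms (n - r). g r * (mob d * of_bool (?\<theta> r d \<and> \<not> ?\<theta> r (add_mset (minp (n - r - d)) d) \<and> low (n - r - d) < low d))))"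
      unfolding sft_def
    proof (intro sum.cong refl, goal_cases)
      case (1 r)
      show ?case
      proof (cases "g r = 0")
        case False
        have mono: "?\<theta> r d" if "p \<in> Q" "?\<theta> r (add_mset p d)" for p d
        proof -
          have "1 \<le> nrm p" using that Q_P nrm_pos by auto
          then have "1 * real (N (r + d)) \<le> real (nrm p) * real (N (r + d))" by (intro mult_right_mono) auto
          then show ?thesis using that(2) by (simp add: N_add_mset)
        qed
        show ?thesis
          using buchstab_below[of "?\<theta> r" "n - r"] g(2)[OF False] mono
          by (simp add: sum_distrib_left[symmetric] right_diff_distrib)
      qed simp
    qed
    also have "\<dots> = (\<Sum>a\<in>subms n. \<Sum>r\<in>subms a. g r * (mob (a - r) * of_bool (?\<theta> r (a - r)))) -
      (\<Sum>a\<in>subms n. \<Sum>r\<in>subms a. g r * (mob (a - r) * of_bool (?\<theta> r (a - r) \<and> \<not> ?\<theta> r (add_mset (minp (n - r - (a - r))) (a - r)) \<and> low (n - r - (a - r)) < low (a - r))))"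
      unfolding sum_subtractf sum_subms_swap ..
    also have "\<dots> = Glow n - (Gin n + Gout n)"
      unfolding Glow_def Gin_def Gout_def sum.distrib[symmetric]
    proof (intro arg_cong2[where f = "(-)"] sum.cong refl)
      fix a r assume ar: "a \<in> subms n" "r \<in> subms a"
      then have r: "r + (a - r) = a" and sub: "r \<subseteq># a" by (auto simp: subms_def)
      show "g r * (mob (a - r) * of_bool (?\<theta> r (a - r))) = g r * mob (a - r) * of_bool (real (N a) \<le> z)"
        unfolding r by simp
      have "kk r a * F (r, a) (n - a) * ?\<sigma> a (n - a) + kk r a * of_bool (C r a (n - a)) * (1 - ?\<sigma> a (n - a))
         = kk r a * of_bool (C r a (n - a))" unfolding F by (simp add: algebra_simps)
      moreover have "r + add_mset p (a - r) = add_mset p a" for p using r by simp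
      ultimately show "g r * (mob (a - r) * of_bool (?\<theta> r (a - r) \<and> \<not> ?\<theta> r (add_mset (minp (n - r - (a - r))) (a - r)) \<and> low (n - r - (a - r)) < low (a - r)))
        = kk r a * F (r, a) (n - a) * ?\<sigma> a (n - a) + kk r a * of_bool (C r a (n - a)) * (1 - ?\<sigma> a (n - a))"
        unfolding r diff_diff_eq[OF sub] by (auto simp: kk_def C_def)
    qed
    finally show "sft g n = Glow n + (-1) * (Gin n + Gout n)" by simp
  qed
  also have "\<dots> = T Glow + (-1) * (T Gin + T Gout)"
  proof -
    have a1: "adm (\<lambda>n. Gin n + Gout n)" by (rule adm_add[OF adm_in adm_out])
    have a2: "adm (\<lambda>n. (-1) * (Gin n + Gout n))" using a1 unfolding adm_def norm_mult by simp
    show ?thesis unfolding T_add[OF Glow(1) a2] T_cmult T_add[OF adm_in adm_out] ..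
  qed
  finally have "cmod (T (sft g)) = cmod (T Glow - (T Gin + T Gout))"
    by (simp only: mult_minus1 diff_conv_add_uminus)
  also have "\<dots> \<le> cmod (T Glow) + (cmod (T Gin) + cmod (T Gout))"
    by (intro order.trans[OF norm_triangle_ineq4] add_left_mono norm_triangle_ineq)
  also have "\<dots> \<le> Y + (real L * real L * Y + E)" using Glow Gin Gout by (intro add_mono)
  finally show ?thesis by (simp add: algebra_simps)
qed

end

section \<open>The sieve on ideals\<close>

context numfield
begin

lemma foldr_iprod:
  "set ms \<subseteq> pmsets \<Longrightarrow> foldr (ideal_mult K) (map iprod ms) \<O> = iprod (sum_list ms)"
proof (induction ms)
  case (Cons m ms)
  have "m \<in> pmsets" using Cons.prems by auto
  moreover have "sum_list ms \<in> pmsets" using Cons.prems by (induction ms) auto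
  ultimately show ?case using Cons iprod_plus[of m "sum_list ms"] by simp
qed simp

text \<open>By unique factorization \<open>iprod\<close> matches ordered factorizations of a
  multiset with those of its ideal.\<close>

lemma divisor_fun_iprod:
  assumes "M \<in> pmsets"
  shows "divisor_fun K k (iprod M) = tau k M"
proof -
  let ?A = "{ms. length ms = k \<and> sum_list ms = M}"
  have sub: "set ms \<subseteq> pmsets" if "sum_list ms \<in> pmsets" for ms :: "'a set multiset list"
    using that by (induction ms) auto
  have "{bs. length bs = k \<and> set bs \<subseteq> nz_ideals K \<and> foldr (ideal_mult K) bs (carrier R) = iprod M} = map iprod ` ?A"
  proof (intro equalityI subsetI)
    fix bs assume "bs \<in> {bs. length bs = k \<and> set bs \<subseteq> nz_ideals K \<and> foldr (ideal_mult K) bs (carrier R) = iprod M}"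
    then have bs: "length bs = k" "set bs \<subseteq> nz_ideals K" "foldr (ideal_mult K) bs \<O> = iprod M" by auto
    have "\<forall>b\<in>nz_ideals K. \<exists>m. m \<in> pmsets \<and> b = iprod m" using iprod_surj by blast
    then obtain h where h: "\<And>b. b \<in> nz_ideals K \<Longrightarrow> h b \<in> pmsets \<and> b = iprod (h b)" by metis
    define ms where "ms = map h bs"
    have ms: "set ms \<subseteq> pmsets" unfolding ms_def set_map using bs(2) h by blast
    have "map iprod ms = bs" unfolding ms_def map_map
    proof (rule map_idI)
      fix b assume "b \<in> set bs"
      then show "(iprod \<circ> h) b = b" using bs(2) h[of b] by auto
    qed
    moreover have "sum_list ms \<in> pmsets" using ms by (induction ms) auto
    then have "sum_list ms = M" using iprod_inj[of "sum_list ms" M] foldr_iprod[OF ms] calculation bs(3) assms by simp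
    ultimately show "bs \<in> map iprod ` ?A" using bs(1) by (intro image_eqI[of _ _ ms]) auto
  next
    fix bs assume "bs \<in> map iprod ` ?A"
    then obtain ms where ms: "length ms = k" "sum_list ms = M" "bs = map iprod ms" by auto
    then have "set ms \<subseteq> pmsets" using sub[of ms] assms by simp
    then show "bs \<in> {bs. length bs = k \<and> set bs \<subseteq> nz_ideals K \<and> foldr (ideal_mult K) bs (carrier R) = iprod M}"
      using foldr_iprod[of ms] ms pmsets_nz by auto
  qed
  moreover have "inj_on (map iprod) ?A"
  proof (rule inj_onI)
    fix ms ns assume "ms \<in> ?A" "ns \<in> ?A" and eq: "map iprod ms = map iprod ns"
    then have "set ms \<subseteq> pmsets" "set ns \<subseteq> pmsets" using sub[of ms] sub[of ns] assms by simp_all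
    then have "inj_on iprod (set ms \<union> set ns)"
      using bij_betw_iprod inj_on_subset[of iprod pmsets "set ms \<union> set ns"] by (simp add: bij_betw_def)
    then show "ms = ns" using eq by (metis map_inj_on)
  qed
  ultimately show ?thesis unfolding divisor_fun_def tau_def by (simp add: card_image)
qed

lemma finprod_primes:
  assumes "finite Q" "Q \<subseteq> nz_primes K"
  shows "finprod (ideals_set R) (\<lambda>p. p) Q = iprod (mset_set Q)"
  using assms
proof (induction rule: finite_induct)
  case empty
  have "finprod (ideals_set R) (\<lambda>p. p) {} = \<one>\<^bsub>ideals_set R\<^esub>"
    by (rule comm_monoid.finprod_empty[OF ideals_set_is_comm_monoid])
  then show ?case by (simp add: ideals_set_def)
next
  case (insert p Q)
  interpret I: comm_monoid "ideals_set R" by (rule ideals_set_is_comm_monoid)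
  have c: "q \<in> carrier (ideals_set R)" if "q \<in> insert p Q" for q
    using that insert.prems nz_primesD(1) by (auto simp: ideals_set_def)
  have "finprod (ideals_set R) (\<lambda>p. p) (insert p Q) = ideal_mult K p (finprod (ideals_set R) (\<lambda>p. p) Q)"
    using I.finprod_insert[OF insert.hyps, of "\<lambda>p. p"] c by (auto simp: ideals_set_def)
  also have "\<dots> = iprod (add_mset p (mset_set Q))"
    using insert by (subst iprod_add_prime) auto
  finally show ?case using insert.hyps by simp
qed

text \<open>If the sum of the two ideals is proper, it lies in a prime, which then divides
  both.\<close>

lemma coprime_iff:
  assumes "M \<in> pmsets" "N \<in> pmsets"
  shows "coprime_ideals K (iprod M) (iprod N) \<longleftrightarrow> (\<forall>p\<in>#N. p \<notin># M)"
proof -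
  let ?S = "set_add R (iprod M) (iprod N)"
  have A: "ideal (iprod M) R" "ideal (iprod N) R" using pmsets_nz nz_idealsD(1) assms by auto
  have S: "ideal ?S R" by (rule add_ideals[OF A])
  have sub: "iprod M \<subseteq> ?S" "iprod N \<subseteq> ?S"
    using ideal_0[OF A(1)] ideal_0[OF A(2)] unfolding set_add_def' by force+
  have "?S \<noteq> \<O> \<longleftrightarrow> (\<exists>p\<in>#N. p \<in># M)"
  proof
    assume "?S \<noteq> \<O>"
    moreover have "?S \<in> nz_ideals K"
    proof -
      obtain x where "x \<in> iprod M" "x \<noteq> 0"
        using nz_idealsD(2)[OF pmsets_nz[OF assms(1)]] ideal_0[OF A(1)] by auto
      then have "?S \<noteq> {0}" using sub(1) by auto
      then show ?thesis using S by (simp add: nz_ideals_def)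
    qed
    ultimately obtain p where p: "p \<in> nz_primes K" "?S \<subseteq> p" by (metis contained_in_prime)
    then have "p \<in># M" "p \<in># N"
      using sub prime_contains_iprod[OF p(1) assms(1)] prime_contains_iprod[OF p(1) assms(2)] by auto
    then show "\<exists>p\<in>#N. p \<in># M" by blast
  next
    assume "\<exists>p\<in>#N. p \<in># M"
    then obtain p where p: "p \<in># N" "p \<in># M" by blast
    then have P: "p \<in> nz_primes K" using assms by auto
    have "iprod M \<subseteq> p" "iprod N \<subseteq> p" using iprod_subset_prime_iff[OF P] assms p by auto
    then have "?S \<subseteq> p" unfolding set_add_def' using ideal_add[OF nz_primesD(1)[OF P]] by auto
    then show "?S \<noteq> \<O>" using nz_primesD(5)[OF P] O_1 by blast
  qed
  then show ?thesis unfolding coprime_ideals_def by auto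
qed

lemma infsum_ideals_iprod: "(\<Sum>\<^sub>\<infinity>A\<in>{A \<in> nz_ideals K. C A}. f A) = (\<Sum>\<^sub>\<infinity>M\<in>{M \<in> pmsets. C (iprod M)}. f (iprod M))" (is ?inf)
  and summable_ideals_iprod: "f summable_on {A \<in> nz_ideals K. C A} \<longleftrightarrow> (\<lambda>M. f (iprod M)) summable_on {M \<in> pmsets. C (iprod M)}" (is ?sum)
proof -
  have bij: "bij_betw iprod {M \<in> pmsets. C (iprod M)} {A \<in> nz_ideals K. C A}"
    unfolding bij_betw_def
  proof
    have img: "iprod ` pmsets = nz_ideals K" and inj: "inj_on iprod pmsets"
      using bij_betw_iprod by (auto simp: bij_betw_def)
    show "inj_on iprod {M \<in> pmsets. C (iprod M)}" by (rule inj_on_subset[OF inj]) auto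
    show "iprod ` {M \<in> pmsets. C (iprod M)} = {A \<in> nz_ideals K. C A}" unfolding img[symmetric] by auto
  qed
  show ?inf by (rule infsum_reindex_bij_betw[OF bij, symmetric])
  show ?sum by (rule summable_on_reindex_bij_betw[OF bij, symmetric])
qed

lemma
  fixes F :: "'a set \<Rightarrow> 'a set \<Rightarrow> complex"
  shows infsum_pairs_iprod: "(\<Sum>\<^sub>\<infinity>(A, B)\<in>{(A, B). A \<in> nz_ideals K \<and> B \<in> nz_ideals K \<and> C A}. F A B)
      = (\<Sum>\<^sub>\<infinity>(M, N)\<in>{(M, N). M \<in> pmsets \<and> N \<in> pmsets \<and> C (iprod M)}. F (iprod M) (iprod N))" (is ?inf)
    and summable_pairs_iprod: "(\<lambda>(A, B). F A B) summable_on {(A, B). A \<in> nz_ideals K \<and> B \<in> nz_ideals K \<and> C A}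
      \<longleftrightarrow> (\<lambda>(M, N). F (iprod M) (iprod N)) summable_on {(M, N). M \<in> pmsets \<and> N \<in> pmsets \<and> C (iprod M)}" (is ?sum)
proof -
  have img: "iprod ` pmsets = nz_ideals K" and inj: "inj_on iprod pmsets"
    using bij_betw_iprod by (auto simp: bij_betw_def)
  let ?S = "{(M, N). M \<in> pmsets \<and> N \<in> pmsets \<and> C (iprod M)}" and ?T = "{(A, B). A \<in> nz_ideals K \<and> B \<in> nz_ideals K \<and> C A}"
  have bij: "bij_betw (\<lambda>(M, N). (iprod M, iprod N)) ?S
     ?T"
    unfolding bij_betw_def
  proof
    show "inj_on (\<lambda>(M, N). (iprod M, iprod N)) ?S"
      using iprod_inj by (auto simp: inj_on_def)
    show "(\<lambda>(M, N). (iprod M, iprod N)) ` ?S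
      = ?T"
      unfolding img[symmetric] by (auto simp: image_iff)
  qed
  show ?inf
    using infsum_reindex_bij_betw[OF bij, of "\<lambda>(A, B). F A B"] by (simp add: case_prod_unfold)
  show ?sum
    using summable_on_reindex_bij_betw[OF bij, of "\<lambda>(A, B). F A B"] by (simp add: case_prod_unfold)
qed

end

section \<open>Transport of the hypotheses from ideals to multisets of primes\<close>

locale sieve_data = numfield K for K :: "'a::field_char_0 set" +
  fixes x X Y \<iota> \<mu> \<kappa> M R R1 :: real and \<omega> \<omega>' :: "'a set \<Rightarrow> real" and c :: "'a set \<Rightarrow> complex"
  assumes x: "x \<ge> 3"
    and w: "\<forall>w\<in>{\<omega>, \<omega>'}. (\<forall>\<nn>\<in>nz_ideals K. w \<nn> \<ge> 0) \<and>
         sum_bounded_by (\<lambda>\<nn>. real (divisor_fun K 5 \<nn>) * w \<nn>) (nz_ideals K) X"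
    and Y: "Y > 1" and \<mu>: "0 \<le> \<iota>" "\<iota> \<le> \<mu>" "\<mu> < 1" and \<kappa>: "0 < \<kappa>" "\<kappa> \<le> 1 / 2" and M: "x powr \<mu> \<le> M"
    and hyp: "\<forall>(a :: 'a set \<Rightarrow> complex) (b :: 'a set \<Rightarrow> complex).
         (\<forall>\<aa>\<in>nz_ideals K. cmod (a \<aa>) \<le> real (divisor_fun K 3 \<aa>)) \<longrightarrow>
         (\<forall>\<bb>\<in>nz_ideals K. cmod (b \<bb>) \<le> real (divisor_fun K 3 \<bb>)) \<longrightarrow>
         sum_bounded_by
           (\<lambda>(\<aa>, \<bb>). a \<aa> *
              complex_of_real (\<omega> (ideal_mult K \<aa> \<bb>) - \<omega>' (ideal_mult K \<aa> \<bb>)))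
           {(\<aa>, \<bb>). \<aa> \<in> nz_ideals K \<and> \<bb> \<in> nz_ideals K \<and> real (abs_norm K \<aa>) \<le> M} Y \<and>
         sum_bounded_by
           (\<lambda>(\<aa>, \<bb>). a \<aa> * b \<bb> *
              complex_of_real (\<omega> (ideal_mult K \<aa> \<bb>) - \<omega>' (ideal_mult K \<aa> \<bb>)))
           {(\<aa>, \<bb>). \<aa> \<in> nz_ideals K \<and> \<bb> \<in> nz_ideals K \<and>
              x powr (\<mu> - \<iota>) \<le> real (abs_norm K \<aa>) \<and>
              real (abs_norm K \<aa>) \<le> x powr (\<mu> + \<kappa>)} Y"
    and c: "\<forall>\<rr>\<in>nz_ideals K. cmod (c \<rr>) \<le> 1"
    and R1: "R1 \<le> 2 * R"
    and big: "R > x powr (\<mu> + \<kappa>) / 2 \<longrightarrow>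
         2 * R \<le> x powr (1 - \<mu>) \<and> x powr (1 - \<mu>) \<le> M \<and>
         (\<forall>w\<in>{\<omega>, \<omega>'}.
            sum_bounded_by (\<lambda>\<aa>. real (divisor_fun K 5 \<aa>) * w \<aa>)
              {\<aa> \<in> nz_ideals K. real (abs_norm K \<aa>) \<notin> {x powr (1 - \<iota>)..x}} Y)"
begin

definition v where "v n = \<omega> (iprod n) - \<omega>' (iprod n)"

lemma w_nonneg: "u \<in> {\<omega>, \<omega>'} \<Longrightarrow> n \<in> pmsets \<Longrightarrow> 0 \<le> u (iprod n)"
  using w pmsets_nz by blast

lemma w_summable:
  assumes "u \<in> {\<omega>, \<omega>'}"
  shows "(\<lambda>n. real (tau 5 n) * u (iprod n)) summable_on pmsets"
proof -
  have "(\<lambda>\<nn>. real (divisor_fun K 5 \<nn>) * u \<nn>) summable_on nz_ideals K"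
    using w assms unfolding sum_bounded_by_def by blast
  then have "(\<lambda>n. real (divisor_fun K 5 (iprod n)) * u (iprod n)) summable_on pmsets"
    unfolding summable_on_reindex_bij_betw[OF bij_betw_iprod, of "\<lambda>\<nn>. real (divisor_fun K 5 \<nn>) * u \<nn>"] .
  then show ?thesis by (rule summable_on_cong[THEN iffD1, rotated]) (simp add: divisor_fun_iprod)
qed

sublocale W: weighted "nz_primes K" "abs_norm K" v
proof
  show "1 \<le> abs_norm K p" if "p \<in> nz_primes K" for p using abs_norm_prime_ge2[OF that] by simp
  have s: "(\<lambda>n. real (tau 5 n) * \<omega> (iprod n) + real (tau 5 n) * \<omega>' (iprod n)) summable_on pmsets"
    by (intro summable_on_add w_summable) auto
  show "(\<lambda>n. real (tau 5 n) * v n) abs_summable_on pmsets"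
  proof (rule summable_on_comparison_test[OF s])
    fix n assume n: "n \<in> pmsets"
    have "\<bar>v n\<bar> \<le> \<omega> (iprod n) + \<omega>' (iprod n)" using w_nonneg[of \<omega> n] w_nonneg[of \<omega>' n] n unfolding v_def by auto
    then have "real (tau 5 n) * \<bar>v n\<bar> \<le> real (tau 5 n) * (\<omega> (iprod n) + \<omega>' (iprod n))" by (intro mult_left_mono) auto
    then show "norm (real (tau 5 n) * v n) \<le> real (tau 5 n) * \<omega> (iprod n) + real (tau 5 n) * \<omega>' (iprod n)"
      by (simp add: abs_mult distrib_left)
  qed simp
qed

lemma W_I: "W.I = pmsets" by (simp add: W.I_def)

lemma W_N: "m \<in> pmsets \<Longrightarrow> abs_norm K (iprod m) = W.N m"
  by (simp add: abs_norm_iprod W.N_def)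

lemma pair_hyp:
  assumes s: "sum_bounded_by (\<lambda>(\<aa>, \<bb>). F \<aa> \<bb> * complex_of_real (\<omega> (ideal_mult K \<aa> \<bb>) - \<omega>' (ideal_mult K \<aa> \<bb>)))
      {(\<aa>, \<bb>). \<aa> \<in> nz_ideals K \<and> \<bb> \<in> nz_ideals K \<and> C \<aa>} Y"
    and F: "\<And>m n. m \<in> pmsets \<Longrightarrow> n \<in> pmsets \<Longrightarrow> F (iprod m) (iprod n) = G m n"
    and C: "\<And>m. m \<in> pmsets \<Longrightarrow> C (iprod m) = D m"
  shows "cmod (W.T (\<lambda>n. \<Sum>a\<in>subms n. G a (n - a) * of_bool (D a))) \<le> Y"
proof -
  let ?H = "\<lambda>\<aa> \<bb>. F \<aa> \<bb> * complex_of_real (\<omega> (ideal_mult K \<aa> \<bb>) - \<omega>' (ideal_mult K \<aa> \<bb>))"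
  let ?S = "{(a, b). a \<in> W.I \<and> b \<in> W.I \<and> D a}"
  have S: "{(m, n). m \<in> pmsets \<and> n \<in> pmsets \<and> C (iprod m)} = ?S" using C W_I by auto
  have eq: "?H (iprod m) (iprod n) = G m n * complex_of_real (v (m + n))" if "m \<in> pmsets" "n \<in> pmsets" for m n
    using F[OF that] iprod_plus[OF that] by (simp add: v_def)
  have eq': "(case z of (m, n) \<Rightarrow> ?H (iprod m) (iprod n)) = (case z of (a, b) \<Rightarrow> G a b * complex_of_real (v (a + b)))"
    if "z \<in> ?S" for z using that eq W_I by (auto simp del: of_real_diff)
  have "(\<lambda>(m, n). ?H (iprod m) (iprod n)) summable_on ?S"
    using s unfolding sum_bounded_by_def summable_pairs_iprod[of ?H C] S by blast
  then have sm: "(\<lambda>(a, b). G a b * complex_of_real (v (a + b))) summable_on ?S"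
    using summable_on_cong[where f = "\<lambda>(m, n). ?H (iprod m) (iprod n)" and A = ?S
        and g = "\<lambda>(a, b). G a b * complex_of_real (v (a + b))", OF eq'] by blast
  have "(\<Sum>\<^sub>\<infinity>(a, b)\<in>?S. G a b * complex_of_real (v (a + b))) = (\<Sum>\<^sub>\<infinity>(\<aa>, \<bb>)\<in>{(\<aa>, \<bb>). \<aa> \<in> nz_ideals K \<and> \<bb> \<in> nz_ideals K \<and> C \<aa>}. ?H \<aa> \<bb>)"
    unfolding infsum_pairs_iprod[of ?H C] S by (rule infsum_cong[symmetric]) (rule eq')
  then have "cmod (\<Sum>\<^sub>\<infinity>(a, b)\<in>?S. G a b * complex_of_real (v (a + b))) \<le> Y"
    using s unfolding sum_bounded_by_def by simp
  then show ?thesis unfolding W.T_pair_sum[OF sm] .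
qed

text \<open>The hypotheses speak of coefficients on ideals; coefficients on multisets are carried
  over along the inverse of \<open>iprod\<close>.\<close>

definition lft :: "('a set multiset \<Rightarrow> complex) \<Rightarrow> 'a set \<Rightarrow> complex" where
  "lft A \<aa> = A (inv_into pmsets iprod \<aa>)"

lemma lft_iprod: "m \<in> pmsets \<Longrightarrow> lft A (iprod m) = A m"
proof -
  assume "m \<in> pmsets"
  then have "inv_into pmsets iprod (iprod m) = m"
    using bij_betw_iprod unfolding bij_betw_def by (intro inv_into_f_f) auto
  then show ?thesis by (simp add: lft_def)
qed

lemma lft_bound:
  assumes "\<And>m. cmod (A m) \<le> real (tau 3 m)"
  shows "\<forall>\<aa>\<in>nz_ideals K. cmod (lft A \<aa>) \<le> real (divisor_fun K 3 \<aa>)"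
proof
  fix \<aa> assume "\<aa> \<in> nz_ideals K"
  then obtain m where "m \<in> pmsets" "\<aa> = iprod m" using iprod_surj by blast
  then show "cmod (lft A \<aa>) \<le> real (divisor_fun K 3 \<aa>)" using assms[of m] by (simp add: lft_iprod divisor_fun_iprod)
qed

text \<open>Common form of \<open>sieve_S\<close> and \<open>sieve_\<Phi>\<close>, which differ only
  in the set of primes multiplied.\<close>

definition sifted where
  "sifted Q \<rr> u = (\<Sum>\<^sub>\<infinity>\<aa>\<in>{\<aa> \<in> nz_ideals K. coprime_ideals K \<aa> (finprod (ideals_set (ring_of_integers K)) (\<lambda>\<pp>. \<pp>) Q)}.
     complex_of_real (u (ideal_mult K \<aa> \<rr>)))"

definition range_R where "range_R = {\<rr>. \<rr> \<in> nz_ideals K \<and> R \<le> real (abs_norm K \<rr>) \<and> real (abs_norm K \<rr>) < R1}"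

definition S where "S = {r \<in> pmsets. R \<le> real (W.N r) \<and> real (W.N r) < R1}"

lemma finite_range_R: "finite range_R"
proof (rule finite_subset[OF _ finite_ideals_of_bounded_norm])
  show "range_R \<subseteq> {A \<in> nz_ideals K. abs_norm K A \<le> nat \<lfloor>R1\<rfloor>}"
    unfolding range_R_def by (auto simp: le_nat_floor)
qed

lemma bij_S: "bij_betw iprod S range_R"
proof -
  have img: "iprod ` pmsets = nz_ideals K" and inj: "inj_on iprod pmsets"
    using bij_betw_iprod by (auto simp: bij_betw_def)
  have "inj_on iprod S" by (rule inj_on_subset[OF inj]) (auto simp: S_def)
  moreover have "iprod ` S = range_R"
    unfolding S_def range_R_def img[symmetric] using W_N by auto
  ultimately show ?thesis by (simp add: bij_betw_def)
qed

lemma finite_S: "finite S"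
  using bij_S finite_range_R bij_betw_finite by blast

lemma sifted_iprod:
  assumes "finite Q" "Q \<subseteq> nz_primes K" "r \<in> pmsets"
  shows "sifted Q (iprod r) u = (\<Sum>\<^sub>\<infinity>a\<in>{a \<in> W.I. \<forall>p\<in>Q. p \<notin># a}. complex_of_real (u (iprod (a + r))))"
proof -
  have Q: "mset_set Q \<in> pmsets" using assms by auto
  have "sifted Q (iprod r) u = (\<Sum>\<^sub>\<infinity>a\<in>{a \<in> pmsets. coprime_ideals K (iprod a) (iprod (mset_set Q))}. complex_of_real (u (ideal_mult K (iprod a) (iprod r))))"
    unfolding sifted_def finprod_primes[OF assms(1,2)] infsum_ideals_iprod ..
  also have "{a \<in> pmsets. coprime_ideals K (iprod a) (iprod (mset_set Q))} = {a \<in> W.I. \<forall>p\<in>Q. p \<notin># a}"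
    using coprime_iff[OF _ Q] assms(1) W_I by auto
  also have "(\<Sum>\<^sub>\<infinity>a\<in>\<dots>. complex_of_real (u (ideal_mult K (iprod a) (iprod r)))) =
      (\<Sum>\<^sub>\<infinity>a\<in>{a \<in> W.I. \<forall>p\<in>Q. p \<notin># a}. complex_of_real (u (iprod (a + r))))"
    using iprod_plus[OF _ assms(3)] W_I by (intro infsum_cong) auto
  finally show ?thesis .
qed

lemma shifted_summable:
  assumes "u \<in> {\<omega>, \<omega>'}" "r \<in> pmsets"
  shows "(\<lambda>a. complex_of_real (u (iprod (a + r)))) summable_on {a \<in> W.I. C a}"
proof -
  have 1: "(\<lambda>n. u (iprod n)) summable_on pmsets"
  proof (rule summable_on_comparison_test[OF w_summable[OF assms(1)]])
    fix n assume n: "n \<in> pmsets"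
    have "1 * u (iprod n) \<le> real (tau 5 n) * u (iprod n)"
      using tau5_pos[of n] w_nonneg[OF assms(1) n] by (intro mult_right_mono) auto
    then show "u (iprod n) \<le> real (tau 5 n) * u (iprod n)" by simp
    show "0 \<le> u (iprod n)" by (rule w_nonneg[OF assms(1) n])
  qed
  have "(\<lambda>a. a + r) ` {a \<in> W.I. C a} \<subseteq> pmsets" using assms(2) W_I by auto
  then have "(\<lambda>n. u (iprod n)) summable_on (\<lambda>a. a + r) ` {a \<in> W.I. C a}"
    by (rule summable_on_subset_banach[OF 1])
  then have "(\<lambda>a. u (iprod (a + r))) summable_on {a \<in> W.I. C a}"
    by (subst (asm) summable_on_reindex) (auto simp: o_def inj_on_def)
  then show ?thesis by (rule summable_on_of_real)
qed

lemma sieve_bound: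
  assumes Q: "finite Q" "Q \<subseteq> nz_primes K" "\<And>p. p \<in> Q \<Longrightarrow> real (abs_norm K p) < x powr \<kappa>"
    and L: "card Q + 2 \<le> 2 ^ L" "x < 2 ^ L"
  shows "cmod ((\<Sum>\<rr>\<in>range_R. c \<rr> * sifted Q \<rr> \<omega>) - (\<Sum>\<rr>\<in>range_R. c \<rr> * sifted Q \<rr> \<omega>'))
     \<le> (3 + real L + real L * real L) * Y" (is "cmod ?lhs \<le> _")
proof -
  obtain idx where idx: "bij_betw idx Q {..<card Q}"
    using ex_bij_betw_finite_nat[OF Q(1)] by (auto simp: atLeast0LessThan)
  have x0: "x > 0" "x \<ge> 1" using x by auto
  interpret Sv: sieve "nz_primes K" "abs_norm K" v Q idx M "x powr (\<mu> - \<iota>)" "x powr (\<mu> + \<kappa>)" "x powr \<kappa>" Y L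
  proof unfold_locales
    show "finite Q" "bij_betw idx Q {..<card Q}" "Q \<subseteq> nz_primes K" "card Q + 2 \<le> 2 ^ L" by fact+
    show "real (abs_norm K p) \<le> x powr \<kappa>" if "p \<in> Q" for p using Q(3)[OF that] by simp
    show "x powr \<kappa> > 0" using x0 by simp
    fix A :: "'a set multiset \<Rightarrow> complex" assume A: "\<And>m. cmod (A m) \<le> real (tau 3 m)"
    have z: "\<forall>\<bb>\<in>nz_ideals K. cmod 0 \<le> real (divisor_fun K 3 \<bb>)" by simp
    have "sum_bounded_by (\<lambda>(\<aa>, \<bb>). lft A \<aa> * complex_of_real (\<omega> (ideal_mult K \<aa> \<bb>) - \<omega>' (ideal_mult K \<aa> \<bb>)))
           {(\<aa>, \<bb>). \<aa> \<in> nz_ideals K \<and> \<bb> \<in> nz_ideals K \<and> real (abs_norm K \<aa>) \<le> M} Y"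
      \<comment> \<open>The hypothesis couples two sequences; choosing 0 for the second gives access
        to the first bound alone.\<close>
      using hyp[rule_format, OF lft_bound[OF A, rule_format], of "\<lambda>_. 0"] by simp
    then show "cmod (W.T (\<lambda>n. \<Sum>a\<in>subms n. A a * of_bool (real (W.N a) \<le> M))) \<le> Y"
      by (rule pair_hyp[where G = "\<lambda>a _. A a"]) (simp_all add: lft_iprod W_N)
    fix B :: "'a set multiset \<Rightarrow> complex" assume B: "\<And>m. cmod (B m) \<le> real (tau 3 m)"
    have "sum_bounded_by (\<lambda>(\<aa>, \<bb>). lft A \<aa> * lft B \<bb> * complex_of_real (\<omega> (ideal_mult K \<aa> \<bb>) - \<omega>' (ideal_mult K \<aa> \<bb>)))
           {(\<aa>, \<bb>). \<aa> \<in> nz_ideals K \<and> \<bb> \<in> nz_ideals K \<and> x powr (\<mu> - \<iota>) \<le> real (abs_norm K \<aa>) \<and>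
              real (abs_norm K \<aa>) \<le> x powr (\<mu> + \<kappa>)} Y"
      using hyp lft_bound[OF A] lft_bound[OF B] by blast
    then show "cmod (W.T (\<lambda>n. \<Sum>a\<in>subms n. A a * B (n - a) *
        of_bool (x powr (\<mu> - \<iota>) \<le> real (W.N a) \<and> real (W.N a) \<le> x powr (\<mu> + \<kappa>)))) \<le> Y"
      by (rule pair_hyp[where G = "\<lambda>a b. A a * B b"]) (simp_all add: lft_iprod W_N)
  qed
  define g where "g r = c (iprod r) * of_bool (r \<in> S)" for r
  have g1: "cmod (g r) \<le> 1" for r using c pmsets_nz by (auto simp: g_def S_def norm_mult)
  have "?lhs
     = (\<Sum>r\<in>S. c (iprod r) * (sifted Q (iprod r) \<omega> - sifted Q (iprod r) \<omega>'))"
    unfolding sum.reindex_bij_betw[OF bij_S, symmetric] by (simp add: sum_subtractf right_diff_distrib)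
  also have "\<dots> = (\<Sum>r\<in>S. c (iprod r) * (\<Sum>\<^sub>\<infinity>a\<in>{a \<in> W.I. Sv.free a}. complex_of_real (v (a + r))))"
  proof (rule sum.cong)
    fix r assume "r \<in> S"
    then have r: "r \<in> pmsets" by (simp add: S_def)
    have "sifted Q (iprod r) \<omega> - sifted Q (iprod r) \<omega>' = (\<Sum>\<^sub>\<infinity>a\<in>{a \<in> W.I. Sv.free a}. complex_of_real (v (a + r)))"
    proof -
      let ?A = "{a \<in> W.I. \<forall>p\<in>Q. p \<notin># a}"
      let ?u = "\<lambda>u a. complex_of_real (u (iprod (a + r)))"
      have s: "?u u summable_on ?A" if "u \<in> {\<omega>, \<omega>'}" for u
        by (rule shifted_summable[OF that r])
      have "(\<Sum>\<^sub>\<infinity>a\<in>?A. ?u \<omega> a + (-1) * ?u \<omega>' a)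
        = infsum (?u \<omega>) ?A + (\<Sum>\<^sub>\<infinity>a\<in>?A. (-1) * ?u \<omega>' a)"
        by (intro infsum_add summable_on_cmult_right s) auto
      also have "(\<Sum>\<^sub>\<infinity>a\<in>?A. (-1) * ?u \<omega>' a) = (-1) * infsum (?u \<omega>') ?A"
        by (rule infsum_cmult_right')
      finally show ?thesis unfolding sifted_iprod[OF Q(1,2) r] Sv.free_def v_def by simp
    qed
    then show "c (iprod r) * (sifted Q (iprod r) \<omega> - sifted Q (iprod r) \<omega>') =
      c (iprod r) * (\<Sum>\<^sub>\<infinity>a\<in>{a \<in> W.I. Sv.free a}. complex_of_real (v (a + r)))" by simp
  qed simp
  also have "\<dots> = W.T (Sv.sft g)"
    unfolding g_def Sv.sft_def by (rule W.sifted_eq_T[OF finite_S]) (auto simp: W_I S_def)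
  finally have eq: "?lhs
     = W.T (Sv.sft g)" .
  show ?thesis
  proof (cases "R > x powr (\<mu> + \<kappa>) / 2")
    case False
    \<comment> \<open>With z = x^\<mu> the overshoot by x^\<kappa> ends exactly at the upper end of
      the Type II range, and 2R <= x^(\<mu>+\<kappa>) keeps the norms of the \<open>r\<close> below
      it.\<close>
    have "cmod (W.T (Sv.sft g)) \<le> (2 + real L) * Y"
    proof (rule Sv.sieve_small[of "x powr \<mu>"])
      show "x powr (\<mu> - \<iota>) \<le> x powr \<mu>" using x0 \<mu> by (intro powr_mono) auto
      show "x powr \<mu> \<le> M" by (rule M)
      show "x powr \<mu> * x powr \<kappa> \<le> x powr (\<mu> + \<kappa>)" by (simp add: powr_add)
      show "real (W.N r) \<le> x powr (\<mu> + \<kappa>)" if "g r \<noteq> 0" for r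
        using that False R1 by (auto simp: g_def S_def)
    qed (rule g1)
    also have "\<dots> \<le> (3 + real L + real L * real L) * Y" using Y by (intro mult_right_mono) auto
    finally show ?thesis unfolding eq .
  next
    case True
    then have b: "2 * R \<le> x powr (1 - \<mu>)" "x powr (1 - \<mu>) \<le> M"
      "\<And>u. u \<in> {\<omega>, \<omega>'} \<Longrightarrow> sum_bounded_by (\<lambda>\<aa>. real (divisor_fun K 5 \<aa>) * u \<aa>)
              {\<aa> \<in> nz_ideals K. real (abs_norm K \<aa>) \<notin> {x powr (1 - \<iota>)..x}} Y"
      using big by blast+
    \<comment> \<open>With z = x^(1-\<mu>) the interval in \<open>sieve_large\<close> becomes
      [x^(1-\<iota>), x], the one in the extra hypothesis; each of the two weights contributes Y
      from outside it.\<close>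
    have "cmod (W.T (Sv.sft g)) \<le> (1 + real L * real L) * Y + 2 * Y"
    proof (rule Sv.sieve_large[of "x powr (1 - \<mu>)"])
      show "0 < x powr (1 - \<mu>)" using x0 by simp
      show "x powr (1 - \<mu>) \<le> M" by (rule b)
      have "x powr (1 - \<mu>) \<le> x powr 1" using x0 \<mu> by (intro powr_mono) auto
      then show "x powr (1 - \<mu>) < 2 ^ L" using x0 L(2) by simp
      show "real (W.N r) \<le> x powr (1 - \<mu>)" if "g r \<noteq> 0" for r
        using that b(1) R1 by (auto simp: g_def S_def)
      have lo: "x powr (1 - \<mu>) * x powr (\<mu> - \<iota>) = x powr (1 - \<iota>)" by (simp flip: powr_add)
      have "x powr (1 - \<mu>) * x powr (\<mu> + \<kappa>) / x powr \<kappa> = x powr 1"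
        by (simp flip: powr_add powr_diff)
      then have hi: "x powr (1 - \<mu>) * x powr (\<mu> + \<kappa>) / x powr \<kappa> = x" using x0 by simp
      let ?t = "\<lambda>u n. real (tau 5 n) * u (iprod n)"
      let ?O = "{n \<in> pmsets. real (abs_norm K (iprod n)) \<notin> {x powr (1 - \<iota>)..x}}"
      have O: "{n \<in> W.I. real (W.N n) \<notin> {x powr (1 - \<iota>)..x}} = ?O" using W_I W_N by auto
      have u: "(?t u) summable_on ?O"
        "(\<Sum>\<^sub>\<infinity>n\<in>?O. ?t u n) \<le> Y" if "u \<in> {\<omega>, \<omega>'}" for u
      proof -
        let ?d = "\<lambda>n. real (divisor_fun K 5 (iprod n)) * u (iprod n)"
        have e: "?d n = ?t u n" if "n \<in> ?O" for n
          using that by (simp add: divisor_fun_iprod)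
        have "?d summable_on ?O"
          using b(3)[OF that] unfolding sum_bounded_by_def summable_ideals_iprod by blast
        then show "(?t u) summable_on ?O"
          using summable_on_cong[where f = ?d and A = ?O
            and g = "?t u", OF e] by blast
        have "\<bar>infsum ?d ?O\<bar> \<le> Y"
          using b(3)[OF that] unfolding sum_bounded_by_def infsum_ideals_iprod by simp
        then show "(\<Sum>\<^sub>\<infinity>n\<in>?O. ?t u n) \<le> Y"
          using infsum_cong[where f = ?d and A = ?O
            and g = "?t u", OF e] by linarith
      qed
      have "(\<Sum>\<^sub>\<infinity>n\<in>?O. real (tau 5 n) * \<bar>v n\<bar>) \<le> (\<Sum>\<^sub>\<infinity>n\<in>?O. ?t \<omega> n + ?t \<omega>' n)"
      proof (rule infsum_mono)
        show sm: "(\<lambda>n. ?t \<omega> n + ?t \<omega>' n) summable_on ?O"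
          by (intro summable_on_add u) auto
        show le: "real (tau 5 n) * \<bar>v n\<bar> \<le> ?t \<omega> n + ?t \<omega>' n" if "n \<in> ?O" for n
        proof -
          have "\<bar>v n\<bar> \<le> \<omega> (iprod n) + \<omega>' (iprod n)" using w_nonneg[of \<omega> n] w_nonneg[of \<omega>' n] that unfolding v_def by auto
          then show ?thesis unfolding distrib_left[symmetric] by (intro mult_left_mono) auto
        qed
        show "(\<lambda>n. real (tau 5 n) * \<bar>v n\<bar>) summable_on ?O"
          using sm le by (rule summable_on_comparison_test) auto
      qed
      also have "\<dots> = (\<Sum>\<^sub>\<infinity>n\<in>?O. ?t \<omega> n) + (\<Sum>\<^sub>\<infinity>n\<in>?O. ?t \<omega>' n)"
        by (rule infsum_add) (intro u; simp)+
      also have "\<dots> \<le> Y + Y" by (intro add_mono u) auto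
      finally show "(\<Sum>\<^sub>\<infinity>n\<in>{n \<in> W.I. real (W.N n) \<notin> {x powr (1 - \<mu>) * x powr (\<mu> - \<iota>)..x powr (1 - \<mu>) * x powr (\<mu> + \<kappa>) / x powr \<kappa>}}.
          real (tau 5 n) * \<bar>v n\<bar>) \<le> 2 * Y"
        unfolding lo hi O by simp
    qed (rule g1)
    also have "\<dots> = (3 + 0 + real L * real L) * Y" by (simp add: algebra_simps)
    also have "\<dots> \<le> (3 + real L + real L * real L) * Y" using Y by (intro mult_right_mono) auto
    finally show ?thesis unfolding eq .
  qed
qed

end

section \<open>Logarithmic size of the number of digits, and the theorem\<close>

lemma (in numfield) log_card_bound:
  "\<exists>C1\<ge>0. \<forall>x\<ge>3. \<exists>L. real (card gens) * x + 2 \<le> 2 ^ L \<and> x < 2 ^ L \<and> real L \<le> C1 * ln x"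
proof -
  \<comment> \<open>The summand 3 makes a x at least \<open>card gens\<close> x + 2 and larger than
    x.\<close>
  define a where "a = real (card gens) + 3"
  have a: "a \<ge> 3" by (simp add: a_def)
  \<comment> \<open>Comes from log 2 (a x) + 1, where ln x >= 1 absorbs the constants ln a and
    1.\<close>
  define C1 where "C1 = (ln a + 1) / ln 2 + 1"
  have "C1 \<ge> 0" unfolding C1_def using a by simp
  moreover have "\<exists>L. real (card gens) * x + 2 \<le> 2 ^ L \<and> x < 2 ^ L \<and> real L \<le> C1 * ln x" if x: "x \<ge> 3" for x :: real
  proof -
    define L where "L = nat \<lceil>log 2 (a * x)\<rceil>"
    have ax: "a * x \<ge> 1" using mult_mono[of 1 a 1 x] a x by simp
    then have l0: "log 2 (a * x) \<ge> 0" by simp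
    have "a * x = 2 powr (log 2 (a * x))" using ax by simp
    also have "\<dots> \<le> 2 powr (real L)" unfolding L_def by (intro powr_mono) (auto simp: real_nat_ceiling_ge)
    also have "\<dots> = 2 ^ L" by (simp add: powr_realpow)
    finally have L: "a * x \<le> 2 ^ L" .
    have ln1: "ln x \<ge> 1"
    proof -
      have "exp 1 \<le> x" using exp_le x by linarith
      then show ?thesis using ln_ge_iff[of x 1] x by simp
    qed
    have "real L \<le> log 2 (a * x) + 1" unfolding L_def using l0 by linarith
    also have "log 2 (a * x) = (ln a + ln x) / ln 2" using a x by (simp add: log_def ln_mult)
    also have "(ln a + ln x) / ln 2 \<le> (ln a * ln x + ln x) / ln 2"
    proof -
      have "ln a * 1 \<le> ln a * ln x" using ln1 a by (intro mult_left_mono) auto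
      then show ?thesis by (intro divide_right_mono) auto
    qed
    also have "(ln a * ln x + ln x) / ln 2 + 1 \<le> (ln a * ln x + ln x) / ln 2 + ln x" using ln1 by simp
    also have "\<dots> = C1 * ln x" unfolding C1_def by (simp add: algebra_simps add_divide_distrib)
    finally have "real L \<le> C1 * ln x" by simp
    moreover have "a * x = real (card gens) * x + 3 * x" by (simp add: a_def algebra_simps)
    moreover have "real (card gens) * x \<ge> 0" using x by simp
    ultimately show ?thesis using L x by (intro exI[of _ L]) linarith
  qed
  ultimately show ?thesis by blast
qed

text \<open>Norms are below x^\<kappa> with \<kappa> <= 1/2, so the square in
  \<open>card_primes_of_bounded_norm\<close> is at most x.\<close>

lemma (in numfield) card_primes_le:
  fixes x :: real
  assumes "x \<ge> 3" "0 < \<kappa>" "\<kappa> \<le> 1 / 2" "Q \<subseteq> nz_primes K" "\<And>p. p \<in> Q \<Longrightarrow> real (abs_norm K p) < x powr \<kappa>"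
  shows "finite Q" "real (card Q) \<le> real (card gens) * x"
proof -
  define n where "n = nat \<lfloor>x powr \<kappa>\<rfloor>"
  have sub: "Q \<subseteq> {P \<in> nz_primes K. abs_norm K P \<le> n}"
  proof
    fix p assume p: "p \<in> Q"
    then have "abs_norm K p \<le> n" unfolding n_def using assms(5)[OF p] by (intro le_nat_floor) simp
    then show "p \<in> {P \<in> nz_primes K. abs_norm K P \<le> n}" using p assms(4) by auto
  qed
  have fin: "finite {P \<in> nz_primes K. abs_norm K P \<le> n}"
    by (rule finite_subset[OF _ finite_ideals_of_bounded_norm[of n]]) (use primes_subset_ideals in auto)
  then show "finite Q" using sub finite_subset by blast
  have "card Q \<le> n * (n * card gens)"
    using card_mono[OF fin sub] card_primes_of_bounded_norm[of n] by linarith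
  then have "real (card Q) \<le> real n * (real n * real (card gens))" by (metis of_nat_le_iff of_nat_mult)
  also have "\<dots> = real n * real n * real (card gens)" by simp
  also have "real n * real n \<le> x"
  proof -
    have "real n \<le> x powr \<kappa>" unfolding n_def by simp
    then have "real n * real n \<le> x powr \<kappa> * x powr \<kappa>" by (intro mult_mono) auto
    also have "\<dots> = x powr (2 * \<kappa>)" by (simp flip: powr_add)
    also have "\<dots> \<le> x powr 1" using assms by (intro powr_mono) auto
    finally show ?thesis using assms(1) by simp
  qed
  finally show "real (card Q) \<le> real (card gens) * x" by (simp add: mult_right_mono mult.commute)
qed

theorem theorem6:
  fixes K :: "'a::field_char_0 set"
  assumes "number_field K"
  shows "\<exists>C>0. \<forall>prec. prime_order K prec \<longrightarrow>
    (\<forall>(x::real) (X::real) (Y::real) (\<iota>::real) (\<mu>::real) (\<kappa>::real) (M::real) (R::real) (R\<^sub>1::real)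
      (\<omega> :: 'a set \<Rightarrow> real) (\<omega>' :: 'a set \<Rightarrow> real) (c :: 'a set \<Rightarrow> complex).
      x \<ge> 3 \<longrightarrow> X \<ge> 1 \<longrightarrow>
      (\<forall>w\<in>{\<omega>, \<omega>'}.
         (\<forall>\<nn>\<in>nz_ideals K. w \<nn> \<ge> 0) \<and>
         sum_bounded_by (\<lambda>\<nn>. real (divisor_fun K 5 \<nn>) * w \<nn>) (nz_ideals K) X) \<longrightarrow>
      Y > 1 \<longrightarrow> 0 \<le> \<iota> \<longrightarrow> \<iota> \<le> \<mu> \<longrightarrow> \<mu> < 1 \<longrightarrow> 0 < \<kappa> \<longrightarrow> \<kappa> \<le> 1 / 2 \<longrightarrow>
      x powr \<mu> \<le> M \<longrightarrow> M < x \<longrightarrow>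
      (\<forall>(a :: 'a set \<Rightarrow> complex) (b :: 'a set \<Rightarrow> complex).
         (\<forall>\<aa>\<in>nz_ideals K. cmod (a \<aa>) \<le> real (divisor_fun K 3 \<aa>)) \<longrightarrow>
         (\<forall>\<bb>\<in>nz_ideals K. cmod (b \<bb>) \<le> real (divisor_fun K 3 \<bb>)) \<longrightarrow>
         sum_bounded_by
           (\<lambda>(\<aa>, \<bb>). a \<aa> *
              complex_of_real (\<omega> (ideal_mult K \<aa> \<bb>) - \<omega>' (ideal_mult K \<aa> \<bb>)))
           {(\<aa>, \<bb>). \<aa> \<in> nz_ideals K \<and> \<bb> \<in> nz_ideals K \<and> real (abs_norm K \<aa>) \<le> M} Y \<and>
         sum_bounded_by
           (\<lambda>(\<aa>, \<bb>). a \<aa> * b \<bb> *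
              complex_of_real (\<omega> (ideal_mult K \<aa> \<bb>) - \<omega>' (ideal_mult K \<aa> \<bb>)))
           {(\<aa>, \<bb>). \<aa> \<in> nz_ideals K \<and> \<bb> \<in> nz_ideals K \<and>
              x powr (\<mu> - \<iota>) \<le> real (abs_norm K \<aa>) \<and>
              real (abs_norm K \<aa>) \<le> x powr (\<mu> + \<kappa>)} Y) \<longrightarrow>
      (\<forall>\<rr>\<in>nz_ideals K. cmod (c \<rr>) \<le> 1) \<longrightarrow>
      R > 1 / 2 \<longrightarrow> R < R\<^sub>1 \<longrightarrow> R\<^sub>1 \<le> 2 * R \<longrightarrow>
      (R > x powr (\<mu> + \<kappa>) / 2 \<longrightarrow>
         2 * R \<le> x powr (1 - \<mu>) \<and> x powr (1 - \<mu>) \<le> M \<and>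
         (\<forall>w\<in>{\<omega>, \<omega>'}.
            sum_bounded_by (\<lambda>\<aa>. real (divisor_fun K 5 \<aa>) * w \<aa>)
              {\<aa> \<in> nz_ideals K. real (abs_norm K \<aa>) \<notin> {x powr (1 - \<iota>)..x}} Y)) \<longrightarrow>
      (\<forall>\<qq>\<in>nz_primes K.
         (\<forall>\<pp>\<in>nz_primes K. prec \<pp> \<qq> \<longrightarrow> real (abs_norm K \<pp>) < x powr \<kappa>) \<longrightarrow>
         cmod
           ((\<Sum>\<rr> | \<rr> \<in> nz_ideals K \<and> R \<le> real (abs_norm K \<rr>) \<and> real (abs_norm K \<rr>) < R\<^sub>1.
               c \<rr> * sieve_\<Phi> K prec \<rr> (\<lambda>\<nn>. complex_of_real (\<omega> \<nn>)) \<qq>) -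
            (\<Sum>\<rr> | \<rr> \<in> nz_ideals K \<and> R \<le> real (abs_norm K \<rr>) \<and> real (abs_norm K \<rr>) < R\<^sub>1.
               c \<rr> * sieve_\<Phi> K prec \<rr> (\<lambda>\<nn>. complex_of_real (\<omega>' \<nn>)) \<qq>))
         \<le> C * (Y * ln (x * X) ^ 3)) \<and>
      cmod
        ((\<Sum>\<rr> | \<rr> \<in> nz_ideals K \<and> R \<le> real (abs_norm K \<rr>) \<and> real (abs_norm K \<rr>) < R\<^sub>1.
            c \<rr> * sieve_S K \<rr> (\<lambda>\<nn>. complex_of_real (\<omega> \<nn>)) (x powr \<kappa>)) -
         (\<Sum>\<rr> | \<rr> \<in> nz_ideals K \<and> R \<le> real (abs_norm K \<rr>) \<and> real (abs_norm K \<rr>) < R\<^sub>1.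
            c \<rr> * sieve_S K \<rr> (\<lambda>\<nn>. complex_of_real (\<omega>' \<nn>)) (x powr \<kappa>)))
      \<le> C * (Y * ln (x * X) ^ 3))"
proof -
  interpret numfield K by unfold_locales (rule assms)
  obtain C1 where C1: "C1 \<ge> 0" "\<forall>x\<ge>3. \<exists>L. real (card gens) * x + 2 \<le> 2 ^ L \<and> x < 2 ^ L \<and> real L \<le> C1 * ln x"
    using log_card_bound by blast
  \<comment> \<open>One summand for each of the terms 3, L and L * L of \<open>sieve_bound\<close>:
    L is at most C1 times ln (x X), and this logarithm is at least 1.\<close>
  define C where "C = 3 + C1 + C1 * C1"
  have "C > 0" unfolding C_def using C1(1) by (simp add: add_pos_nonneg)
  then show ?thesis
  proof (intro exI[of _ C] conjI[of "C > 0"] allI impI, assumption, goal_cases)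
    case hyps: (1 prec x X Y \<iota> \<mu> \<kappa> M R R\<^sub>1 \<omega> \<omega>' c)
    note x = hyps(3) and X = hyps(4) and h = hyps(6,10,11)
    interpret D: sieve_data K x X Y \<iota> \<mu> \<kappa> M R R\<^sub>1 \<omega> \<omega>' c
      using hyps by unfold_locales
    let ?\<Delta> = "\<lambda>Q. (\<Sum>\<rr>\<in>D.range_R. c \<rr> * D.sifted Q \<rr> \<omega>) - (\<Sum>\<rr>\<in>D.range_R. c \<rr> * D.sifted Q \<rr> \<omega>')"
    have bound: "cmod (?\<Delta> Q)
        \<le> C * (Y * ln (x * X) ^ 3)"
      if Q: "Q \<subseteq> nz_primes K" "\<And>p. p \<in> Q \<Longrightarrow> real (abs_norm K p) < x powr \<kappa>" for Q
    proof -
      note cQ = card_primes_le[OF x h(2,3) Q]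
      obtain L where L: "real (card gens) * x + 2 \<le> 2 ^ L" "x < 2 ^ L" "real L \<le> C1 * ln x" using C1(2) x by blast
      have "real (card Q + 2) \<le> real (2 ^ L)" using cQ(2) L(1) by simp
      then have "card Q + 2 \<le> 2 ^ L" by (simp only: of_nat_le_iff)
      then have "cmod (?\<Delta> Q)
        \<le> (3 + real L + real L * real L) * Y"
        by (intro D.sieve_bound cQ(1) Q L(2))
      also have "3 + real L + real L * real L \<le> C * ln (x * X) ^ 3"
      proof -
        define t where "t = ln (x * X)"
        have "exp 1 \<le> x" using exp_le x by linarith
        then have "1 \<le> ln x" using ln_ge_iff[of x 1] x by simp
        moreover have "ln x \<le> t" unfolding t_def using x X by (simp add: ln_mult)
        ultimately have t: "1 \<le> t" "real L \<le> C1 * t"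
          using L(3) mult_left_mono[of "ln x" t C1] C1(1) by linarith+
        have t3: "1 \<le> t ^ 3" "t \<le> t ^ 3" "t ^ 2 \<le> t ^ 3"
          using t(1) power_increasing[of 1 3 t] power_increasing[of 2 3 t] by (simp_all add: one_le_power)
        have "real L * real L \<le> (C1 * t) * (C1 * t)" using t C1(1) by (intro mult_mono) auto
        also have "\<dots> = C1 * C1 * t ^ 2" by (simp add: power2_eq_square)
        also have "\<dots> \<le> C1 * C1 * t ^ 3" using t3 C1(1) by (intro mult_left_mono) auto
        finally have "real L * real L \<le> C1 * C1 * t ^ 3" .
        moreover have "real L \<le> C1 * t ^ 3" using t(2) mult_left_mono[OF t3(2) C1(1)] by linarith
        ultimately show ?thesis unfolding C_def t_def[symmetric] using t3(1) by (simp add: algebra_simps)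
      qed
      finally show ?thesis using h(1) by (simp add: mult_ac mult_right_mono)
    qed
    show ?case
    proof (intro conjI ballI impI, goal_cases)
      case (1 \<qq>)
      have "cmod (?\<Delta> {\<pp> \<in> nz_primes K. prec \<pp> \<qq>})
        \<le> C * (Y * ln (x * X) ^ 3)"
        by (rule bound) (use 1 in auto)
      then show ?case
        unfolding D.range_R_def D.sifted_def sieve_\<Phi>_def prime_prod_prec_def .
    next
      case 2
      have "cmod (?\<Delta> {\<pp> \<in> nz_primes K. real (abs_norm K \<pp>) < x powr \<kappa>})
        \<le> C * (Y * ln (x * X) ^ 3)"
        by (rule bound) auto
      then show ?case
        unfolding D.range_R_def D.sifted_def sieve_S_def prime_prod_norm_def .
    qed
  qed
qed

end
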